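(* Let $n\ge1$, $\alpha\in(0,1)$ and $p\in\left[1,\frac{n}{n-\alpha}\right)$. If $f\in BV^{\alpha,p}_+(\mathbb{R}^n)$, then $$\int_{\mathbb{R}^n}f(x)\,w_{n,\alpha}(|x-x_0|,r)\,dx\le|D^\alpha f|\big(\mathbb{R}^n\setminus B_r(x_0)\big)$$ for all $x_0\in\mathbb{R}^n$ and $r>0$, where $$w_{n,\alpha}(t,r)=\frac{(n-1)\,\omega_{n-1}}{n\,\omega_n}\,\frac{\mu_{1,\alpha}}{\alpha}\int_{-1}^{1}\frac{(1-s^2)^{\frac{n-3}{2}}}{|st-r|^\alpha}\,ds\quad\text{for }n\ge2,$$ $$w_{1,\alpha}(t,r)=\frac{\mu_{1,\alpha}}{2\alpha}\left(\frac{1}{|t-r|^\alpha}+\frac{1}{|t+r|^\alpha}\right)\quad\text{for }n=1.$$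
   Context: Let $\mu_{n,\alpha}=2^{\alpha}\pi^{-n/2}\,\Gamma\left(\frac{n+\alpha+1}{2}\right)/\Gamma\left(\frac{1-\alpha}{2}\right)$; $\omega_n$ is the volume of the unit ball of $\mathbb{R}^n$; $B_r(x_0)$ is the open ball. For $\varphi\in \mathrm{Lip}_c(\mathbb{R}^n;\mathbb{R}^n)$ (compactly supported Lipschitz), the fractional $\alpha$-divergence is $$\mathrm{div}^\alpha\varphi(x)=\mu_{n,\alpha}\int_{\mathbb{R}^n}\frac{(y-x)\cdot(\varphi(y)-\varphi(x))}{|y-x|^{n+\alpha+1}}\,dy,\quad x\in\mathbb{R}^n.$$ For $p\in[1,+\infty]$ and $f\in L^p(\mathbb{R}^n)$ let $$|D^\alpha f|(\mathbb{R}^n)=\sup\left\{\int_{\mathbb{R}^n} f\,\mathrm{div}^\alpha\varphi\,dx:\varphi\in C^\infty_c(\mathbb{R}^n;\mathbb{R}^n),\ \|\varphi\|_{L^\infty(\mathbb{R}^n;\mathbb{R}^n)}\le1\right\},$$ $BV^{\alpha,p}(\mathbb{R}^n)=\{f\in L^p(\mathbb{R}^n):|D^\alpha f|(\mathbb{R}^n)<+\infty\}$ and $BV^{\alpha,p}_+(\mathbb{R}^n)=\{f\in BV^{\alpha,p}(\mathbb{R}^n):f\ge0\}$. A function $f\in L^p(\mathbb{R}^n)$ belongs to $BV^{\alpha,p}(\mathbb{R}^n)$ if and only if there is a (unique) finite $\mathbb{R}^n$-valued Radon measure $D^\alpha f$ on $\mathbb{R}^n$ with $\int_{\mathbb{R}^n}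 f\,\mathrm{div}^\alpha\varphi\,dx=-\int_{\mathbb{R}^n}\varphi\cdot dD^\alpha f$ for all $\varphi\in \mathrm{Lip}_c(\mathbb{R}^n;\mathbb{R}^n)$; $|D^\alpha f|$ denotes its total variation measure. *)

theory Defs
  imports "HOL-Analysis.Analysis"
begin

definition frac_mu :: "nat \<Rightarrow> real \<Rightarrow> real" where
  "frac_mu n \<alpha> = 2 powr \<alpha> * pi powr (- (real n / 2)) *
     Gamma ((real n + \<alpha> + 1) / 2) / Gamma ((1 - \<alpha>) / 2)"


subsection \<open>Test fields and the fractional divergence\<close>

definition compactly_supported :: "('a::topological_space \<Rightarrow> 'b::zero) \<Rightarrow> bool" where
  "compactly_supported \<phi> \<longleftrightarrow> compact (closure {x. \<phi> x \<noteq> 0})"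

definition Lip_c :: "(real^'n \<Rightarrow> real^'n) set" where
  "Lip_c = {\<phi>. (\<exists>L. L-lipschitz_on UNIV \<phi>) \<and> compactly_supported \<phi>}"

text \<open>Class \<open>C\<^sup>k\<close> on the whole space: \<open>k\<close> successive (total) differentiations along
  arbitrary directions are possible and the last derivatives are continuous.\<close>

primrec C_k :: "nat \<Rightarrow> ('a::real_normed_vector \<Rightarrow> 'b::real_normed_vector) \<Rightarrow> bool" where
  "C_k 0 g \<longleftrightarrow> continuous_on UNIV g"
| "C_k (Suc k) g \<longleftrightarrow> (\<forall>x. g differentiable (at x)) \<and>
     (\<forall>v. C_k k (\<lambda>x. frechet_derivative g (at x) v))"

definition C_c_infinity :: "(real^'n \<Rightarrow> real^'n) set" where
  "C_c_infinity = {\<phi>. (\<forall>k. C_k k \<phi>) \<and> compactly_supported \<phi>}"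

text \<open>At \<open>y = x\<close> the integrand is \<open>0 / 0 = 0\<close>, which concerns a null set only. For
  \<open>\<phi>\<close> in \<open>Lip_c\<close> and \<open>0 < \<alpha> < 1\<close> the integral converges absolutely.\<close>

definition frac_div :: "real \<Rightarrow> (real^'n \<Rightarrow> real^'n) \<Rightarrow> real^'n \<Rightarrow> real" where
  "frac_div \<alpha> \<phi> x = frac_mu CARD('n) \<alpha> *
     (LINT y|lborel. ((y - x) \<bullet> (\<phi> y - \<phi> x)) / norm (y - x) powr (real CARD('n) + \<alpha> + 1))"


subsection \<open>The spaces\<close>

text \<open>Functions stand for their classes modulo equality almost everywhere; only finite
  exponents \<open>p\<close> are covered.\<close>

definition L_p :: "real \<Rightarrow> (real^'n \<Rightarrow> real) set" where
  "L_p p = {f. f \<in> borel_measurable lebesgue \<and> integrable lebesgue (\<lambda>x. \<bar>f x\<bar> powr p)}"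

definition frac_variation :: "real \<Rightarrow> (real^'n \<Rightarrow> real) \<Rightarrow> ereal" where
  "frac_variation \<alpha> f =
     (SUP \<phi> \<in> {\<phi> \<in> C_c_infinity. AE x in lebesgue. norm (\<phi> x) \<le> 1}.
        ereal (LINT x|lebesgue. f x * frac_div \<alpha> \<phi> x))"

definition BV :: "real \<Rightarrow> real \<Rightarrow> (real^'n \<Rightarrow> real) set" where
  "BV \<alpha> p = {f \<in> L_p p. frac_variation \<alpha> f < \<infinity>}"

definition BV_plus :: "real \<Rightarrow> real \<Rightarrow> (real^'n \<Rightarrow> real) set" where
  "BV_plus \<alpha> p = {f \<in> BV \<alpha> p. AE x in lebesgue. 0 \<le> f x}"


subsection \<open>Vector-valued measures\<close>

text \<open>A vector-valued measure is a set function of which only the values on Borel sets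
  matter.\<close>

definition total_variation ::
    "('a::topological_space set \<Rightarrow> 'b::real_normed_vector) \<Rightarrow> 'a set \<Rightarrow> ennreal" where
  "total_variation \<nu> E =
     (SUP A \<in> {A :: nat \<Rightarrow> 'a set. range A \<subseteq> sets borel \<and> disjoint_family A \<and> (\<Union>i. A i) = E}.
        (\<Sum>i. ennreal (norm (\<nu> (A i)))))"

text \<open>The condition on disjoint sequences entails \<open>\<nu> {} = 0\<close>. On a Euclidean space
  every finite Borel measure is a Radon measure.\<close>

definition finite_vector_measure ::
    "('a::topological_space set \<Rightarrow> 'b::real_normed_vector) \<Rightarrow> bool" where
  "finite_vector_measure \<nu> \<longleftrightarrow>
     (\<forall>A :: nat \<Rightarrow> 'a set. range A \<subseteq> sets borel \<longrightarrow> disjoint_family A \<longrightarrow>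
        (\<lambda>i. \<nu> (A i)) sums \<nu> (\<Union>i. A i)) \<and>
     total_variation \<nu> UNIV < \<infinity>"

text \<open>Jordan decomposition \<open>\<mu>\<^sup>+ = (|\<mu>| + \<mu>) / 2\<close>; the negative part of \<open>\<mu>\<close> is
  the positive part of \<open>- \<mu>\<close>.\<close>

definition pos_part :: "('a::topological_space set \<Rightarrow> real) \<Rightarrow> 'a measure" where
  "pos_part \<mu> = measure_of UNIV (sets borel)
     (\<lambda>E. ennreal ((enn2real (total_variation \<mu> E) + \<mu> E) / 2))"

definition signed_integral ::
    "('a::topological_space set \<Rightarrow> real) \<Rightarrow> ('a \<Rightarrow> real) \<Rightarrow> real" where
  "signed_integral \<mu> g =
     (LINT x|pos_part \<mu>. g x) - (LINT x|pos_part (\<lambda>E. - \<mu> E). g x)"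

definition vector_integral ::
    "(real^'n \<Rightarrow> real^'n) \<Rightarrow> ((real^'n) set \<Rightarrow> real^'n) \<Rightarrow> real" where
  "vector_integral \<phi> \<nu> = (\<Sum>i\<in>UNIV. signed_integral (\<lambda>E. \<nu> E $ i) (\<lambda>x. \<phi> x $ i))"

text \<open>\<open>\<nu> = D\<^sup>\<alpha> f\<close>, as a relation; such a \<open>\<nu>\<close> is unique on Borel sets, and for \<open>f\<close> in
  \<open>L_p p\<close> it exists exactly when \<open>f\<close> lies in \<open>BV \<alpha> p\<close>.\<close>

definition has_frac_variation_measure ::
    "real \<Rightarrow> (real^'n \<Rightarrow> real) \<Rightarrow> ((real^'n) set \<Rightarrow> real^'n) \<Rightarrow> bool" where
  "has_frac_variation_measure \<alpha> f \<nu> \<longleftrightarrow>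
     finite_vector_measure \<nu> \<and>
     (\<forall>\<phi>\<in>Lip_c. (LINT x|lebesgue. f x * frac_div \<alpha> \<phi> x) = - vector_integral \<phi> \<nu>)"


subsection \<open>The weight\<close>

text \<open>The weight takes values in \<open>[0, \<infinity>]\<close>: for \<open>n = 2\<close>, \<open>\<alpha> \<ge> 1/2\<close> and \<open>t = r\<close> the
  integral over \<open>s\<close> diverges. For \<open>n = 1\<close> and \<open>t = r\<close> the convention \<open>1 / 0 = 0\<close> is
  in force, on the null set \<open>|x - x\<^sub>0| = r\<close> only.\<close>

definition weight :: "nat \<Rightarrow> real \<Rightarrow> real \<Rightarrow> real \<Rightarrow> ennreal" where
  "weight n \<alpha> t r =
     (if n = 1 then
        ennreal (frac_mu 1 \<alpha> / (2 * \<alpha>) * (1 / \<bar>t - r\<bar> powr \<alpha> + 1 / \<bar>t + r\<bar> powr \<alpha>))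
      else
        ennreal ((real n - 1) * unit_ball_vol (real n - 1) / (real n * unit_ball_vol (real n)) *
                 (frac_mu 1 \<alpha> / \<alpha>)) *
        (\<integral>\<^sup>+s\<in>{-1..1}. ennreal ((1 - s\<^sup>2) powr ((real n - 3) / 2) / \<bar>s * t - r\<bar> powr \<alpha>) \<partial>lborel))"

end

theory Submission
  imports Defs
begin

text \<open>For a unit vector \<open>v\<close>, the fractional divergence of \<open>v\<close> times the indicator of the half-space
  \<open>H = {y. r < (y - x0) \<bullet> v}\<close> is the one-dimensional profile
  \<open>\<mu>\<^sub>1 / (\<alpha> |(x - x0) \<bullet> v - r|\<^sup>\<alpha>)\<close>, and \<open>H\<close> avoids the ball, so formally \<open>f\<close> integrates this
  profile to at most \<open>|D\<^sup>\<alpha> f|\<close> of the complement of the ball. Averaging the profile over all directions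
  \<open>v\<close> gives the weight. To make the test field admissible, the indicator is replaced by a
  Lipschitz ramp \<open>g\<close> times a cut-off \<open>\<eta>\<close> at scale \<open>k\<close>. As \<open>g\<close> is monotone along \<open>v\<close>, its
  contribution has a nonnegative integrand and passes to the limit by Fatou's lemma. The error caused
  by \<open>\<eta>\<close> is nonlocal; it is bounded in the supremum norm by \<open>k\<^sup>-\<^sup>\<alpha>\<close> and in \<open>L\<^sup>1\<close> by
  \<open>k\<^sup>n\<^sup>-\<^sup>\<alpha>\<close> (up to constants), and tends to zero against \<open>f\<close> in \<open>L\<^sup>p\<close>
  because \<open>p < n / (n - \<alpha>)\<close>.\<close>

section \<open>Total variation and integrals against vector measures\<close>

text \<open>The profile carries the one-dimensional constant in every dimension because the
  indicator depends on one coordinate only: the angular part of the kernel integral is a Beta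
  function, whose Gamma factors turn \<open>frac_mu n \<alpha>\<close> into
  \<open>frac_mu 1 \<alpha>\<close>. The bound for a single v has a right-hand side that does not
  involve v, so every average over directions preserves it. In the uniform average, (x - x0)
  \<bullet> v becomes s |x - x0| with s the cosine of an angle, whose density is proportional to (1
  - s^2)^((n-3)/2); this is the shape of the weight. In dimension one the sphere consists of two
  points, hence the two terms there. The obstacle is that the indicator is neither Lipschitz nor
  compactly supported, while D is known only through its pairing with \<open>Lip_c\<close>. On the
  measure side, total variation is a supremum over partitions, so the pairing with a field of
  constant direction is estimated through the superlevel sets of its scalar factor.\<close>

lemma sum_norm_le_total_variation:
  assumes "range A \<subseteq> sets borel" "disjoint_family A" "(\<Union>i. A i) = E"
  shows "(\<Sum>i. ennreal (norm (\<nu> (A i)))) \<le> total_variation \<nu> E"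
  unfolding total_variation_def by (rule SUP_upper) (use assms in auto)

lemma total_variation_le:
  assumes "\<And>A. range A \<subseteq> sets borel \<Longrightarrow> disjoint_family A \<Longrightarrow> (\<Union>i. A i) = E \<Longrightarrow>
      (\<Sum>i. ennreal (norm (\<nu> (A i)))) \<le> c"
  shows "total_variation \<nu> E \<le> c"
  unfolding total_variation_def by (rule SUP_least) (use assms in auto)

lemma norm_le_total_variation:
  assumes "E \<in> sets borel"
  shows "ennreal (norm (\<nu> E)) \<le> total_variation \<nu> E"
proof -
  let ?A = "\<lambda>i::nat. if i = 0 then E else {}"
  have "ennreal (norm (\<nu> E)) = (\<Sum>i<1. ennreal (norm (\<nu> (?A i))))" by simp
  also have "\<dots> \<le> (\<Sum>i. ennreal (norm (\<nu> (?A i))))"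
    by (intro sum_le_suminf) auto
  also have "\<dots> \<le> total_variation \<nu> E"
    by (rule sum_norm_le_total_variation) (use assms in \<open>auto simp: disjoint_family_on_def split: if_splits\<close>)
  finally show ?thesis .
qed

text \<open>A partition of \<open>E\<close> and one of \<open>F\<close> interleave, on even and odd
  indices, into a partition of the union. The suprema over the two partitions are then taken one
  after the other.\<close>

lemma total_variation_superadditive:
  assumes E: "E \<in> sets borel" and F: "F \<in> sets borel" and EF: "E \<inter> F = {}"
  shows "total_variation \<nu> E + total_variation \<nu> F \<le> total_variation \<nu> (E \<union> F)"
proof -
  have *: "(\<Sum>i. ennreal (norm (\<nu> (A i)))) + (\<Sum>i. ennreal (norm (\<nu> (B i)))) \<le> total_variation \<nu> (E \<union> F)"
    if A: "range A \<subseteq> sets borel" "disjoint_family A" "(\<Union>i. A i) = E"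
      and B: "range B \<subseteq> sets borel" "disjoint_family B" "(\<Union>i. B i) = F" for A B :: "nat \<Rightarrow> 'a set"
  proof -
    define C where "C n = (if even n then A (n div 2) else B (n div 2))" for n
    have rC: "range C \<subseteq> sets borel" using A B by (auto simp: C_def)
    have dC: "disjoint_family C"
      unfolding disjoint_family_on_def
    proof (intro ballI impI)
      fix m n :: nat assume mn: "m \<noteq> n"
      have "A i \<inter> B j = {}" "B j \<inter> A i = {}" for i j using A(3) B(3) EF by blast+
      moreover have "A (m div 2) \<inter> A (n div 2) = {}" "B (m div 2) \<inter> B (n div 2) = {}"
        if "even m \<longleftrightarrow> even n"
      proof -
        have "m div 2 \<noteq> n div 2" using that mn by presburger
        then show "A (m div 2) \<inter> A (n div 2) = {}" "B (m div 2) \<inter> B (n div 2) = {}"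
          using A(2) B(2) by (simp_all add: disjoint_family_on_def)
      qed
      ultimately show "C m \<inter> C n = {}"
        unfolding C_def by presburger
    qed
    have uC: "(\<Union>i. C i) = E \<union> F"
    proof -
      have "A i = C (2 * i)" "B i = C (2 * i + 1)" for i by (auto simp: C_def)
      moreover have "C i \<subseteq> E \<union> F" for i using A(3) B(3) by (auto simp: C_def)
      ultimately show ?thesis using A(3) B(3) by (metis (lifting) SUP_le_iff UNIV_I UN_upper Un_subset_iff subset_antisym)
    qed
    \<comment> \<open>The first 2 N pieces of \<open>C\<close> are the first N pieces of
      \<open>A\<close> and of \<open>B\<close>, so partial sums of even length suffice.\<close>
    have fin: "(\<Sum>i<N. ennreal (norm (\<nu> (A i)))) + (\<Sum>i<N. ennreal (norm (\<nu> (B i)))) =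
       (\<Sum>i<2*N. ennreal (norm (\<nu> (C i))))" for N
      by (induction N) (auto simp: C_def ac_simps)
    have "(\<lambda>N. (\<Sum>i<N. ennreal (norm (\<nu> (A i)))) + (\<Sum>i<N. ennreal (norm (\<nu> (B i)))))
       \<longlonglongrightarrow> (\<Sum>i. ennreal (norm (\<nu> (A i)))) + (\<Sum>i. ennreal (norm (\<nu> (B i))))"
      by (intro tendsto_add summable_LIMSEQ) auto
    moreover have "(\<Sum>i<2*N. ennreal (norm (\<nu> (C i)))) \<le> total_variation \<nu> (E \<union> F)" for N
      by (rule order_trans[OF sum_le_suminf sum_norm_le_total_variation]) (use rC dC uC in auto)
    ultimately show ?thesis unfolding fin by (intro LIMSEQ_le_const2) auto
  qed
  \<comment> \<open>In \<open>ennreal\<close> an addend moves inside a supremum only over a nonempty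
    index set; \<open>E\<close> followed by empty sets is a partition of \<open>E\<close>.\<close>
  have ne: "{A :: nat \<Rightarrow> 'a set. range A \<subseteq> sets borel \<and> disjoint_family A \<and> (\<Union>i. A i) = E} \<noteq> {}"
    if "E \<in> sets borel" for E :: "'a set"
    using that by (auto intro!: exI[of _ "\<lambda>i::nat. if i = 0 then E else {}"] simp: disjoint_family_on_def split: if_splits)
  have **: "(\<Sum>i. ennreal (norm (\<nu> (A i)))) + total_variation \<nu> F \<le> total_variation \<nu> (E \<union> F)"
    if "range A \<subseteq> sets borel" "disjoint_family A" "(\<Union>i. A i) = E" for A :: "nat \<Rightarrow> 'a set"
    unfolding total_variation_def[of _ F] ennreal_SUP_add_right[OF ne[OF F]]
  proof (rule SUP_least)
    fix B :: "nat \<Rightarrow> 'a set"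
    assume "B \<in> {B. range B \<subseteq> sets borel \<and> disjoint_family B \<and> (\<Union>i. B i) = F}"
    then have B: "range B \<subseteq> sets borel" "disjoint_family B" "(\<Union>i. B i) = F" by simp_all
    show "(\<Sum>i. ennreal (norm (\<nu> (A i)))) + (\<Sum>i. ennreal (norm (\<nu> (B i)))) \<le> total_variation \<nu> (E \<union> F)"
      by (rule *[OF that B])
  qed
  show ?thesis
    unfolding total_variation_def[of _ E] ennreal_SUP_add_left[OF ne[OF E], symmetric]
  proof (intro SUP_least)
    fix A :: "nat \<Rightarrow> 'a set"
    assume "A \<in> {B. range B \<subseteq> sets borel \<and> disjoint_family B \<and> (\<Union>i. B i) = E}"
    then have A: "range A \<subseteq> sets borel" "disjoint_family A" "(\<Union>i. A i) = E" by simp_all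
    show "(\<Sum>i. ennreal (norm (\<nu> (A i)))) + total_variation \<nu> F \<le> total_variation \<nu> (E \<union> F)"
      by (rule **[OF A])
  qed
qed

lemma total_variation_mono:
  assumes "E \<in> sets borel" "F \<in> sets borel" "E \<subseteq> F"
  shows "total_variation \<nu> E \<le> total_variation \<nu> F"
proof -
  have "total_variation \<nu> E \<le> total_variation \<nu> E + total_variation \<nu> (F - E)" by simp
  also have "\<dots> \<le> total_variation \<nu> (E \<union> (F - E))"
    by (rule total_variation_superadditive) (use assms in auto)
  also have "E \<union> (F - E) = F" using assms by auto
  finally show ?thesis .
qed

lemma suminf_suminf_commute_ennreal:
  fixes f :: "nat \<Rightarrow> nat \<Rightarrow> ennreal"
  shows "(\<Sum>i. \<Sum>j. f i j) = (\<Sum>j. \<Sum>i. f i j)"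
proof -
  have "(\<Sum>i. \<Sum>j. f i j) = (\<integral>\<^sup>+i. (\<Sum>j. f i j) \<partial>count_space UNIV)"
    by (rule nn_integral_count_space_nat[symmetric])
  also have "\<dots> = (\<Sum>j. \<integral>\<^sup>+i. f i j \<partial>count_space UNIV)"
    by (rule nn_integral_suminf) auto
  finally show ?thesis by (simp add: nn_integral_count_space_nat)
qed

text \<open>One inequality is the limit of finite superadditivity. For the other, an arbitrary
  partition of the union is refined by the sets \<open>E j\<close>: countable additivity and the
  triangle inequality bound each piece by its refinement, and the double sum is then taken in the
  other order.\<close>

lemma total_variation_suminf:
  assumes ca: "\<And>A :: nat \<Rightarrow> 'a::topological_space set. range A \<subseteq> sets borel \<Longrightarrow> disjoint_family A \<Longrightarrow>
        (\<lambda>i. \<nu> (A i)) sums \<nu> (\<Union>i. A i)"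
    and E: "range E \<subseteq> sets borel" "disjoint_family E"
  shows "(\<Sum>j. total_variation \<nu> (E j)) = total_variation \<nu> (\<Union>j. E j)"
proof (rule antisym)
  have fin: "(\<Sum>j<N. total_variation \<nu> (E j)) \<le> total_variation \<nu> (\<Union>j<N. E j)" for N
  proof (induction N)
    case (Suc N)
    have "(\<Sum>j<Suc N. total_variation \<nu> (E j)) \<le> total_variation \<nu> (\<Union>j<N. E j) + total_variation \<nu> (E N)"
      using Suc by (simp add: add_right_mono)
    also have "\<dots> \<le> total_variation \<nu> ((\<Union>j<N. E j) \<union> E N)"
    proof (rule total_variation_superadditive)
      show "(\<Union>j<N. E j) \<in> sets borel" "E N \<in> sets borel"
        using E(1) by (auto intro!: sets.finite_UN)
      have "E j \<inter> E N = {}" if "j < N" for j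
        using E(2) that by (auto simp: disjoint_family_on_def)
      then show "(\<Union>j<N. E j) \<inter> E N = {}" by blast
    qed
    also have "(\<Union>j<N. E j) \<union> E N = (\<Union>j<Suc N. E j)" by (auto simp: less_Suc_eq)
    finally show ?case .
  qed simp
  show "(\<Sum>j. total_variation \<nu> (E j)) \<le> total_variation \<nu> (\<Union>j. E j)"
  proof (rule suminf_le_const)
    fix N
    show "(\<Sum>j<N. total_variation \<nu> (E j)) \<le> total_variation \<nu> (\<Union>j. E j)"
      by (rule order_trans[OF fin total_variation_mono]) (use E in \<open>auto intro!: sets.finite_UN sets.countable_UN\<close>)
  qed auto
next
  show "total_variation \<nu> (\<Union>j. E j) \<le> (\<Sum>j. total_variation \<nu> (E j))"
  proof (rule total_variation_le)
    fix A :: "nat \<Rightarrow> 'a set"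
    assume A: "range A \<subseteq> sets borel" "disjoint_family A" "(\<Union>i. A i) = (\<Union>j. E j)"
    \<comment> \<open>The triangle inequality for an infinite refinement: it holds for finite
      partial sums and survives the limit.\<close>
    have 1: "ennreal (norm (\<nu> (A i))) \<le> (\<Sum>j. ennreal (norm (\<nu> (A i \<inter> E j))))" for i
    proof -
      have "(\<lambda>j. \<nu> (A i \<inter> E j)) sums \<nu> (\<Union>j. A i \<inter> E j)"
      proof (rule ca)
        show "range (\<lambda>j. A i \<inter> E j) \<subseteq> sets borel" using A(1) E(1) by auto
        show "disjoint_family (\<lambda>j. A i \<inter> E j)" by (rule disjoint_family_subset[OF E(2)]) auto
      qed
      moreover have "(\<Union>j. A i \<inter> E j) = A i" using A(3) by auto
      ultimately have "(\<lambda>N. \<Sum>j<N. \<nu> (A i \<inter> E j)) \<longlonglongrightarrow> \<nu> (A i)" by (simp add: sums_def)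
      then have lim: "(\<lambda>N. ennreal (norm (\<Sum>j<N. \<nu> (A i \<inter> E j)))) \<longlonglongrightarrow> ennreal (norm (\<nu> (A i)))"
        by (intro tendsto_ennrealI tendsto_norm)
      have "ennreal (norm (\<Sum>j<N. \<nu> (A i \<inter> E j))) \<le> (\<Sum>j. ennreal (norm (\<nu> (A i \<inter> E j))))" for N
      proof -
        have "ennreal (norm (\<Sum>j<N. \<nu> (A i \<inter> E j))) \<le> (\<Sum>j<N. ennreal (norm (\<nu> (A i \<inter> E j))))"
          by (subst sum_ennreal) (auto intro!: ennreal_leI norm_sum)
        also have "\<dots> \<le> (\<Sum>j. ennreal (norm (\<nu> (A i \<inter> E j))))" by (rule sum_le_suminf) auto
        finally show ?thesis .
      qed
      then show ?thesis by (intro LIMSEQ_le_const2[OF lim]) blast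
    qed
    have "(\<Sum>i. ennreal (norm (\<nu> (A i)))) \<le> (\<Sum>i. \<Sum>j. ennreal (norm (\<nu> (A i \<inter> E j))))"
      by (intro suminf_le 1) auto
    also have "\<dots> = (\<Sum>j. \<Sum>i. ennreal (norm (\<nu> (A i \<inter> E j))))" by (rule suminf_suminf_commute_ennreal)
    also have "\<dots> \<le> (\<Sum>j. total_variation \<nu> (E j))"
    proof (intro suminf_le sum_norm_le_total_variation)
      fix j
      show "range (\<lambda>i. A i \<inter> E j) \<subseteq> sets borel" using A(1) E(1) by auto
      show "disjoint_family (\<lambda>i. A i \<inter> E j)" by (rule disjoint_family_subset[OF A(2)]) auto
      show "(\<Union>i. A i \<inter> E j) = E j" using A(3) by blast
    qed auto
    finally show "(\<Sum>i. ennreal (norm (\<nu> (A i)))) \<le> (\<Sum>j. total_variation \<nu> (E j))" .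
  qed
qed

section \<open>Finite vector measures and their components\<close>

lemma finite_vector_measure_sums:
  "finite_vector_measure \<nu> \<Longrightarrow> range A \<subseteq> sets borel \<Longrightarrow> disjoint_family A \<Longrightarrow>
     (\<lambda>i. \<nu> (A i)) sums \<nu> (\<Union>i. A i)"
  by (simp add: finite_vector_measure_def)

lemma total_variation_uminus: "total_variation (\<lambda>E. - \<nu> E) = total_variation \<nu>"
  by (simp add: total_variation_def fun_eq_iff)

lemma finite_vector_measure_uminus:
  "finite_vector_measure \<nu> \<Longrightarrow> finite_vector_measure (\<lambda>E. - \<nu> E)"
  by (simp add: finite_vector_measure_def total_variation_uminus sums_minus)

lemma finite_vector_measure_nth:
  fixes \<nu> :: "'a::topological_space set \<Rightarrow> real^'n"
  assumes "finite_vector_measure \<nu>"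
  shows "finite_vector_measure (\<lambda>E. \<nu> E $ i)"
proof -
  have "total_variation (\<lambda>E. \<nu> E $ i) UNIV \<le> total_variation \<nu> UNIV"
  proof (rule total_variation_le)
    fix A :: "nat \<Rightarrow> 'a set"
    assume A: "range A \<subseteq> sets borel" "disjoint_family A" "(\<Union>i. A i) = UNIV"
    have "(\<Sum>j. ennreal (norm (\<nu> (A j) $ i))) \<le> (\<Sum>j. ennreal (norm (\<nu> (A j))))"
      by (intro suminf_le ennreal_leI) (auto simp: component_le_norm_cart)
    also have "\<dots> \<le> total_variation \<nu> UNIV" by (rule sum_norm_le_total_variation[OF A])
    finally show "(\<Sum>j. ennreal (norm (\<nu> (A j) $ i))) \<le> total_variation \<nu> UNIV" .
  qed
  moreover have "(\<lambda>j. \<nu> (A j) $ i) sums (\<nu> (\<Union>j. A j) $ i)"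
    if "range A \<subseteq> sets borel" "disjoint_family A" for A :: "nat \<Rightarrow> 'a set"
  proof -
    have "(\<lambda>N. (\<Sum>j<N. \<nu> (A j)) $ i) \<longlonglongrightarrow> \<nu> (\<Union>j. A j) $ i"
      using finite_vector_measure_sums[OF assms that] unfolding sums_def by (rule tendsto_vec_nth)
    then show ?thesis by (simp add: sums_def)
  qed
  ultimately show ?thesis using assms by (auto simp: finite_vector_measure_def)
qed

lemma finite_total_variation:
  assumes "finite_vector_measure \<nu>" "E \<in> sets borel"
  shows "total_variation \<nu> E < \<infinity>"
proof -
  have "total_variation \<nu> E \<le> total_variation \<nu> UNIV"
    by (rule total_variation_mono) (use assms in auto)
  then show ?thesis using assms(1) by (auto simp: finite_vector_measure_def)
qed

lemma abs_le_enn2real_total_variation: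
  fixes \<mu> :: "'a::topological_space set \<Rightarrow> real"
  assumes "finite_vector_measure \<mu>" "E \<in> sets borel"
  shows "\<bar>\<mu> E\<bar> \<le> enn2real (total_variation \<mu> E)"
  using norm_le_total_variation[OF assms(2), of \<mu>] finite_total_variation[OF assms]
  by (metis abs_ge_zero enn2real_ennreal enn2real_mono infinity_ennreal_def real_norm_def)

section \<open>Jordan parts of a signed measure\<close>

lemma sets_pos_part [simp, measurable_cong]:
  fixes \<mu> :: "'a::topological_space set \<Rightarrow> real"
  shows "sets (pos_part \<mu>) = sets borel"
  unfolding pos_part_def using sets.sigma_sets_eq[of "borel :: 'a measure"] by (simp add: sets_measure_of)

lemma space_pos_part [simp]: "space (pos_part \<mu>) = UNIV"
  unfolding pos_part_def by (simp add: space_measure_of_conv)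

text \<open>\<open>measure_of\<close> yields the zero measure unless its set function is a measure,
  so positivity and countable additivity have to be checked. Finiteness of the total variation lets
  its additivity pass from \<open>ennreal\<close> to the reals, where it is added to that of
  \<mu>.\<close>

lemma emeasure_pos_part:
  fixes \<mu> :: "'a::topological_space set \<Rightarrow> real"
  assumes fin: "finite_vector_measure \<mu>" and E: "E \<in> sets borel"
  shows "emeasure (pos_part \<mu>) E = ennreal ((enn2real (total_variation \<mu> E) + \<mu> E) / 2)"
  unfolding pos_part_def
proof (rule emeasure_measure_of_sigma)
  show "sigma_algebra UNIV (sets (borel :: 'a measure))"
    using sets.sigma_algebra_axioms[of "borel :: 'a measure"] by simp
  have nn: "0 \<le> (enn2real (total_variation \<mu> F) + \<mu> F) / 2" if "F \<in> sets borel" for F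
    using abs_le_enn2real_total_variation[OF fin that] by simp
  have ca: "(\<lambda>i. (enn2real (total_variation \<mu> (A i)) + \<mu> (A i)) / 2) sums
      ((enn2real (total_variation \<mu> (\<Union>i. A i)) + \<mu> (\<Union>i. A i)) / 2)"
    if A: "range A \<subseteq> sets borel" "disjoint_family A" for A :: "nat \<Rightarrow> 'a set"
  proof -
    have f: "ennreal (enn2real (total_variation \<mu> F)) = total_variation \<mu> F" if "F \<in> sets borel" for F
      using finite_total_variation[OF fin that] by simp
    have Ai: "A i \<in> sets borel" for i using A by auto
    have "(\<lambda>i. total_variation \<mu> (A i)) sums total_variation \<mu> (\<Union>i. A i)"
      unfolding total_variation_suminf[OF finite_vector_measure_sums[OF fin] A, simplified, symmetric]
      by (rule summable_sums) auto
    then have "(\<lambda>i. ennreal (enn2real (total_variation \<mu> (A i)))) sums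
        ennreal (enn2real (total_variation \<mu> (\<Union>i. A i)))"
      using A by (simp add: f Ai sets.countable_UN)
    then have "(\<lambda>i. enn2real (total_variation \<mu> (A i))) sums enn2real (total_variation \<mu> (\<Union>i. A i))"
      by (subst (asm) sums_ennreal) auto
    then show ?thesis
      by (intro sums_divide sums_add finite_vector_measure_sums[OF fin] A)
  qed
  show "countably_additive (sets borel) (\<lambda>E. ennreal ((enn2real (total_variation \<mu> E) + \<mu> E) / 2))"
    unfolding countably_additive_def
    by (auto intro!: suminf_ennreal_eq ca nn)
  \<comment> \<open>Empty sets form a disjoint sequence, so this constant series converges, which
    forces its term to be zero.\<close>
  have "(\<lambda>i::nat. (enn2real (total_variation \<mu> {}) + \<mu> {}) / 2) sums
      ((enn2real (total_variation \<mu> {}) + \<mu> {}) / 2)"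
    using ca[of "\<lambda>_. {}"] by (simp add: disjoint_family_on_def)
  then have "(enn2real (total_variation \<mu> {}) + \<mu> {}) / 2 = 0"
    using sums_summable summable_const_iff by blast
  then show "positive (sets borel) (\<lambda>E. ennreal ((enn2real (total_variation \<mu> E) + \<mu> E) / 2))"
    by (simp add: positive_def)
qed (use E in auto)

lemma finite_measure_pos_part:
  "finite_vector_measure \<mu> \<Longrightarrow> finite_measure (pos_part \<mu>)"
  by (rule finite_measureI) (simp add: emeasure_pos_part)

lemma measure_pos_part_diff:
  fixes \<mu> :: "'a::topological_space set \<Rightarrow> real"
  assumes fin: "finite_vector_measure \<mu>" and E: "E \<in> sets borel"
  shows "measure (pos_part \<mu>) E - measure (pos_part (\<lambda>E. - \<mu> E)) E = \<mu> E"
  using abs_le_enn2real_total_variation[OF fin E]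
  by (simp add: measure_def emeasure_pos_part[OF fin E]
      emeasure_pos_part[OF finite_vector_measure_uminus[OF fin] E] total_variation_uminus field_simps)

text \<open>The discrete layer cake formula reduces integrals to values of the measure on
  superlevel sets.\<close>

lemma integral_layer_cake_LIMSEQ:
  fixes \<psi> :: "'a \<Rightarrow> real"
  assumes M: "finite_measure M" and [measurable]: "\<psi> \<in> borel_measurable M" and \<psi>: "\<And>x. 0 \<le> \<psi> x" "\<And>x. \<psi> x \<le> 1"
  shows "(\<lambda>k. (\<Sum>j=1..k. measure M {x \<in> space M. real j / real k \<le> \<psi> x}) / real k) \<longlonglongrightarrow> (LINT x|M. \<psi> x)"
proof -
  interpret finite_measure M by fact
  \<comment> \<open>Counting the levels j / k with j \<ge> 1 that do not exceed \<psi> x rounds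
    \<psi> x down to a multiple of 1 / k. Hence \<open>s k\<close> is within 1 / k of \<psi> for k >
    0 and is dominated by 1.\<close>
  define s where "s k x = (\<Sum>j=1..k. indicator {x \<in> space M. real j / real k \<le> \<psi> x} x) / real k" for k x
  have s: "s k x = real (nat \<lfloor>real k * \<psi> x\<rfloor>) / real k" if "x \<in> space M" "k > 0" for k x
  proof -
    have "(\<Sum>j=1..k. indicator {x \<in> space M. real j / real k \<le> \<psi> x} x) =
        (\<Sum>j=1..k. if real j / real k \<le> \<psi> x then 1 else 0 :: real)"
      by (rule sum.cong) (use that(1) in \<open>simp_all add: indicator_def\<close>)
    also have "\<dots> = (\<Sum>j\<in>{j\<in>{1..k}. real j / real k \<le> \<psi> x}. 1 :: real)"
      by (rule sum.inter_filter[symmetric]) simp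
    also have "{j\<in>{1..k}. real j / real k \<le> \<psi> x} = {1..nat \<lfloor>real k * \<psi> x\<rfloor>}"
    proof -
      have *: "{j\<in>{1..k}. P j} = {1..m}" if "\<And>j. P j \<longleftrightarrow> j \<le> m" "m \<le> k" for P and m :: nat
      proof -
        have "P = (\<lambda>j. j \<le> m)" using that(1) by blast
        then show ?thesis using that(2) by auto
      qed
      have "real j / real k \<le> \<psi> x \<longleftrightarrow> j \<le> nat \<lfloor>real k * \<psi> x\<rfloor>" for j
        using that(2) \<psi>(1)[of x] by (simp add: le_nat_iff le_floor_iff pos_divide_le_eq mult.commute)
      moreover have "nat \<lfloor>real k * \<psi> x\<rfloor> \<le> k"
        using mult_left_mono[OF \<psi>(2)[of x], of "real k"] by (simp add: nat_le_iff) linarith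
      ultimately show ?thesis by (intro *)
    qed
    finally show ?thesis by (simp add: s_def)
  qed
  have conv: "(\<lambda>k. s k x) \<longlonglongrightarrow> \<psi> x" if x: "x \<in> space M" for x
  proof (rule real_tendsto_sandwich)
    show "\<forall>\<^sub>F k in sequentially. \<psi> x - 1 / real k \<le> s k x"
      using eventually_gt_at_top[of 0]
    proof eventually_elim
      case (elim k)
      have "real k * \<psi> x - 1 \<le> real (nat \<lfloor>real k * \<psi> x\<rfloor>)"
        using \<psi>(1)[of x] by linarith
      then have "(real k * \<psi> x - 1) / real k \<le> real (nat \<lfloor>real k * \<psi> x\<rfloor>) / real k"
        by (rule divide_right_mono) simp
      then show ?case using elim unfolding s[OF x elim] by (simp add: diff_divide_distrib)
    qed
    show "\<forall>\<^sub>F k in sequentially. s k x \<le> \<psi> x"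
      using eventually_gt_at_top[of 0]
    proof eventually_elim
      case (elim k)
      have "real (nat \<lfloor>real k * \<psi> x\<rfloor>) \<le> real k * \<psi> x"
        using \<psi>(1)[of x] by (simp)
      then show ?case using elim unfolding s[OF x elim] by (simp add: field_simps)
    qed
    show "(\<lambda>k. \<psi> x - 1 / real k) \<longlonglongrightarrow> \<psi> x"
      using tendsto_diff[OF tendsto_const lim_1_over_n, of "\<psi> x"] by simp
  qed simp
  have "(\<lambda>k. LINT x|M. s k x) \<longlonglongrightarrow> (LINT x|M. \<psi> x)"
  proof (rule integral_dominated_convergence)
    show "integrable M (\<lambda>_. 1 :: real)" by simp
    show "AE x in M. norm (s k x) \<le> 1" for k
    proof (rule AE_I2)
      fix x assume x: "x \<in> space M"
      show "norm (s k x) \<le> 1"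
      proof (cases "k = 0")
        case False
        then have k: "k > 0" by simp
        have "real (nat \<lfloor>real k * \<psi> x\<rfloor>) \<le> real k * \<psi> x" using \<psi>(1)[of x] by simp
        also have "\<dots> \<le> real k" using \<psi>(2)[of x] by (simp add: mult_left_le)
        finally show ?thesis using k unfolding s[OF x k] by (simp add: divide_le_eq_1)
      qed (simp add: s_def)
    qed
  qed (use conv in \<open>auto simp: s_def\<close>)
  moreover have "(LINT x|M. s k x) = (\<Sum>j=1..k. measure M {x \<in> space M. real j / real k \<le> \<psi> x}) / real k" for k
  proof -
    have "(LINT x|M. s k x) = (\<Sum>j=1..k. LINT x|M. indicator {x \<in> space M. real j / real k \<le> \<psi> x} x) / real k"
      unfolding s_def by (simp, subst Bochner_Integration.integral_sum)
        (auto intro!: integrable_real_indicator simp: less_top[symmetric])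
    also have "\<dots> = (\<Sum>j=1..k. measure M {x \<in> space M. real j / real k \<le> \<psi> x}) / real k"
      by (intro arg_cong2[where f="(/)"] sum.cong refl) (auto intro!: arg_cong[where f="measure M"])
    finally show ?thesis .
  qed
  ultimately show ?thesis by simp
qed

text \<open>Subtracting the layer cake formulas of the two Jordan parts cancels the total variation
  on each superlevel set. Only values of \<mu> itself remain.\<close>

lemma signed_integral_LIMSEQ:
  fixes \<mu> :: "'a::topological_space set \<Rightarrow> real"
  assumes fin: "finite_vector_measure \<mu>" and [measurable]: "\<psi> \<in> borel_measurable borel"
    and \<psi>: "\<And>x. 0 \<le> \<psi> x" "\<And>x. \<psi> x \<le> 1"
  shows "(\<lambda>k. (\<Sum>j=1..k. \<mu> {x. real j / real k \<le> \<psi> x}) / real k) \<longlonglongrightarrow> signed_integral \<mu> \<psi>"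
proof -
  have "(\<lambda>k. (\<Sum>j=1..k. measure (pos_part \<mu>) {x \<in> space (pos_part \<mu>). real j / real k \<le> \<psi> x}) / real k -
      (\<Sum>j=1..k. measure (pos_part (\<lambda>E. - \<mu> E)) {x \<in> space (pos_part (\<lambda>E. - \<mu> E)). real j / real k \<le> \<psi> x}) / real k)
     \<longlonglongrightarrow> signed_integral \<mu> \<psi>"
    unfolding signed_integral_def
    by (intro tendsto_diff integral_layer_cake_LIMSEQ finite_measure_pos_part fin finite_vector_measure_uminus \<psi>)
      measurable
  then show ?thesis
    by (simp add: diff_divide_distrib[symmetric] sum_subtractf[symmetric] measure_pos_part_diff[OF fin])
qed

text \<open>Every superlevel set of \<psi> at a positive level lies in \<open>K\<close>, and there
  the component of \<nu> along v is at least minus the total variation of \<open>K\<close>, by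
  Cauchy-Schwarz. The integral is a limit of averages over such levels and inherits the
  bound.\<close>

lemma vector_integral_ge:
  fixes \<nu> :: "(real^'n) set \<Rightarrow> real^'n"
  assumes fin: "finite_vector_measure \<nu>" and [measurable]: "\<psi> \<in> borel_measurable borel"
    and \<psi>: "\<And>x. 0 \<le> \<psi> x" "\<And>x. \<psi> x \<le> 1"
    and K: "K \<in> sets borel" "\<And>x. \<psi> x \<noteq> 0 \<Longrightarrow> x \<in> K" and v: "norm v = 1"
  shows "ennreal (- vector_integral (\<lambda>x. \<psi> x *\<^sub>R v) \<nu>) \<le> total_variation \<nu> K"
proof -
  have eq: "vector_integral (\<lambda>x. \<psi> x *\<^sub>R v) \<nu> = (\<Sum>i\<in>UNIV. v $ i * signed_integral (\<lambda>E. \<nu> E $ i) \<psi>)"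
    by (simp add: vector_integral_def signed_integral_def algebra_simps)
  have "(\<lambda>k. \<Sum>i\<in>UNIV. v $ i * ((\<Sum>j=1..k. \<nu> {x. real j / real k \<le> \<psi> x} $ i) / real k))
      \<longlonglongrightarrow> vector_integral (\<lambda>x. \<psi> x *\<^sub>R v) \<nu>"
    unfolding eq by (intro tendsto_intros signed_integral_LIMSEQ finite_vector_measure_nth fin \<psi>) auto
  moreover have "(\<Sum>i\<in>UNIV. v $ i * ((\<Sum>j=1..k. \<nu> {x. real j / real k \<le> \<psi> x} $ i) / real k)) =
     (\<Sum>j=1..k. v \<bullet> \<nu> {x. real j / real k \<le> \<psi> x}) / real k" for k
  proof -
    have "(\<Sum>j=1..k. v \<bullet> \<nu> {x. real j / real k \<le> \<psi> x}) / real k = v \<bullet> (\<Sum>j=1..k. \<nu> {x. real j / real k \<le> \<psi> x}) / real k"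
      by (simp add: inner_sum_right)
    also have "\<dots> = (\<Sum>i\<in>UNIV. v $ i * ((\<Sum>j=1..k. \<nu> {x. real j / real k \<le> \<psi> x} $ i) / real k))"
      by (simp only: inner_vec_def inner_real_def sum_component times_divide_eq_right sum_divide_distrib[of _ UNIV])
    finally show ?thesis by (rule sym)
  qed
  ultimately have lim: "(\<lambda>k. (\<Sum>j=1..k. v \<bullet> \<nu> {x. real j / real k \<le> \<psi> x}) / real k) \<longlonglongrightarrow> vector_integral (\<lambda>x. \<psi> x *\<^sub>R v) \<nu>"
    by simp
  define T where "T = enn2real (total_variation \<nu> K)"
  have T: "ennreal T = total_variation \<nu> K" unfolding T_def
    using finite_total_variation[OF fin K(1)] by simp
  have T0: "T \<ge> 0" by (simp add: T_def)
  have "- T \<le> (\<Sum>j=1..k. v \<bullet> \<nu> {x. real j / real k \<le> \<psi> x}) / real k" for k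
  proof (cases "k = 0")
    case False
    \<comment> \<open>The levels start at j = 1: level zero would select the whole space instead of
      a part of \<open>K\<close>.\<close>
    have "- T \<le> v \<bullet> \<nu> {x. real j / real k \<le> \<psi> x}" if "j \<in> {1..k}" for j
    proof -
      have "{x. real j / real k \<le> \<psi> x} \<subseteq> K"
      proof
        fix x assume "x \<in> {x. real j / real k \<le> \<psi> x}"
        then have "\<psi> x \<ge> real j / real k" by simp
        moreover have "real j / real k > 0" using that by simp
        ultimately show "x \<in> K" using K(2)[of x] by linarith
      qed
      then have "ennreal (norm (\<nu> {x. real j / real k \<le> \<psi> x})) \<le> total_variation \<nu> K"
        by (intro order_trans[OF norm_le_total_variation total_variation_mono] K) auto
      then have "norm (\<nu> {x. real j / real k \<le> \<psi> x}) \<le> T"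
        unfolding T[symmetric] using T0 by simp
      moreover have "\<bar>v \<bullet> \<nu> {x. real j / real k \<le> \<psi> x}\<bar> \<le> norm (\<nu> {x. real j / real k \<le> \<psi> x})"
        using Cauchy_Schwarz_ineq2[of v] v by simp
      ultimately show ?thesis by linarith
    qed
    then have "(\<Sum>j=1..k. - T) \<le> (\<Sum>j=1..k. v \<bullet> \<nu> {x. real j / real k \<le> \<psi> x})" by (rule sum_mono)
    then show ?thesis using False by (simp add: field_simps)
  qed (use T0 in simp)
  then have "- T \<le> vector_integral (\<lambda>x. \<psi> x *\<^sub>R v) \<nu>"
    by (intro LIMSEQ_le_const[OF lim]) auto
  then show ?thesis unfolding T[symmetric] by (intro ennreal_leI) simp
qed

section \<open>Polar coordinates with respect to an axis\<close>

lemma nn_integral_lborel_affine: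
  fixes g :: "'a::euclidean_space \<Rightarrow> ennreal"
  assumes [measurable]: "g \<in> borel_measurable borel" and c: "c \<noteq> 0"
  shows "(\<integral>\<^sup>+x. g x \<partial>lborel) = ennreal (\<bar>c\<bar> ^ DIM('a)) * (\<integral>\<^sup>+x. g (t + c *\<^sub>R x) \<partial>lborel)"
  by (subst lborel_affine[OF c, of t]) (simp add: nn_integral_density nn_integral_distr nn_integral_cmult)

lemma nn_integral_lborel_translate:
  fixes g :: "'a::euclidean_space \<Rightarrow> ennreal"
  assumes "g \<in> borel_measurable borel"
  shows "(\<integral>\<^sup>+x. g (t + x) \<partial>lborel) = (\<integral>\<^sup>+x. g x \<partial>lborel)"
  using nn_integral_lborel_affine[OF assms, of 1 t] by simp

lemma nn_integral_lborel_reflect: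
  fixes g :: "'a::euclidean_space \<Rightarrow> ennreal"
  assumes "g \<in> borel_measurable borel"
  shows "(\<integral>\<^sup>+x. g (t - x) \<partial>lborel) = (\<integral>\<^sup>+x. g x \<partial>lborel)"
  using nn_integral_lborel_affine[OF assms, of "-1" t] by simp

text \<open>Weil's uniqueness argument for invariant measures, with the unit ball as the
  normalizing set.\<close>

lemma nn_integral_lborel_orthogonal:
  fixes g :: "'a::euclidean_space \<Rightarrow> ennreal" and f :: "'a \<Rightarrow> 'a"
  assumes [measurable]: "g \<in> borel_measurable borel" and f: "orthogonal_transformation f"
  shows "(\<integral>\<^sup>+x. g (f x) \<partial>lborel) = (\<integral>\<^sup>+x. g x \<partial>lborel)"
proof -
  let ?B = "indicator (ball 0 1) :: 'a \<Rightarrow> ennreal"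
  have lin: "linear f" using f by (rule orthogonal_transformation_linear)
  have [measurable]: "f \<in> borel_measurable borel"
    by (intro borel_measurable_continuous_onI linear_continuous_on linear_conv_bounded_linear[THEN iffD1] lin)
  have [measurable]: "ball (0::'a) 1 \<in> sets borel" by simp
  have Bf: "?B (f x) = ?B x" for x :: 'a
    using f by (simp add: indicator_def orthogonal_transformation_norm)
  have tr: "(\<integral>\<^sup>+y. ?B (t + y) \<partial>lborel) = (\<integral>\<^sup>+y. ?B y \<partial>lborel)" for t
    by (intro nn_integral_lborel_translate borel_measurable_indicator borel_open open_ball)
  have "(\<integral>\<^sup>+x. g (f x) \<partial>lborel) * (\<integral>\<^sup>+y. ?B y \<partial>lborel) = (\<integral>\<^sup>+x. g (f x) * (\<integral>\<^sup>+y. ?B (f x + y) \<partial>lborel) \<partial>lborel)"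
    by (simp only: tr) (rule nn_integral_multc[symmetric], measurable)
  also have "\<dots> = (\<integral>\<^sup>+x. \<integral>\<^sup>+y. g (f x) * ?B (f x + y) \<partial>lborel \<partial>lborel)"
    by (simp add: nn_integral_cmult)
  also have "\<dots> = (\<integral>\<^sup>+y. \<integral>\<^sup>+x. g (f x) * ?B (f x + y) \<partial>lborel \<partial>lborel)"
    by (rule lborel_pair.Fubini') measurable
  also have "\<dots> = (\<integral>\<^sup>+y. \<integral>\<^sup>+x. g (f x - y) * ?B (f x) \<partial>lborel \<partial>lborel)"
  proof (rule nn_integral_cong)
    fix y
    \<comment> \<open>Translating x by -w turns f x + y into f x and f x into f x - y. After another
      exchange the integral over y equals that of \<open>g\<close> for every x, and f leaves the
      indicator because the ball is invariant.\<close>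
    obtain w where w: "f w = y" using orthogonal_transformation_surj[OF f] by (metis surjD)
    have "(\<integral>\<^sup>+x. g (f x) * ?B (f x + y) \<partial>lborel) = (\<integral>\<^sup>+x. g (f (- w + x)) * ?B (f (- w + x) + y) \<partial>lborel)"
      by (rule nn_integral_lborel_translate[symmetric]) measurable
    then show "(\<integral>\<^sup>+x. g (f x) * ?B (f x + y) \<partial>lborel) = (\<integral>\<^sup>+x. g (f x - y) * ?B (f x) \<partial>lborel)"
      by (simp add: linear_add[OF lin] linear_neg[OF lin] linear_diff[OF lin] w)
  qed
  also have "\<dots> = (\<integral>\<^sup>+x. \<integral>\<^sup>+y. g (f x - y) * ?B (f x) \<partial>lborel \<partial>lborel)"
    by (rule lborel_pair.Fubini') measurable
  also have "\<dots> = (\<integral>\<^sup>+x. (\<integral>\<^sup>+y. g y \<partial>lborel) * ?B x \<partial>lborel)"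
    by (simp add: nn_integral_multc nn_integral_lborel_reflect Bf)
  also have "\<dots> = (\<integral>\<^sup>+x. g x \<partial>lborel) * (\<integral>\<^sup>+y. ?B y \<partial>lborel)"
    by (simp add: nn_integral_cmult)
  finally have eq: "(\<integral>\<^sup>+x. g (f x) \<partial>lborel) * (\<integral>\<^sup>+y. ?B y \<partial>lborel) = (\<integral>\<^sup>+x. g x \<partial>lborel) * (\<integral>\<^sup>+y. ?B y \<partial>lborel)" .
  have "(\<integral>\<^sup>+y. ?B y \<partial>lborel) = ennreal (unit_ball_vol DIM('a))"
    by (simp add: emeasure_ball)
  then have "(\<integral>\<^sup>+y. ?B y \<partial>lborel) \<noteq> 0" "(\<integral>\<^sup>+y. ?B y \<partial>lborel) \<noteq> \<infinity>"
    by (auto simp: ennreal_eq_0_iff not_le)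
  with eq show ?thesis by (metis ennreal_mult_cancel_left mult.commute infinity_ennreal_def)
qed

text \<open>The law of the Euclidean norm under product Lebesgue measure and the stated density
  agree on the half-lines \<open>{..r}\<close>, by the volume of balls, hence everywhere. The index
  set is an arbitrary finite one because the coordinates transverse to an axis are not the basis of
  a type of their own.\<close>

lemma nn_integral_PiM_radial:
  fixes k :: "real \<Rightarrow> ennreal"
  assumes A: "finite A" "A \<noteq> {}" and [measurable]: "k \<in> borel_measurable borel"
  shows "(\<integral>\<^sup>+f. k (sqrt (\<Sum>i\<in>A. (f i)\<^sup>2)) \<partial>(\<Pi>\<^sub>M i\<in>A. lborel)) =
    (\<integral>\<^sup>+\<rho>\<in>{0<..}. ennreal (real (card A) * unit_ball_vol (card A) * \<rho> ^ (card A - 1)) * k \<rho> \<partial>lborel)"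
proof -
  let ?m = "card A"
  let ?c = "real ?m * unit_ball_vol ?m"
  let ?n = "\<lambda>f. sqrt (\<Sum>i\<in>A. (f i)\<^sup>2) :: real"
  let ?P = "\<Pi>\<^sub>M i\<in>A. lborel :: real measure"
  have m: "?m > 0" using A by (simp add: card_gt_0_iff)
  define dens where "dens \<rho> = ennreal (?c * \<rho> ^ (?m - 1)) * indicator {0<..} \<rho>" for \<rho> :: real
  have dm [measurable]: "dens \<in> borel_measurable borel" unfolding dens_def by measurable
  have D1: "emeasure (distr ?P borel ?n) {..r} = ennreal (unit_ball_vol ?m * (max 0 r) ^ ?m)" for r
  proof (cases "r > 0")
    case True
    have "emeasure (distr ?P borel ?n) {..r} = emeasure ?P ({f. ?n f \<le> r} \<inter> space ?P)"
      by (subst emeasure_distr) (auto intro!: arg_cong2[where f=emeasure])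
    then show ?thesis using emeasure_cball_aux[OF A(1) True] True by simp
  next
    case False
    \<comment> \<open>The ball formula is for positive radii, so the mass of \<open>{..0}\<close> is
      squeezed by the radii 1 / (k + 1). It vanishes because the exponent is positive.\<close>
    have *: "emeasure (distr ?P borel ?n) {..0} = 0"
    proof -
      have "emeasure (distr ?P borel ?n) {..0} \<le> ennreal (unit_ball_vol ?m * (1 / real (Suc k)) ^ ?m)" for k
      proof -
        have "emeasure (distr ?P borel ?n) {..0} \<le> emeasure (distr ?P borel ?n) {..1 / real (Suc k)}"
          by (intro emeasure_mono) (auto intro: order_trans)
        also have "\<dots> = emeasure ?P ({f. ?n f \<le> 1 / real (Suc k)} \<inter> space ?P)"
          by (subst emeasure_distr) (auto intro!: arg_cong2[where f=emeasure])
        finally show ?thesis using emeasure_cball_aux[OF A(1), of "1 / real (Suc k)"] by simp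
      qed
      moreover have lim: "(\<lambda>k. ennreal (unit_ball_vol ?m * (1 / real (Suc k)) ^ ?m)) \<longlonglongrightarrow> ennreal (unit_ball_vol ?m * 0 ^ ?m)"
        by (intro tendsto_intros LIMSEQ_Suc lim_1_over_n tendsto_ennrealI)
      ultimately have "emeasure (distr ?P borel ?n) {..0} \<le> ennreal (unit_ball_vol ?m * 0 ^ ?m)"
        by (intro LIMSEQ_le_const[OF lim]) blast
      moreover have "0 ^ ?m = (0::real)" using m by (rule zero_power)
      ultimately show ?thesis by (simp only: mult_zero_right ennreal_0 le_zero_eq)
    qed
    have "emeasure (distr ?P borel ?n) {..r} \<le> emeasure (distr ?P borel ?n) {..0}"
      using False by (intro emeasure_mono) auto
    then show ?thesis using False m * by simp
  qed
  have D2: "emeasure (density lborel dens) {..r} = ennreal (unit_ball_vol ?m * (max 0 r) ^ ?m)" for r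
  proof -
    have "emeasure (density lborel dens) {..r} = (\<integral>\<^sup>+\<rho>. dens \<rho> * indicator {..r} \<rho> \<partial>lborel)"
      by (subst emeasure_density) auto
    also have "\<dots> = (\<integral>\<^sup>+\<rho>. ennreal (?c * \<rho> ^ (?m - 1)) * indicator {0..max 0 r} \<rho> \<partial>lborel)"
    proof (rule nn_integral_cong_AE)
      have "AE \<rho> in lborel. \<rho> \<noteq> (0::real)" by (rule AE_lborel_singleton)
      then show "AE \<rho> in lborel. dens \<rho> * indicator {..r} \<rho> = ennreal (?c * \<rho> ^ (?m - 1)) * indicator {0..max 0 r} \<rho>"
        by eventually_elim (auto simp: dens_def indicator_def)
    qed
    also have "\<dots> = ennreal (unit_ball_vol ?m * (max 0 r) ^ ?m - unit_ball_vol ?m * 0 ^ ?m)"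
      by (rule nn_integral_FTC_Icc) (auto intro!: derivative_eq_intros)
    finally show ?thesis using m by simp
  qed
  have eq: "distr ?P borel ?n = density lborel dens"
  proof (rule measure_eqI_generator_eq)
    let ?E = "range (\<lambda>r::real. {..r})"
    show "Int_stable ?E" by (auto simp: Int_stable_def)
    show "?E \<subseteq> Pow UNIV" by simp
    show "sets (distr ?P borel ?n) = sigma_sets UNIV ?E" "sets (density lborel dens) = sigma_sets UNIV ?E"
      by (simp_all add: borel_eq_atMost)
    show "emeasure (distr ?P borel ?n) X = emeasure (density lborel dens) X" if "X \<in> ?E" for X
      using that D1 D2 by auto
    show "range (\<lambda>i::nat. {..real i}) \<subseteq> ?E" by auto
    show "(\<Union>i::nat. {..real i}) = UNIV" by (auto simp: real_arch_simple)
    show "emeasure (distr ?P borel ?n) {..real i} \<noteq> \<infinity>" for i by (simp add: D1)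
  qed
  have "(\<integral>\<^sup>+f. k (?n f) \<partial>?P) = (\<integral>\<^sup>+\<rho>. k \<rho> \<partial>distr ?P borel ?n)"
    by (subst nn_integral_distr) auto
  also have "\<dots> = (\<integral>\<^sup>+\<rho>. dens \<rho> * k \<rho> \<partial>lborel)"
    unfolding eq by (rule nn_integral_density) auto
  finally show ?thesis by (simp add: dens_def mult_ac)
qed

lemma norm_sum_Basis:
  "norm (\<Sum>b\<in>Basis. f b *\<^sub>R b :: 'a::euclidean_space) = sqrt (\<Sum>b\<in>Basis. (f b)\<^sup>2)"
  by (subst norm_eq_sqrt_inner, subst euclidean_inner) (simp add: power2_eq_square)

lemma nn_integral_lborel_radial:
  fixes k :: "real \<Rightarrow> ennreal"
  assumes [measurable]: "k \<in> borel_measurable borel"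
  shows "(\<integral>\<^sup>+z. k (norm (z :: 'a::euclidean_space)) \<partial>lborel) =
    (\<integral>\<^sup>+\<rho>\<in>{0<..}. ennreal (real DIM('a) * unit_ball_vol DIM('a) * \<rho> ^ (DIM('a) - 1)) * k \<rho> \<partial>lborel)"
proof -
  have "(\<integral>\<^sup>+z. k (norm (z :: 'a)) \<partial>lborel) = (\<integral>\<^sup>+f. k (norm (\<Sum>b\<in>Basis. f b *\<^sub>R b :: 'a)) \<partial>(\<Pi>\<^sub>M b\<in>(Basis::'a set). lborel))"
    by (subst lborel_eq, subst nn_integral_distr) auto
  also have "\<dots> = (\<integral>\<^sup>+f. k (sqrt (\<Sum>b\<in>Basis. (f b)\<^sup>2)) \<partial>(\<Pi>\<^sub>M b\<in>(Basis::'a set). lborel))"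
    by (simp only: norm_sum_Basis)
  finally show ?thesis by (simp add: nn_integral_PiM_radial)
qed

text \<open>Fubini separates the coordinate a along \<open>b\<close>; the others enter only through
  their norm \<rho>, so the radial formula applies in one dimension less. Dimension at least two
  leaves a transverse coordinate.\<close>

lemma nn_integral_lborel_slice:
  fixes h :: "real \<Rightarrow> real \<Rightarrow> ennreal" and b :: "'a::euclidean_space"
  assumes [measurable]: "case_prod h \<in> borel_measurable (borel \<Otimes>\<^sub>M borel)" and b: "b \<in> Basis" and dim: "DIM('a) \<ge> 2"
  shows "(\<integral>\<^sup>+z. h (z \<bullet> b) (norm z) \<partial>lborel) =
    (\<integral>\<^sup>+a. (\<integral>\<^sup>+\<rho>\<in>{0<..}. ennreal (real (DIM('a) - 1) * unit_ball_vol (real (DIM('a) - 1)) * \<rho> ^ (DIM('a) - 2)) * h a (sqrt (a\<^sup>2 + \<rho>\<^sup>2)) \<partial>lborel) \<partial>lborel)"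
proof -
  interpret product_sigma_finite "\<lambda>_. lborel :: real measure" by standard
  let ?A = "Basis - {b}"
  have ins: "Basis = insert b ?A" using b by auto
  have c: "card ?A = DIM('a) - 1" using b by simp
  have ne: "?A \<noteq> {}"
  proof
    assume "?A = {}"
    then have "card ?A = 0" by (simp only: card.empty)
    with dim c show False by linarith
  qed
  have "(\<integral>\<^sup>+z. h (z \<bullet> b) (norm z) \<partial>lborel) =
      (\<integral>\<^sup>+f. h (f b) (sqrt (\<Sum>b\<in>Basis. (f b)\<^sup>2)) \<partial>(\<Pi>\<^sub>M b\<in>(Basis::'a set). lborel))"
    by (subst lborel_eq, subst nn_integral_distr) (simp_all add: norm_sum_Basis b)
  also have "\<dots> = (\<integral>\<^sup>+f. h (f b) (sqrt (\<Sum>i\<in>insert b ?A. (f i)\<^sup>2)) \<partial>(\<Pi>\<^sub>M b\<in>insert b ?A. lborel))"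
    unfolding ins[symmetric] ..
  also have "\<dots> = (\<integral>\<^sup>+a. \<integral>\<^sup>+f. h ((f(b := a)) b) (sqrt (\<Sum>i\<in>insert b ?A. ((f(b := a)) i)\<^sup>2)) \<partial>(\<Pi>\<^sub>M b\<in>?A. lborel) \<partial>lborel)"
    by (rule product_nn_integral_insert_rev) (simp, simp, measurable)
  also have "\<dots> = (\<integral>\<^sup>+a. \<integral>\<^sup>+f. h a (sqrt (a\<^sup>2 + (sqrt (\<Sum>i\<in>?A. (f i)\<^sup>2))\<^sup>2)) \<partial>(\<Pi>\<^sub>M b\<in>?A. lborel) \<partial>lborel)"
  proof (intro nn_integral_cong)
    fix a :: real and f :: "'a \<Rightarrow> real"
    have "(\<Sum>i\<in>?A. ((f(b := a)) i)\<^sup>2) = (\<Sum>i\<in>?A. (f i)\<^sup>2)" by (intro sum.cong) auto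
    moreover have "(\<Sum>i\<in>insert b ?A. ((f(b := a)) i)\<^sup>2) = a\<^sup>2 + (\<Sum>i\<in>?A. ((f(b := a)) i)\<^sup>2)"
      by (subst sum.insert) auto
    ultimately show "h ((f(b := a)) b) (sqrt (\<Sum>i\<in>insert b ?A. ((f(b := a)) i)\<^sup>2)) = h a (sqrt (a\<^sup>2 + (sqrt (\<Sum>i\<in>?A. (f i)\<^sup>2))\<^sup>2))"
      by (simp only: fun_upd_same real_sqrt_pow2 sum_nonneg zero_le_power2)
  qed
  also have "\<dots> = (\<integral>\<^sup>+a. (\<integral>\<^sup>+\<rho>\<in>{0<..}. ennreal (real (DIM('a) - 1) * unit_ball_vol (real (DIM('a) - 1)) * \<rho> ^ (DIM('a) - 2)) * h a (sqrt (a\<^sup>2 + \<rho>\<^sup>2)) \<partial>lborel) \<partial>lborel)"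
  proof (intro nn_integral_cong)
    fix a :: real
    have "(\<lambda>\<rho>. h a (sqrt (a\<^sup>2 + \<rho>\<^sup>2))) \<in> borel_measurable borel" by measurable
    from nn_integral_PiM_radial[OF _ ne this]
    show "(\<integral>\<^sup>+f. h a (sqrt (a\<^sup>2 + (sqrt (\<Sum>i\<in>?A. (f i)\<^sup>2))\<^sup>2)) \<partial>(\<Pi>\<^sub>M b\<in>?A. lborel)) =
      (\<integral>\<^sup>+\<rho>\<in>{0<..}. ennreal (real (DIM('a) - 1) * unit_ball_vol (real (DIM('a) - 1)) * \<rho> ^ (DIM('a) - 2)) * h a (sqrt (a\<^sup>2 + \<rho>\<^sup>2)) \<partial>lborel)"
      using c by (simp add: numeral_2_eq_2)
  qed
  finally show ?thesis .
qed

text \<open>The substitution is a = tan (arcsin s), with derivative (1 - s^2)^(-3/2). For a point at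
  height a and transverse radius one, s is the cosine of its angle to the axis. The rule for compact
  intervals is applied on an exhausting sequence, followed by monotone convergence.\<close>

lemma nn_integral_substitution_tan_arcsin:
  fixes F :: "real \<Rightarrow> real"
  assumes [measurable]: "F \<in> borel_measurable borel" and F: "\<And>x. 0 \<le> F x"
  shows "(\<integral>\<^sup>+a. ennreal (F a) \<partial>lborel) =
    (\<integral>\<^sup>+s\<in>{-1<..<1}. ennreal (F (s / sqrt (1 - s\<^sup>2)) * (1 - s\<^sup>2) powr (-3/2)) \<partial>lborel)"
proof -
  define g where "g s = s / sqrt (1 - s\<^sup>2)" for s :: real
  define g' where "g' s = (1 - s\<^sup>2) powr (-3/2)" for s :: real
  \<comment> \<open>This is sin (arctan k), the preimage of k, so that the interval up to
    \<open>\<sigma> k\<close> corresponds to [-k, k].\<close>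
  define \<sigma> where "\<sigma> k = real k / sqrt (1 + (real k)\<^sup>2)" for k :: nat
  have pos: "0 < 1 + (real k)\<^sup>2" for k by (smt (verit) zero_le_power2)
  have \<sigma>2: "(\<sigma> k)\<^sup>2 = (real k)\<^sup>2 / (1 + (real k)\<^sup>2)" for k
    using pos[of k] by (simp add: \<sigma>_def power_divide)
  have \<sigma>0: "\<sigma> k \<ge> 0" for k by (simp add: \<sigma>_def)
  \<comment> \<open>A root-free form of membership, from which s^2 < 1 and monotonicity in k can be
    read off.\<close>
  have mem: "s \<in> {- \<sigma> k..\<sigma> k} \<longleftrightarrow> s\<^sup>2 \<le> (real k)\<^sup>2 * (1 - s\<^sup>2)" for s k
  proof -
    have "s \<in> {- \<sigma> k..\<sigma> k} \<longleftrightarrow> \<bar>s\<bar> \<le> \<bar>\<sigma> k\<bar>" using \<sigma>0[of k] by auto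
    also have "\<dots> \<longleftrightarrow> s\<^sup>2 \<le> (\<sigma> k)\<^sup>2" by (rule abs_le_square_iff)
    also have "\<dots> \<longleftrightarrow> s\<^sup>2 \<le> (real k)\<^sup>2 * (1 - s\<^sup>2)"
      using pos[of k] by (simp add: \<sigma>2 pos_le_divide_eq algebra_simps)
    finally show ?thesis .
  qed
  have lt1: "s\<^sup>2 < 1" if "s \<in> {- \<sigma> k..\<sigma> k}" for s k
  proof (rule ccontr)
    assume "\<not> s\<^sup>2 < 1"
    then have "(real k)\<^sup>2 * (1 - s\<^sup>2) \<le> 0" "s\<^sup>2 \<ge> 1" by (auto intro!: mult_nonneg_nonpos)
    with that show False unfolding mem by linarith
  qed
  have g\<sigma>: "g (\<sigma> k) = real k" "g (- \<sigma> k) = - real k" for k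
  proof -
    have "1 - (\<sigma> k)\<^sup>2 = 1 / (1 + (real k)\<^sup>2)" using pos[of k] by (simp add: \<sigma>2 field_simps)
    then have "sqrt (1 - (\<sigma> k)\<^sup>2) = 1 / sqrt (1 + (real k)\<^sup>2)" by (simp add: real_sqrt_divide)
    then show "g (\<sigma> k) = real k" "g (- \<sigma> k) = - real k" using pos[of k] by (simp_all add: g_def \<sigma>_def)
  qed
  have deriv: "(g has_real_derivative g' s) (at s)" if "s\<^sup>2 < 1" for s
  proof -
    have p: "0 < 1 - s\<^sup>2" using that by simp
    have e: "(1 - s\<^sup>2) powr (-3/2) = 1 / ((1 - s\<^sup>2) * sqrt (1 - s\<^sup>2))"
    proof -
      have "(1 - s\<^sup>2) powr (3/2) = (1 - s\<^sup>2) powr 1 * (1 - s\<^sup>2) powr (1/2)"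
        by (subst powr_add[symmetric]) simp
      moreover have "(1 - s\<^sup>2) powr (- (3/2)) = 1 / (1 - s\<^sup>2) powr (3/2)" by (rule powr_minus_divide)
      ultimately show ?thesis using p by (simp add: powr_half_sqrt)
    qed
    define q where "q = sqrt (1 - s\<^sup>2)"
    have q: "q > 0" "q * q = 1 - s\<^sup>2" using p by (simp_all add: q_def)
    have "((\<lambda>s. sqrt (1 - s\<^sup>2)) has_real_derivative (- s / q)) (at s)"
      unfolding q_def using p by (auto intro!: derivative_eq_intros simp: field_simps)
    from DERIV_divide[OF DERIV_ident this]
    have "(g has_real_derivative (q - s * (- s / q)) / (q * q)) (at s)"
      using q(1) by (simp add: g_def[abs_def] q_def)
    moreover have "q - s * (- s / q) = 1 / q"
    proof -
      have "q - s * (- s / q) = (q * q + s\<^sup>2) / q" using q(1) by (simp add: field_simps power2_eq_square)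
      then show ?thesis by (simp add: q(2))
    qed
    ultimately show ?thesis unfolding g'_def e q(2) by (simp add: q_def mult.commute)
  qed
  have eqk: "(\<integral>\<^sup>+a. ennreal (F a * indicator {- real k..real k} a) \<partial>lborel) =
      (\<integral>\<^sup>+s. ennreal (F (g s) * g' s * indicator {- \<sigma> k..\<sigma> k} s) \<partial>lborel)" for k
  proof -
    have "(\<integral>\<^sup>+a. ennreal (F a * indicator {g (- \<sigma> k)..g (\<sigma> k)} a) \<partial>lborel) =
      (\<integral>\<^sup>+s. ennreal (F (g s) * g' s * indicator {- \<sigma> k..\<sigma> k} s) \<partial>lborel)"
    proof (rule nn_integral_substitution)
      show "set_borel_measurable borel {g (- \<sigma> k)..g (\<sigma> k)} F"
        unfolding set_borel_measurable_def by measurable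
      show "continuous_on {- \<sigma> k..\<sigma> k} g'"
        unfolding g'_def by (intro continuous_intros) (use lt1[of _ k] in fastforce)
      show "- \<sigma> k \<le> \<sigma> k" using \<sigma>0[of k] by simp
      show "(g has_real_derivative g' s) (at s)" if "s \<in> {- \<sigma> k..\<sigma> k}" for s
        using deriv[OF lt1[OF that]] .
    qed (simp add: g'_def)
    then show ?thesis by (simp add: g\<sigma>)
  qed
  have [measurable]: "g \<in> borel_measurable borel" "g' \<in> borel_measurable borel"
    unfolding g_def g'_def by measurable
  have L: "(\<lambda>k. \<integral>\<^sup>+a. ennreal (F a * indicator {- real k..real k} a) \<partial>lborel) \<longlonglongrightarrow> (\<integral>\<^sup>+a. ennreal (F a) \<partial>lborel)"
  proof (rule nn_integral_LIMSEQ)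
    show "incseq (\<lambda>k a. ennreal (F a * indicator {- real k..real k} a))"
      using F by (auto simp: incseq_def le_fun_def indicator_def)
    show "(\<lambda>k. ennreal (F a * indicator {- real k..real k} a)) \<longlonglongrightarrow> ennreal (F a)" for a
    proof (rule tendsto_eventually)
      obtain N :: nat where "\<bar>a\<bar> \<le> real N" using real_arch_simple by blast
      then show "\<forall>\<^sub>F k in sequentially. ennreal (F a * indicator {- real k..real k} a) = ennreal (F a)"
        by (intro eventually_sequentiallyI[of N]) (auto simp: indicator_def)
    qed
  qed measurable
  have R: "(\<lambda>k. \<integral>\<^sup>+s. ennreal (F (g s) * g' s * indicator {- \<sigma> k..\<sigma> k} s) \<partial>lborel) \<longlonglongrightarrow>
      (\<integral>\<^sup>+s. ennreal (F (g s) * g' s * indicator {-1<..<1} s) \<partial>lborel)"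
  proof (rule nn_integral_LIMSEQ)
    have sub: "{- \<sigma> k..\<sigma> k} \<subseteq> {- \<sigma> l..\<sigma> l}" if "k \<le> l" for k l
    proof
      fix s assume s: "s \<in> {- \<sigma> k..\<sigma> k}"
      have "(real k)\<^sup>2 * (1 - s\<^sup>2) \<le> (real l)\<^sup>2 * (1 - s\<^sup>2)"
        using lt1[OF s] that by (intro mult_right_mono power_mono) auto
      then show "s \<in> {- \<sigma> l..\<sigma> l}" using s unfolding mem by linarith
    qed
    show "incseq (\<lambda>k s. ennreal (F (g s) * g' s * indicator {- \<sigma> k..\<sigma> k} s))"
      unfolding incseq_def le_fun_def
    proof (intro allI impI ennreal_leI mult_left_mono)
      fix k l :: nat and s :: real assume "k \<le> l"
      from sub[OF this] show "indicator {- \<sigma> k..\<sigma> k} s \<le> (indicator {- \<sigma> l..\<sigma> l} s :: real)"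
        unfolding indicator_def by (simp only: subset_iff) simp
    qed (simp add: F g'_def)
    show "(\<lambda>k. ennreal (F (g s) * g' s * indicator {- \<sigma> k..\<sigma> k} s)) \<longlonglongrightarrow>
        ennreal (F (g s) * g' s * indicator {-1<..<1} s)" for s
    proof (rule tendsto_eventually)
      show "\<forall>\<^sub>F k in sequentially. ennreal (F (g s) * g' s * indicator {- \<sigma> k..\<sigma> k} s) =
          ennreal (F (g s) * g' s * indicator {-1<..<1} s)"
      proof (cases "s\<^sup>2 < 1")
        case True
        obtain N :: nat where N: "s\<^sup>2 / (1 - s\<^sup>2) \<le> real N" using real_arch_simple by blast
        have "s \<in> {- \<sigma> k..\<sigma> k}" if "k \<ge> Suc N" for k
        proof -
          have "real N \<le> real k" "1 \<le> real k" using that by auto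
          then have "real N \<le> (real k)\<^sup>2" by (metis order_trans self_le_power zero_less_numeral)
          then have "s\<^sup>2 / (1 - s\<^sup>2) \<le> (real k)\<^sup>2" using N by linarith
          then show ?thesis unfolding mem using True by (simp add: pos_divide_le_eq)
        qed
        moreover have "s \<in> {-1<..<1}" using True by (simp add: abs_square_less_1 abs_less_iff)
        ultimately show ?thesis by (intro eventually_sequentiallyI[of "Suc N"]) simp
      next
        case False
        then have "s \<notin> {- \<sigma> k..\<sigma> k}" for k using lt1 by blast
        moreover have "s \<notin> {-1<..<1}" using False by (auto simp: abs_square_less_1 abs_less_iff)
        ultimately show ?thesis by simp
      qed
    qed
  qed measurable
  have "(\<integral>\<^sup>+a. ennreal (F a) \<partial>lborel) = (\<integral>\<^sup>+s. ennreal (F (g s) * g' s * indicator {-1<..<1} s) \<partial>lborel)"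
    using L R unfolding eqk by (rule LIMSEQ_unique)
  also have "\<dots> = (\<integral>\<^sup>+s\<in>{-1<..<1}. ennreal (F (s / sqrt (1 - s\<^sup>2)) * (1 - s\<^sup>2) powr (-3/2)) \<partial>lborel)"
    unfolding g_def g'_def by (intro nn_integral_cong) (auto simp: indicator_def)
  finally show ?thesis .
qed

text \<open>After rotating the axis to a basis vector, put a = R s and \<rho> = R sqrt (1 - s^2),
  with s the cosine of the angle to v. The change is made one variable at a time: a for fixed
  \<rho>, then \<rho> for fixed s, with an exchange of integrals before each.\<close>

lemma nn_integral_lborel_polar:
  fixes H :: "real \<Rightarrow> real \<Rightarrow> real" and v :: "real^'n"
  assumes H [measurable]: "case_prod H \<in> borel_measurable (borel \<Otimes>\<^sub>M borel)" and H0: "\<And>x y. 0 \<le> H x y"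
    and v: "norm v = 1" and n: "CARD('n) \<ge> 2"
  shows "(\<integral>\<^sup>+z. ennreal (H (z \<bullet> v) (norm z)) \<partial>lborel) =
    (\<integral>\<^sup>+s\<in>{-1<..<1}. ennreal ((real CARD('n) - 1) * unit_ball_vol (real CARD('n) - 1) * (1 - s\<^sup>2) powr ((real CARD('n) - 3) / 2)) *
       (\<integral>\<^sup>+R\<in>{0<..}. ennreal (R ^ (CARD('n) - 1) * H (R * s) R) \<partial>lborel) \<partial>lborel)"
proof -
  let ?n = "CARD('n)"
  let ?c = "(real ?n - 1) * unit_ball_vol (real ?n - 1)"
  have c0: "?c \<ge> 0" using n by simp
  obtain b :: "real^'n" where b: "b \<in> Basis" by (meson SOME_Basis)
  obtain f where f: "orthogonal_transformation f" "f b = v"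
    using orthogonal_transformation_exists[of b v] b v by auto
  have "(\<integral>\<^sup>+z. ennreal (H (z \<bullet> v) (norm z)) \<partial>lborel) = (\<integral>\<^sup>+z. ennreal (H (f z \<bullet> v) (norm (f z))) \<partial>lborel)"
    by (rule nn_integral_lborel_orthogonal[OF _ f(1), symmetric]) measurable
  also have "\<dots> = (\<integral>\<^sup>+z. ennreal (H (z \<bullet> b) (norm z)) \<partial>lborel)"
    unfolding f(2)[symmetric] using f(1) by (simp add: orthogonal_transformation_norm orthogonal_transformation_def)
  also have "\<dots> = (\<integral>\<^sup>+a. (\<integral>\<^sup>+\<rho>\<in>{0<..}. ennreal (?c * \<rho> ^ (?n - 2)) * ennreal (H a (sqrt (a\<^sup>2 + \<rho>\<^sup>2))) \<partial>lborel) \<partial>lborel)"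
    using nn_integral_lborel_slice[OF _ b, of "\<lambda>x y. ennreal (H x y)"] n by (simp add: of_nat_diff)
  \<comment> \<open>With \<rho> outside, the axial variable can be rescaled by \<rho> and then
    substituted.\<close>
  also have "\<dots> = (\<integral>\<^sup>+\<rho>. \<integral>\<^sup>+a. ennreal (?c * \<rho> ^ (?n - 2)) * ennreal (H a (sqrt (a\<^sup>2 + \<rho>\<^sup>2))) * indicator {0<..} \<rho> \<partial>lborel \<partial>lborel)"
    by (rule lborel_pair.Fubini') measurable
  also have "\<dots> = (\<integral>\<^sup>+\<rho>. \<integral>\<^sup>+s. ennreal (?c * \<rho> ^ (?n - 1) * (1 - s\<^sup>2) powr (-3/2) * H (\<rho> * s / sqrt (1 - s\<^sup>2)) (\<rho> / sqrt (1 - s\<^sup>2))) *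
      indicator {-1<..<1} s * indicator {0<..} \<rho> \<partial>lborel \<partial>lborel)"
  proof (rule nn_integral_cong)
    fix \<rho> :: real
    show "(\<integral>\<^sup>+a. ennreal (?c * \<rho> ^ (?n - 2)) * ennreal (H a (sqrt (a\<^sup>2 + \<rho>\<^sup>2))) * indicator {0<..} \<rho> \<partial>lborel) =
      (\<integral>\<^sup>+s. ennreal (?c * \<rho> ^ (?n - 1) * (1 - s\<^sup>2) powr (-3/2) * H (\<rho> * s / sqrt (1 - s\<^sup>2)) (\<rho> / sqrt (1 - s\<^sup>2))) *
      indicator {-1<..<1} s * indicator {0<..} \<rho> \<partial>lborel)" (is "?L = ?R")
    proof (cases "\<rho> > 0")
      case True
      have sq: "sqrt ((\<rho> * (s / sqrt (1 - s\<^sup>2)))\<^sup>2 + \<rho>\<^sup>2) = \<rho> / sqrt (1 - s\<^sup>2)" if "s \<in> {-1<..<1}" for s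
      proof -
        have p: "0 < 1 - s\<^sup>2" using that by (simp add: abs_square_less_1 abs_less_iff)
        then have "(\<rho> * (s / sqrt (1 - s\<^sup>2)))\<^sup>2 + \<rho>\<^sup>2 = (\<rho> / sqrt (1 - s\<^sup>2))\<^sup>2"
          by (simp add: power_mult_distrib power_divide field_simps)
        then show ?thesis using True p by (simp only: real_sqrt_abs) simp
      qed
      have pw: "\<rho> ^ (?n - 2) * \<rho> = \<rho> ^ (?n - 1)" using n by (metis One_nat_def Suc_1 Suc_diff_Suc less_eq_Suc_le power_Suc2)
      have "?L = (\<integral>\<^sup>+a. ennreal (?c * \<rho> ^ (?n - 2) * H a (sqrt (a\<^sup>2 + \<rho>\<^sup>2))) \<partial>lborel)"
        using True c0 H0 by (intro nn_integral_cong) (simp add: ennreal_mult')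
      also have "\<dots> = ennreal \<rho> * (\<integral>\<^sup>+a. ennreal (?c * \<rho> ^ (?n - 2) * H (\<rho> * a) (sqrt ((\<rho> * a)\<^sup>2 + \<rho>\<^sup>2))) \<partial>lborel)"
        using nn_integral_real_affine[of "\<lambda>a. ennreal (?c * \<rho> ^ (?n - 2) * H a (sqrt (a\<^sup>2 + \<rho>\<^sup>2)))" \<rho> 0] True by simp
      also have "\<dots> = (\<integral>\<^sup>+a. ennreal (\<rho> * (?c * \<rho> ^ (?n - 2) * H (\<rho> * a) (sqrt ((\<rho> * a)\<^sup>2 + \<rho>\<^sup>2)))) \<partial>lborel)"
        using True by (simp add: nn_integral_cmult[symmetric] ennreal_mult')
      also have "\<dots> = (\<integral>\<^sup>+s\<in>{-1<..<1}. ennreal (\<rho> * (?c * \<rho> ^ (?n - 2) * H (\<rho> * (s / sqrt (1 - s\<^sup>2))) (sqrt ((\<rho> * (s / sqrt (1 - s\<^sup>2)))\<^sup>2 + \<rho>\<^sup>2))) * (1 - s\<^sup>2) powr (-3/2)) \<partial>lborel)"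
        using True c0 H0 by (intro nn_integral_substitution_tan_arcsin) auto
      also have "\<dots> = ?R"
      proof (intro nn_integral_cong)
        fix s :: real
        show "ennreal (\<rho> * (?c * \<rho> ^ (?n - 2) * H (\<rho> * (s / sqrt (1 - s\<^sup>2))) (sqrt ((\<rho> * (s / sqrt (1 - s\<^sup>2)))\<^sup>2 + \<rho>\<^sup>2))) * (1 - s\<^sup>2) powr (-3/2)) * indicator {-1<..<1} s =
          ennreal (?c * \<rho> ^ (?n - 1) * (1 - s\<^sup>2) powr (-3/2) * H (\<rho> * s / sqrt (1 - s\<^sup>2)) (\<rho> / sqrt (1 - s\<^sup>2))) * indicator {-1<..<1} s * indicator {0<..} \<rho>"
        proof (cases "s \<in> {-1<..<1}")
          case s: True
          show ?thesis unfolding sq[OF s] pw[symmetric] using True by (simp add: mult_ac)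
        qed simp
      qed
      finally show ?thesis .
    qed simp
  qed
  also have "\<dots> = (\<integral>\<^sup>+s. \<integral>\<^sup>+\<rho>. ennreal (?c * \<rho> ^ (?n - 1) * (1 - s\<^sup>2) powr (-3/2) * H (\<rho> * s / sqrt (1 - s\<^sup>2)) (\<rho> / sqrt (1 - s\<^sup>2))) *
      indicator {-1<..<1} s * indicator {0<..} \<rho> \<partial>lborel \<partial>lborel)"
    by (rule lborel_pair.Fubini') measurable
  also have "\<dots> = (\<integral>\<^sup>+s\<in>{-1<..<1}. ennreal (?c * (1 - s\<^sup>2) powr ((real ?n - 3) / 2)) *
       (\<integral>\<^sup>+R\<in>{0<..}. ennreal (R ^ (?n - 1) * H (R * s) R) \<partial>lborel) \<partial>lborel)"
  proof (intro nn_integral_cong)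
    fix s :: real
    show "(\<integral>\<^sup>+\<rho>. ennreal (?c * \<rho> ^ (?n - 1) * (1 - s\<^sup>2) powr (-3/2) * H (\<rho> * s / sqrt (1 - s\<^sup>2)) (\<rho> / sqrt (1 - s\<^sup>2))) *
      indicator {-1<..<1} s * indicator {0<..} \<rho> \<partial>lborel) =
      ennreal (?c * (1 - s\<^sup>2) powr ((real ?n - 3) / 2)) *
       (\<integral>\<^sup>+R\<in>{0<..}. ennreal (R ^ (?n - 1) * H (R * s) R) \<partial>lborel) * indicator {-1<..<1} s" (is "?L = ?R")
    proof (cases "s \<in> {-1<..<1}")
      case True
      let ?q = "sqrt (1 - s\<^sup>2)"
      have p: "0 < 1 - s\<^sup>2" using True by (simp add: abs_square_less_1 abs_less_iff)
      then have q: "?q > 0" by simp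
      \<comment> \<open>Scaling \<rho> contributes n factors sqrt (1 - s^2), one from the
        differential and n - 1 from the density. Together with the power -3/2 from the substitution
        the exponent becomes (n - 3) / 2.\<close>
      have pw: "?q * ?q ^ (?n - 1) * (1 - s\<^sup>2) powr (-3/2) = (1 - s\<^sup>2) powr ((real ?n - 3) / 2)"
      proof -
        have "?q * ?q ^ (?n - 1) = ?q ^ ?n" using n by (metis One_nat_def Suc_pred less_le_trans pos2 power_Suc)
        also have "\<dots> = (1 - s\<^sup>2) powr (real ?n / 2)"
          using p by (simp add: powr_half_sqrt[symmetric] powr_realpow[symmetric] powr_powr)
        finally show ?thesis by (simp add: powr_add[symmetric] field_simps)
      qed
      have "?L = (\<integral>\<^sup>+\<rho>. ennreal (?c * \<rho> ^ (?n - 1) * (1 - s\<^sup>2) powr (-3/2) * H (\<rho> * s / ?q) (\<rho> / ?q)) * indicator {0<..} \<rho> \<partial>lborel)"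
        using True by simp
      also have "\<dots> = ennreal ?q * (\<integral>\<^sup>+R. ennreal (?c * (?q * R) ^ (?n - 1) * (1 - s\<^sup>2) powr (-3/2) * H (?q * R * s / ?q) (?q * R / ?q)) * indicator {0<..} (?q * R) \<partial>lborel)"
        using nn_integral_real_affine[of "\<lambda>\<rho>. ennreal (?c * \<rho> ^ (?n - 1) * (1 - s\<^sup>2) powr (-3/2) * H (\<rho> * s / ?q) (\<rho> / ?q)) * indicator {0<..} \<rho>" ?q 0] q by simp
      also have "\<dots> = (\<integral>\<^sup>+R. ennreal ?q * (ennreal (?c * (?q * R) ^ (?n - 1) * (1 - s\<^sup>2) powr (-3/2) * H (?q * R * s / ?q) (?q * R / ?q)) * indicator {0<..} (?q * R)) \<partial>lborel)"
        by (rule nn_integral_cmult[symmetric]) measurable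
      also have "\<dots> = (\<integral>\<^sup>+R. ennreal (?c * (1 - s\<^sup>2) powr ((real ?n - 3) / 2)) * (ennreal (R ^ (?n - 1) * H (R * s) R) * indicator {0<..} R) \<partial>lborel)"
      proof (intro nn_integral_cong)
        fix R :: real
        show "ennreal ?q * (ennreal (?c * (?q * R) ^ (?n - 1) * (1 - s\<^sup>2) powr (-3/2) * H (?q * R * s / ?q) (?q * R / ?q)) * indicator {0<..} (?q * R)) =
          ennreal (?c * (1 - s\<^sup>2) powr ((real ?n - 3) / 2)) * (ennreal (R ^ (?n - 1) * H (R * s) R) * indicator {0<..} R)"
        proof (cases "R > 0")
          case R: True
          have "?q * (?c * (?q * R) ^ (?n - 1) * (1 - s\<^sup>2) powr (-3/2) * H (R * s) R) =
             ?c * (?q * ?q ^ (?n - 1) * (1 - s\<^sup>2) powr (-3/2)) * (R ^ (?n - 1) * H (R * s) R)"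
            by (simp add: power_mult_distrib)
          then have "?q * (?c * (?q * R) ^ (?n - 1) * (1 - s\<^sup>2) powr (-3/2) * H (R * s) R) =
             ?c * (1 - s\<^sup>2) powr ((real ?n - 3) / 2) * (R ^ (?n - 1) * H (R * s) R)" unfolding pw .
          moreover have "?q * R * s / ?q = R * s" "?q * R / ?q = R" using q by auto
          moreover have "indicator {0<..} (?q * R) = (1::ennreal)" "indicator {0<..} R = (1::ennreal)" using R q by auto
          ultimately show ?thesis using R q c0 H0
            by (simp only: mult_1_right ennreal_mult'[symmetric] less_imp_le c0 mult_nonneg_nonneg powr_ge_zero)
        next
          case False
          then have "\<not> ?q * R > 0" using q by (simp add: zero_less_mult_iff)
          with False show ?thesis by (simp add: indicator_def)
        qed
      qed
      also have "\<dots> = ?R" using True by (simp add: nn_integral_cmult)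
      finally show ?thesis .
    qed simp
  qed
  finally show ?thesis .
qed

section \<open>Half-space integrals\<close>

lemma frac_mu_pos: "0 \<le> \<alpha> \<Longrightarrow> \<alpha> < 1 \<Longrightarrow> 0 < frac_mu n \<alpha>"
  unfolding frac_mu_def by (intro divide_pos_pos mult_pos_pos Gamma_real_pos) auto

lemma nn_integral_powr_atLeast:
  assumes d: "0 < d" and \<alpha>: "0 < \<alpha>"
  shows "(\<integral>\<^sup>+R\<in>{d..}. ennreal (R powr (- \<alpha> - 1)) \<partial>lborel) = ennreal (d powr (- \<alpha>) / \<alpha>)"
proof -
  have "(\<integral>\<^sup>+R\<in>{d..}. ennreal (R powr (- \<alpha> - 1)) \<partial>lborel) = ennreal (0 - (- (d powr (- \<alpha>) / \<alpha>)))"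
  proof (rule nn_integral_FTC_atLeast)
    show "DERIV (\<lambda>R. - (R powr (- \<alpha>) / \<alpha>)) x :> x powr (- \<alpha> - 1)" if "d \<le> x" for x
      using that d \<alpha> by (auto intro!: derivative_eq_intros simp: divide_simps powr_diff)
    have "((\<lambda>R. - (R powr (- \<alpha>) / \<alpha>)) \<longlongrightarrow> - (0 / \<alpha>)) at_top"
      using \<alpha> by (intro tendsto_intros tendsto_neg_powr filterlim_ident) auto
    then show "((\<lambda>R. - (R powr (- \<alpha>) / \<alpha>)) \<longlongrightarrow> 0) at_top" by simp
  qed auto
  then show ?thesis by simp
qed

lemma nn_integral_Beta_squares:
  assumes "0 < a" "0 < b"
  shows "(\<integral>\<^sup>+s\<in>{0<..<1}. ennreal (s powr (2 * a - 1) * (1 - s\<^sup>2) powr (b - 1)) \<partial>lborel) = ennreal (Beta a b / 2)"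
proof -
  \<comment> \<open>The endpoints are written as squares to match the image of [0, 1] under the
    substitution t = s^2.\<close>
  have "ennreal (Beta a b) = (\<integral>\<^sup>+t. ennreal (t powr (a - 1) * (1 - t) powr (b - 1) * indicator {0^2..1^2} t) \<partial>lborel)"
    using nn_integral_has_integral_lebesgue[OF _ has_integral_Beta_real[OF assms]]
    by (simp add: mult_ac ennreal_mult' ennreal_indicator)
  also have "\<dots> = (\<integral>\<^sup>+s. ennreal ((s\<^sup>2) powr (a - 1) * (1 - s\<^sup>2) powr (b - 1) * (2 * s) * indicator {0..1} s) \<partial>lborel)"
    by (subst nn_integral_substitution[where g = "\<lambda>x. x ^ 2" and g' = "\<lambda>x. 2 * x"])
       (auto intro!: derivative_eq_intros continuous_intros simp: set_borel_measurable_def)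
  also have "\<dots> = (\<integral>\<^sup>+s. 2 * (ennreal (s powr (2 * a - 1) * (1 - s\<^sup>2) powr (b - 1)) * indicator {0<..<1} s) \<partial>lborel)"
  proof (rule nn_integral_cong_AE)
    have "AE s in lborel. s \<noteq> 0 \<and> s \<noteq> (1::real)" by (intro AE_conjI AE_lborel_singleton)
    then show "AE s in lborel. ennreal ((s\<^sup>2) powr (a - 1) * (1 - s\<^sup>2) powr (b - 1) * (2 * s) * indicator {0..1} s) =
      2 * (ennreal (s powr (2 * a - 1) * (1 - s\<^sup>2) powr (b - 1)) * indicator {0<..<1} s)"
    proof eventually_elim
      case (elim s)
      show ?case
      proof (cases "s \<in> {0<..<1}")
        case True
        then have s: "s > 0" by simp
        have "(s\<^sup>2) powr (a - 1) = (s powr 2) powr (a - 1)" using s by simp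
        also have "\<dots> = s powr (2 * (a - 1))" by (rule powr_powr)
        finally have "(s\<^sup>2) powr (a - 1) * s = s powr (2 * (a - 1)) * s powr 1" using s by simp
        also have "\<dots> = s powr (2 * a - 1)" unfolding powr_add[symmetric] by (simp add: algebra_simps)
        finally have *: "(s\<^sup>2) powr (a - 1) * s = s powr (2 * a - 1)" .
        have "(s\<^sup>2) powr (a - 1) * (1 - s\<^sup>2) powr (b - 1) * (2 * s) = 2 * ((s\<^sup>2) powr (a - 1) * s * (1 - s\<^sup>2) powr (b - 1))"
          by (simp only: mult_ac)
        then have "(s\<^sup>2) powr (a - 1) * (1 - s\<^sup>2) powr (b - 1) * (2 * s) = 2 * (s powr (2 * a - 1) * (1 - s\<^sup>2) powr (b - 1))"
          unfolding * .
        moreover have "ennreal (2 * (s powr (2 * a - 1) * (1 - s\<^sup>2) powr (b - 1))) = 2 * ennreal (s powr (2 * a - 1) * (1 - s\<^sup>2) powr (b - 1))"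
          by (subst ennreal_mult') simp_all
        moreover have "indicator {0..1} s = (1 :: real)" "indicator {0<..<1} s = (1 :: ennreal)" using True by auto
        ultimately show ?thesis by (simp only: mult_1_right)
      next
        case False
        then have "s \<notin> {0..1}" using elim by auto
        with False show ?thesis by simp
      qed
    qed
  qed
  also have "\<dots> = 2 * (\<integral>\<^sup>+s\<in>{0<..<1}. ennreal (s powr (2 * a - 1) * (1 - s\<^sup>2) powr (b - 1)) \<partial>lborel)"
    by (rule nn_integral_cmult) measurable
  finally have *: "2 * (\<integral>\<^sup>+s\<in>{0<..<1}. ennreal (s powr (2 * a - 1) * (1 - s\<^sup>2) powr (b - 1)) \<partial>lborel) = 2 * ennreal (Beta a b / 2)"
    using ennreal_mult'[of 2 "Beta a b / 2"] by simp
  then show ?thesis by (subst (asm) ennreal_mult_cancel_left) auto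
qed

text \<open>The Beta factor is the angular part of the half-space integral. With m = (n - 1) / 2,
  its denominator Gamma ((n + \<alpha> + 1) / 2) cancels against \<open>frac_mu n \<alpha>\<close>,
  its factor Gamma m cancels against the ball volume, and the powers of pi collapse to pi^(-1/2).
  The surviving Gamma ((2 + \<alpha>) / 2) is that of dimension one.\<close>

lemma frac_mu_dimension_reduction:
  assumes "0 < \<alpha>" "\<alpha> < 1" "2 \<le> n"
  shows "frac_mu n \<alpha> * ((real n - 1) * unit_ball_vol (real n - 1) * (Beta ((2 + \<alpha>) / 2) ((real n - 1) / 2) / 2)) = frac_mu 1 \<alpha>"
proof -
  define m where "m = (real n - 1) / 2"
  have m: "m > 0" "real n = 2 * m + 1" using assms by (auto simp: m_def field_simps)
  have g: "Gamma (m + 1) = m * Gamma m" using m Gamma_plus1[of m] by (metis nonpos_Ints_nonpos not_less)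
  have pos: "Gamma m > 0" "Gamma (m + (2 + \<alpha>) / 2) > 0" "Gamma ((1 - \<alpha>) / 2) > 0" "Gamma ((2 + \<alpha>) / 2) > 0"
    using m(1) assms by (auto intro!: Gamma_real_pos add_pos_pos)
  have e: "(real n + \<alpha> + 1) / 2 = m + (2 + \<alpha>) / 2" using m by (simp add: field_simps)
  have p: "pi powr (- (real n / 2)) * pi powr m = pi powr (- (1/2))"
    using m by (simp add: powr_add[symmetric] field_simps)
  have "unit_ball_vol (real n - 1) = pi powr m / (m * Gamma m)"
    unfolding unit_ball_vol_def m_def[symmetric] g ..
  then have "frac_mu n \<alpha> * ((real n - 1) * unit_ball_vol (real n - 1) * (Beta ((2 + \<alpha>) / 2) ((real n - 1) / 2) / 2))
     = 2 powr \<alpha> * (pi powr (- (real n / 2)) * pi powr m) * Gamma ((2 + \<alpha>) / 2) / Gamma ((1 - \<alpha>) / 2)"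
    unfolding frac_mu_def e m_def[symmetric] Beta_def using pos m
    by (simp add: field_simps)
  also have "\<dots> = frac_mu 1 \<alpha>"
    unfolding p by (simp add: frac_mu_def add_ac)
  finally show ?thesis .
qed

text \<open>This replaces the polar formula, which needs a transverse direction. With a single basis
  vector, z \<bullet> v is the coordinate of z up to sign.\<close>

lemma inner_one_dim:
  fixes v :: "real^'n"
  assumes "CARD('n) = 1" "norm v = 1"
  shows "norm z = \<bar>z \<bullet> v\<bar>"
    and "h \<in> borel_measurable borel \<Longrightarrow> (\<integral>\<^sup>+z. h (z \<bullet> v) \<partial>lborel) = (\<integral>\<^sup>+a. h a \<partial>lborel)"
proof -
  obtain b :: "real^'n" where B: "Basis = {b}"
    using assms(1) card_1_singletonE[of "Basis :: (real^'n) set"] by auto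
  have b: "b \<in> Basis" unfolding B by (rule singletonI)
  obtain f where f: "orthogonal_transformation f" "f b = v"
    using orthogonal_transformation_exists[of b v] b assms(2) by auto
  have inn: "f w \<bullet> v = w \<bullet> b" for w
    using f unfolding f(2)[symmetric] by (simp add: orthogonal_transformation_def)
  obtain w where w: "f w = z" using orthogonal_transformation_surj[OF f(1)] by (metis surjD)
  have "norm w = \<bar>w \<bullet> b\<bar>" by (subst norm_eq_sqrt_inner, subst euclidean_inner) (simp add: B)
  then show "norm z = \<bar>z \<bullet> v\<bar>" unfolding w[symmetric] inn using f(1) by (simp add: orthogonal_transformation_norm)
  assume [measurable]: "h \<in> borel_measurable borel"
  interpret product_sigma_finite "\<lambda>_. lborel :: real measure" by standard
  have "(\<integral>\<^sup>+z. h (z \<bullet> v) \<partial>lborel) = (\<integral>\<^sup>+z. h (f z \<bullet> v) \<partial>lborel)"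
    by (rule nn_integral_lborel_orthogonal[OF _ f(1), symmetric]) measurable
  also have "\<dots> = (\<integral>\<^sup>+x. h ((\<Sum>c\<in>Basis. x c *\<^sub>R c) \<bullet> b) \<partial>(\<Pi>\<^sub>M b\<in>Basis. lborel))"
    unfolding inn by (subst lborel_eq, subst nn_integral_distr) simp_all
  also have "\<dots> = (\<integral>\<^sup>+x. h (x b) \<partial>(\<Pi>\<^sub>M b\<in>{b}. lborel))"
    using b by (simp add: B)
  also have "\<dots> = (\<integral>\<^sup>+a. h a \<partial>lborel)"
    by (rule product_nn_integral_singleton) simp
  finally show "(\<integral>\<^sup>+z. h (z \<bullet> v) \<partial>lborel) = (\<integral>\<^sup>+a. h a \<partial>lborel)" .
qed

text \<open>In polar form z \<bullet> v = R s, so the constraint leaves a power integral over R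
  \<ge> d / s, which contributes s^(1 + \<alpha>) d^(-\<alpha>) / \<alpha>. The remaining integral
  over s is of Beta type, with the constant computed in
  \<open>frac_mu_dimension_reduction\<close>.\<close>

lemma nn_integral_half_space:
  fixes v :: "real^'n"
  assumes \<alpha>: "0 < \<alpha>" "\<alpha> < 1" and v: "norm v = 1" and d: "0 < d"
  shows "ennreal (frac_mu CARD('n) \<alpha>) *
      (\<integral>\<^sup>+z. ennreal (if d \<le> z \<bullet> v then z \<bullet> v / norm z powr (real CARD('n) + \<alpha> + 1) else 0) \<partial>lborel) =
    ennreal (frac_mu 1 \<alpha> / \<alpha> * (1 / d powr \<alpha>))"
proof (cases "CARD('n) = 1")
  case True
  have "(\<integral>\<^sup>+z. ennreal (if d \<le> z \<bullet> v then z \<bullet> v / norm z powr (real CARD('n) + \<alpha> + 1) else 0) \<partial>lborel) =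
     (\<integral>\<^sup>+z. ennreal (if d \<le> z \<bullet> v then z \<bullet> v / \<bar>z \<bullet> v\<bar> powr (\<alpha> + 2) else 0) \<partial>lborel)"
  proof -
    have e: "real 1 + \<alpha> + 1 = \<alpha> + 2" by simp
    show ?thesis unfolding inner_one_dim(1)[OF True v] True e ..
  qed
  also have "\<dots> = (\<integral>\<^sup>+a. ennreal (if d \<le> a then a / \<bar>a\<bar> powr (\<alpha> + 2) else 0) \<partial>lborel)"
    by (rule inner_one_dim(2)[OF True v]) measurable
  also have "\<dots> = (\<integral>\<^sup>+a\<in>{d..}. ennreal (a powr (- \<alpha> - 1)) \<partial>lborel)"
  proof (rule nn_integral_cong)
    fix a :: real
    have "a / a powr (\<alpha> + 2) = a powr (- \<alpha> - 1)" if "0 < a"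
      using that by (simp add: powr_diff powr_add powr_minus field_simps power2_eq_square)
    then show "ennreal (if d \<le> a then a / \<bar>a\<bar> powr (\<alpha> + 2) else 0) = ennreal (a powr (- \<alpha> - 1)) * indicator {d..} a"
      using d by (auto simp: indicator_def)
  qed
  also have "\<dots> = ennreal (d powr (- \<alpha>) / \<alpha>)" by (rule nn_integral_powr_atLeast[OF d \<alpha>(1)])
  finally show ?thesis unfolding True using frac_mu_pos[of \<alpha> 1] \<alpha>
    by (simp add: ennreal_mult'[symmetric] powr_minus field_simps)
next
  case False
  let ?n = "CARD('n)"
  have n: "?n \<ge> 2" using False by (metis One_nat_def Suc_leI le_neq_implies_less numeral_2_eq_2 zero_less_card_finite)
  define H where "H a R = (if d \<le> a then a / R powr (real ?n + \<alpha> + 1) else 0)" for a R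
  let ?c = "(real ?n - 1) * unit_ball_vol (real ?n - 1)"
  have [measurable]: "case_prod H \<in> borel_measurable (borel \<Otimes>\<^sub>M borel)"
    unfolding H_def by measurable
  have H0: "0 \<le> H a R" for a R using d by (auto simp: H_def)
  have inner: "(\<integral>\<^sup>+R\<in>{0<..}. ennreal (R ^ (?n - 1) * H (R * s) R) \<partial>lborel) =
      ennreal (s powr (1 + \<alpha>) * (d powr (- \<alpha>) / \<alpha>))" if s: "0 < s" for s
  proof -
    have "(\<integral>\<^sup>+R\<in>{0<..}. ennreal (R ^ (?n - 1) * H (R * s) R) \<partial>lborel) =
       (\<integral>\<^sup>+R. ennreal s * (ennreal (R powr (- \<alpha> - 1)) * indicator {d / s..} R) \<partial>lborel)"
    proof (rule nn_integral_cong)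
      fix R :: real
      have "R ^ (?n - 1) * (R * s / R powr (real ?n + \<alpha> + 1)) = s * R powr (- \<alpha> - 1)" if "0 < R"
      proof -
        have "R ^ (?n - 1) = R powr (real ?n - 1)" using that n by (simp add: powr_realpow[symmetric] of_nat_diff)
        then have "R ^ (?n - 1) * (R * s / R powr (real ?n + \<alpha> + 1)) = s * (R powr (real ?n - 1) * R powr 1 / R powr (real ?n + \<alpha> + 1))"
          using that by simp
        also have "\<dots> = s * R powr (- \<alpha> - 1)"
          unfolding powr_add[symmetric] powr_diff[symmetric] by simp
        finally show ?thesis .
      qed
      moreover have "d \<le> R * s \<longleftrightarrow> d / s \<le> R" using s by (simp add: pos_divide_le_eq)
      moreover have "0 < R" if "d / s \<le> R" using that s d by (smt (verit) divide_pos_pos)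
      ultimately show "ennreal (R ^ (?n - 1) * H (R * s) R) * indicator {0<..} R = ennreal s * (ennreal (R powr (- \<alpha> - 1)) * indicator {d / s..} R)"
        using s by (auto simp: H_def indicator_def ennreal_mult'[symmetric])
    qed
    also have "\<dots> = ennreal s * (\<integral>\<^sup>+R\<in>{d / s..}. ennreal (R powr (- \<alpha> - 1)) \<partial>lborel)"
      by (rule nn_integral_cmult) measurable
    also have "\<dots> = ennreal (s * ((d / s) powr (- \<alpha>) / \<alpha>))"
      unfolding nn_integral_powr_atLeast[OF divide_pos_pos[OF d s] \<alpha>(1)] by (rule ennreal_mult'[symmetric]) (use s in simp)
    also have "s * ((d / s) powr (- \<alpha>) / \<alpha>) = s powr (1 + \<alpha>) * (d powr (- \<alpha>) / \<alpha>)"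
      using s d by (simp add: powr_divide powr_minus powr_add field_simps)
    finally show ?thesis .
  qed
  \<comment> \<open>Only directions with positive cosine meet the half-space, which is why the Beta
    integral runs over (0, 1).\<close>
  have inner0: "(\<integral>\<^sup>+R\<in>{0<..}. ennreal (R ^ (?n - 1) * H (R * s) R) \<partial>lborel) = 0" if s: "s \<le> 0" for s
  proof -
    have "ennreal (R ^ (?n - 1) * H (R * s) R) * indicator {0<..} R = 0" for R
    proof (cases "R > 0")
      case True
      then have "R * s \<le> 0" using s by (simp add: mult_nonneg_nonpos)
      then show ?thesis using d by (simp add: H_def)
    qed simp
    then show ?thesis by (simp only: nn_integral_const mult_zero_left)
  qed
  have "(\<integral>\<^sup>+z. ennreal (if d \<le> z \<bullet> v then z \<bullet> v / norm z powr (real ?n + \<alpha> + 1) else 0) \<partial>lborel) =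
      (\<integral>\<^sup>+z. ennreal (H (z \<bullet> v) (norm z)) \<partial>lborel)" by (simp add: H_def)
  also have "\<dots> = (\<integral>\<^sup>+s\<in>{-1<..<1}. ennreal (?c * (1 - s\<^sup>2) powr ((real ?n - 3) / 2)) *
       (\<integral>\<^sup>+R\<in>{0<..}. ennreal (R ^ (?n - 1) * H (R * s) R) \<partial>lborel) \<partial>lborel)"
    by (rule nn_integral_lborel_polar[OF _ H0 v n]) measurable
  also have "\<dots> = (\<integral>\<^sup>+s. ennreal (?c * (d powr (- \<alpha>) / \<alpha>)) * (ennreal (s powr (2 * ((2 + \<alpha>) / 2) - 1) * (1 - s\<^sup>2) powr ((real ?n - 1) / 2 - 1)) * indicator {0<..<1} s) \<partial>lborel)"
  proof (rule nn_integral_cong)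
    fix s :: real
    \<comment> \<open>These rewritings exhibit the Beta parameters (2 + \<alpha>) / 2 and (n - 1) /
      2.\<close>
    have e: "(real ?n - 3) / 2 = (real ?n - 1) / 2 - 1" "1 + \<alpha> = 2 * ((2 + \<alpha>) / 2) - 1" by (simp_all add: field_simps)
    show "ennreal (?c * (1 - s\<^sup>2) powr ((real ?n - 3) / 2)) *
       (\<integral>\<^sup>+R\<in>{0<..}. ennreal (R ^ (?n - 1) * H (R * s) R) \<partial>lborel) * indicator {-1<..<1} s =
       ennreal (?c * (d powr (- \<alpha>) / \<alpha>)) * (ennreal (s powr (2 * ((2 + \<alpha>) / 2) - 1) * (1 - s\<^sup>2) powr ((real ?n - 1) / 2 - 1)) * indicator {0<..<1} s)"
    proof (cases "0 < s")
      case True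
      have "indicator {-1<..<1} s = (indicator {0<..<1} s :: ennreal)" using True by (auto simp: indicator_def)
      moreover have "ennreal (?c * (1 - s\<^sup>2) powr ((real ?n - 1) / 2 - 1)) * ennreal (s powr (1 + \<alpha>) * (d powr (- \<alpha>) / \<alpha>)) =
         ennreal (?c * (d powr (- \<alpha>) / \<alpha>)) * ennreal (s powr (1 + \<alpha>) * (1 - s\<^sup>2) powr ((real ?n - 1) / 2 - 1))"
        using n \<alpha> by (simp add: ennreal_mult'[symmetric] mult_ac)
      ultimately show ?thesis unfolding inner[OF True] e(1) e(2)[symmetric] by (simp only: mult.assoc)
    qed (use inner0 in \<open>auto simp: indicator_def not_less\<close>)
  qed
  also have "\<dots> = ennreal (?c * (d powr (- \<alpha>) / \<alpha>)) * ennreal (Beta ((2 + \<alpha>) / 2) ((real ?n - 1) / 2) / 2)"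
    by (subst nn_integral_cmult, measurable, subst nn_integral_Beta_squares) (use \<alpha> n in auto)
  also have "\<dots> = ennreal (?c * (Beta ((2 + \<alpha>) / 2) ((real ?n - 1) / 2) / 2) * (d powr (- \<alpha>) / \<alpha>))"
    using n \<alpha> by (simp add: ennreal_mult'[symmetric] mult_ac)
  finally have "(\<integral>\<^sup>+z. ennreal (if d \<le> z \<bullet> v then z \<bullet> v / norm z powr (real ?n + \<alpha> + 1) else 0) \<partial>lborel) =
    ennreal (?c * (Beta ((2 + \<alpha>) / 2) ((real ?n - 1) / 2) / 2) * (d powr (- \<alpha>) / \<alpha>))" .
  then have "ennreal (frac_mu ?n \<alpha>) * (\<integral>\<^sup>+z. ennreal (if d \<le> z \<bullet> v then z \<bullet> v / norm z powr (real ?n + \<alpha> + 1) else 0) \<partial>lborel) =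
    ennreal (frac_mu ?n \<alpha> * (?c * (Beta ((2 + \<alpha>) / 2) ((real ?n - 1) / 2) / 2)) * (d powr (- \<alpha>) / \<alpha>))"
    using frac_mu_pos[of \<alpha> ?n] \<alpha> by (simp add: ennreal_mult'[symmetric] mult_ac)
  also have "\<dots> = ennreal (frac_mu 1 \<alpha> / \<alpha> * (1 / d powr \<alpha>))"
    unfolding frac_mu_dimension_reduction[OF \<alpha> n] by (simp add: powr_minus field_simps)
  finally show ?thesis .
qed

section \<open>The nonlocal seminorm of a Lipschitz function\<close>

text \<open>The area of the unit sphere times two radial integrals: \<rho>^(-\<alpha>) over (0, 1)
  and \<rho>^(-\<alpha> - 1) over (1, infinity).\<close>

definition lip_kernel_bound :: "nat \<Rightarrow> real \<Rightarrow> real" where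
  "lip_kernel_bound n \<alpha> = real n * unit_ball_vol (real n) * (1 / (1 - \<alpha>) + 1 / \<alpha>)"

text \<open>The two terms of the minimum cross at radius 1 / L. Below it the kernel is integrable
  because \<alpha> < 1, above it because \<alpha> > 0, and both pieces scale like L to the power
  \<alpha>.\<close>

lemma nn_integral_lip_kernel:
  assumes \<alpha>: "0 < \<alpha>" "\<alpha> < 1" and L: "0 < L"
  shows "(\<integral>\<^sup>+z. ennreal (min (L * norm (z::real^'n)) 1 / norm z powr (real CARD('n) + \<alpha>)) \<partial>lborel)
    \<le> ennreal (lip_kernel_bound CARD('n) \<alpha> * L powr \<alpha>)"
proof -
  let ?n = "CARD('n)"
  let ?c = "real ?n * unit_ball_vol ?n"
  have n: "?n \<ge> 1" by (simp add: Suc_leI)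
  have c: "?c \<ge> 0" by simp
  have "(\<integral>\<^sup>+z. ennreal (min (L * norm (z::real^'n)) 1 / norm z powr (real ?n + \<alpha>)) \<partial>lborel) =
     (\<integral>\<^sup>+\<rho>\<in>{0<..}. ennreal (?c * \<rho> ^ (?n - 1)) * ennreal (min (L * \<rho>) 1 / \<rho> powr (real ?n + \<alpha>)) \<partial>lborel)"
    using nn_integral_lborel_radial[where 'a="real^'n", of "\<lambda>\<rho>. ennreal (min (L * \<rho>) 1 / \<rho> powr (real ?n + \<alpha>))"] by simp
  also have "\<dots> \<le> (\<integral>\<^sup>+\<rho>. ennreal (?c * L) * ennreal (indicator {0..1 / L} \<rho> * \<rho> powr (- \<alpha>)) +
      ennreal ?c * (ennreal (\<rho> powr (- \<alpha> - 1)) * indicator {1 / L..} \<rho>) \<partial>lborel)"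
  proof (rule nn_integral_mono)
    fix \<rho> :: real
    show "ennreal (?c * \<rho> ^ (?n - 1)) * ennreal (min (L * \<rho>) 1 / \<rho> powr (real ?n + \<alpha>)) * indicator {0<..} \<rho> \<le>
      ennreal (?c * L) * ennreal (indicator {0..1 / L} \<rho> * \<rho> powr (- \<alpha>)) +
      ennreal ?c * (ennreal (\<rho> powr (- \<alpha> - 1)) * indicator {1 / L..} \<rho>)" (is "?l \<le> ?r1 + ?r2")
    proof (cases "\<rho> > 0")
      case True
      have "\<rho> ^ (?n - 1) = \<rho> powr (real ?n - 1)" using True n by (simp add: powr_realpow[symmetric] of_nat_diff)
      then have *: "\<rho> ^ (?n - 1) / \<rho> powr (real ?n + \<alpha>) = \<rho> powr (- \<alpha> - 1)"
        by (simp only: powr_diff[symmetric]) (rule arg_cong[where f="(powr) \<rho>"], simp)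
      have l: "?l = ennreal (?c * (min (L * \<rho>) 1 * (\<rho> ^ (?n - 1) / \<rho> powr (real ?n + \<alpha>))))"
        using True L c by (simp add: ennreal_mult'[symmetric] mult_ac)
      show ?thesis
      proof (cases "\<rho> \<le> 1 / L")
        case le: True
        have "?l = ennreal (?c * (L * (\<rho> * \<rho> powr (- \<alpha> - 1))))"
          unfolding l * using le L True by (simp add: min_def field_simps)
        also have "\<rho> * \<rho> powr (- \<alpha> - 1) = \<rho> powr (- \<alpha>)" using True powr_mult_base[of \<rho> "- \<alpha> - 1"] by simp
        also have "ennreal (?c * (L * \<rho> powr (- \<alpha>))) = ?r1"
          using le True L c by (simp add: ennreal_mult'[symmetric] mult_ac)
        finally show ?thesis by simp
      next
        case gt: False
        have "?l = ennreal (?c * \<rho> powr (- \<alpha> - 1))"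
          unfolding l * using gt L True by (simp add: min_def field_simps)
        also have "\<dots> = ?r2" using gt c by (simp add: ennreal_mult')
        finally show ?thesis by simp
      qed
    qed simp
  qed
  also have "\<dots> = ennreal (?c * L) * (\<integral>\<^sup>+\<rho>. ennreal (indicator {0..1 / L} \<rho> * \<rho> powr (- \<alpha>)) \<partial>lborel) +
      ennreal ?c * (\<integral>\<^sup>+\<rho>\<in>{1 / L..}. ennreal (\<rho> powr (- \<alpha> - 1)) \<partial>lborel)"
    by (subst nn_integral_add, measurable, subst (1 2) nn_integral_cmult) measurable
  also have "(\<integral>\<^sup>+\<rho>. ennreal (indicator {0..1 / L} \<rho> * \<rho> powr (- \<alpha>)) \<partial>lborel) = ennreal ((1 / L) powr (- \<alpha> + 1) / (- \<alpha> + 1))"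
    using nn_integral_has_integral_lebesgue[OF _ has_integral_powr_from_0[of "- \<alpha>" "1 / L"]] \<alpha> L by simp
  also have "(\<integral>\<^sup>+\<rho>\<in>{1 / L..}. ennreal (\<rho> powr (- \<alpha> - 1)) \<partial>lborel) = ennreal ((1 / L) powr (- \<alpha>) / \<alpha>)"
    using L \<alpha> by (intro nn_integral_powr_atLeast) auto
  also have "ennreal (?c * L) * ennreal ((1 / L) powr (- \<alpha> + 1) / (- \<alpha> + 1)) + ennreal ?c * ennreal ((1 / L) powr (- \<alpha>) / \<alpha>) =
     ennreal (?c * L * ((1 / L) powr (- \<alpha> + 1) / (- \<alpha> + 1)) + ?c * ((1 / L) powr (- \<alpha>) / \<alpha>))"
    using L \<alpha> c by (simp add: ennreal_mult'[symmetric] ennreal_plus[symmetric] del: ennreal_plus)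
  also have "?c * L * ((1 / L) powr (- \<alpha> + 1) / (- \<alpha> + 1)) + ?c * ((1 / L) powr (- \<alpha>) / \<alpha>) = lip_kernel_bound ?n \<alpha> * L powr \<alpha>"
  proof -
    have 1: "(1 / L) powr (- \<alpha>) = L powr \<alpha>" using L by (simp add: powr_divide powr_minus)
    moreover have "L * (1 / L) powr (- \<alpha> + 1) = L powr \<alpha>"
      unfolding powr_add[of "1 / L" "- \<alpha>" 1] 1 using L by simp
    ultimately show ?thesis by (simp add: lip_kernel_bound_def field_simps)
  qed
  finally show ?thesis .
qed

text \<open>The inner integral of the Gagliardo seminorm of order \<alpha> and exponent one, kept at
  a fixed point. It dominates the divergence kernel, and its values in \<open>ennreal\<close> permit
  Tonelli before finiteness is known.\<close>

definition gagliardo :: "real \<Rightarrow> (real^'n \<Rightarrow> real) \<Rightarrow> real^'n \<Rightarrow> ennreal" where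
  "gagliardo \<alpha> \<psi> x = (\<integral>\<^sup>+y. ennreal (\<bar>\<psi> y - \<psi> x\<bar> / norm (y - x) powr (real CARD('n) + \<alpha>)) \<partial>lborel)"

lemma borel_measurable_gagliardo [measurable]:
  fixes \<psi> :: "real^'n \<Rightarrow> real"
  assumes [measurable]: "\<psi> \<in> borel_measurable borel"
  shows "gagliardo \<alpha> \<psi> \<in> borel_measurable borel"
  unfolding gagliardo_def[abs_def]
  by measurable

lemma gagliardo_le:
  fixes \<psi> :: "real^'n \<Rightarrow> real"
  assumes \<alpha>: "0 < \<alpha>" "\<alpha> < 1" and L: "0 < L" and lip: "\<And>x y. \<bar>\<psi> y - \<psi> x\<bar> \<le> min (L * norm (y - x)) 1"
  shows "gagliardo \<alpha> \<psi> x \<le> ennreal (lip_kernel_bound CARD('n) \<alpha> * L powr \<alpha>)"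
proof -
  have "gagliardo \<alpha> \<psi> x \<le> (\<integral>\<^sup>+y. ennreal (min (L * norm (y - x)) 1 / norm (y - x) powr (real CARD('n) + \<alpha>)) \<partial>lborel)"
    unfolding gagliardo_def by (intro nn_integral_mono ennreal_leI divide_right_mono lip) simp
  also have "\<dots> = (\<integral>\<^sup>+z. ennreal (min (L * norm (z::real^'n)) 1 / norm z powr (real CARD('n) + \<alpha>)) \<partial>lborel)"
    using nn_integral_lborel_translate[of "\<lambda>z::real^'n. ennreal (min (L * norm z) 1 / norm z powr (real CARD('n) + \<alpha>))" "- x"] by simp
  also have "\<dots> \<le> ennreal (lip_kernel_bound CARD('n) \<alpha> * L powr \<alpha>)" by (rule nn_integral_lip_kernel[OF \<alpha> L])
  finally show ?thesis .
qed

text \<open>For a fixed shift z = y - x the difference can be nonzero only if x or x + z lies in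
  \<open>S\<close>. Each case contributes the measure of \<open>S\<close>, hence the factor
  2.\<close>

lemma nn_integral_gagliardo_le:
  fixes \<psi> :: "real^'n \<Rightarrow> real"
  assumes \<alpha>: "0 < \<alpha>" "\<alpha> < 1" and L: "0 < L" and lip: "\<And>x y. \<bar>\<psi> y - \<psi> x\<bar> \<le> min (L * norm (y - x)) 1"
    and [measurable]: "\<psi> \<in> borel_measurable borel" "S \<in> sets borel" and S: "\<And>x. x \<notin> S \<Longrightarrow> \<psi> x = 0"
  shows "(\<integral>\<^sup>+x. gagliardo \<alpha> \<psi> x \<partial>lborel) \<le> 2 * emeasure lborel S * ennreal (lip_kernel_bound CARD('n) \<alpha> * L powr \<alpha>)"
proof -
  let ?k = "\<lambda>z::real^'n. norm z powr (real CARD('n) + \<alpha>)"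
  have "(\<integral>\<^sup>+x. gagliardo \<alpha> \<psi> x \<partial>lborel) = (\<integral>\<^sup>+x. \<integral>\<^sup>+z. ennreal (\<bar>\<psi> (x + z) - \<psi> x\<bar> / ?k z) \<partial>lborel \<partial>lborel)"
  proof (rule nn_integral_cong)
    fix x :: "real^'n"
    show "gagliardo \<alpha> \<psi> x = (\<integral>\<^sup>+z. ennreal (\<bar>\<psi> (x + z) - \<psi> x\<bar> / ?k z) \<partial>lborel)"
      unfolding gagliardo_def
      using nn_integral_lborel_translate[of "\<lambda>y. ennreal (\<bar>\<psi> y - \<psi> x\<bar> / ?k (y - x))" x] by simp
  qed
  also have "\<dots> = (\<integral>\<^sup>+z. \<integral>\<^sup>+x. ennreal (\<bar>\<psi> (x + z) - \<psi> x\<bar> / ?k z) \<partial>lborel \<partial>lborel)"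
    by (rule lborel_pair.Fubini') measurable
  also have "\<dots> \<le> (\<integral>\<^sup>+z. \<integral>\<^sup>+x. ennreal (min (L * norm z) 1 / ?k z) * (indicator S x + indicator S (z + x)) \<partial>lborel \<partial>lborel)"
  proof (intro nn_integral_mono)
    fix z x :: "real^'n"
    show "ennreal (\<bar>\<psi> (x + z) - \<psi> x\<bar> / ?k z) \<le> ennreal (min (L * norm z) 1 / ?k z) * (indicator S x + indicator S (z + x))"
    proof (cases "x \<in> S \<or> z + x \<in> S")
      case True
      then have "1 \<le> (indicator S x + indicator S (z + x) :: ennreal)" by (auto simp: indicator_def)
      then have "ennreal (min (L * norm z) 1 / ?k z) * 1 \<le> ennreal (min (L * norm z) 1 / ?k z) * (indicator S x + indicator S (z + x))"
        by (rule mult_left_mono) simp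
      moreover have "ennreal (\<bar>\<psi> (x + z) - \<psi> x\<bar> / ?k z) \<le> ennreal (min (L * norm z) 1 / ?k z)"
        using lip[of "x + z" x] by (intro ennreal_leI divide_right_mono) auto
      ultimately show ?thesis by simp
    next
      case False
      then show ?thesis using S by (simp add: add.commute)
    qed
  qed
  also have "\<dots> = (\<integral>\<^sup>+z. ennreal (min (L * norm z) 1 / ?k z) * (2 * emeasure lborel S) \<partial>lborel)"
  proof (rule nn_integral_cong)
    fix z :: "real^'n"
    have "(\<integral>\<^sup>+x. (indicator S (z + x) :: ennreal) \<partial>lborel) = emeasure lborel S"
      using nn_integral_lborel_translate[of "indicator S" z] by simp
    then show "(\<integral>\<^sup>+x. ennreal (min (L * norm z) 1 / ?k z) * (indicator S x + indicator S (z + x)) \<partial>lborel) =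
       ennreal (min (L * norm z) 1 / ?k z) * (2 * emeasure lborel S)"
      by (subst nn_integral_cmult, measurable, subst nn_integral_add, measurable) (simp add: mult_2)
  qed
  also have "\<dots> = (\<integral>\<^sup>+z. ennreal (min (L * norm z) 1 / ?k z) \<partial>lborel) * (2 * emeasure lborel S)"
    by (rule nn_integral_multc) measurable
  also have "\<dots> \<le> ennreal (lip_kernel_bound CARD('n) \<alpha> * L powr \<alpha>) * (2 * emeasure lborel S)"
    by (intro mult_right_mono nn_integral_lip_kernel \<alpha> L) simp
  finally show ?thesis by (simp add: mult_ac)
qed

text \<open>Where f exceeds M, it is at most M^(1 - p) f^p. The part bounded by M is paired with the
  integral bound on \<open>gagliardo\<close>, the rest with the supremum bound. The level M stays
  free so that it can be tuned to the scale of the cut-off.\<close>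

lemma nn_integral_mult_gagliardo_le:
  fixes \<psi> :: "real^'n \<Rightarrow> real"
  assumes \<alpha>: "0 < \<alpha>" "\<alpha> < 1" and L: "0 < L" and lip: "\<And>x y. \<bar>\<psi> y - \<psi> x\<bar> \<le> min (L * norm (y - x)) 1"
    and [measurable]: "\<psi> \<in> borel_measurable borel" "S \<in> sets borel" and S: "\<And>x. x \<notin> S \<Longrightarrow> \<psi> x = 0"
    and [measurable]: "f \<in> borel_measurable borel" and f: "\<And>x. 0 \<le> f x" and p: "1 \<le> p" and M: "0 < M"
  shows "(\<integral>\<^sup>+x. ennreal (f x) * gagliardo \<alpha> \<psi> x \<partial>lborel) \<le>
    ennreal (lip_kernel_bound CARD('n) \<alpha> * L powr \<alpha>) *
      (2 * emeasure lborel S * ennreal M + ennreal (M powr (1 - p)) * (\<integral>\<^sup>+x. ennreal (f x powr p) \<partial>lborel))"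
proof -
  let ?K = "ennreal (lip_kernel_bound CARD('n) \<alpha> * L powr \<alpha>)"
  have f_le: "f x \<le> M + M powr (1 - p) * f x powr p" for x
  proof (cases "f x \<le> M")
    case True
    have "0 \<le> M powr (1 - p) * f x powr p" by simp
    with True show ?thesis by linarith
  next
    case False
    then have fx: "f x > M" by simp
    have "f x powr (p - 1) \<ge> M powr (p - 1)" using M fx p by (intro powr_mono2) auto
    then have "M powr (1 - p) * f x powr (p - 1) \<ge> M powr (1 - p) * M powr (p - 1)" by (intro mult_left_mono) auto
    then have 1: "M powr (1 - p) * f x powr (p - 1) \<ge> 1" using M by (simp add: powr_add[symmetric])
    have "f x powr p = f x powr (p - 1) * f x" using fx M powr_mult_base[of "f x" "p - 1"] by (simp add: mult.commute)
    then have "M powr (1 - p) * f x powr p = (M powr (1 - p) * f x powr (p - 1)) * f x" by simp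
    also have "\<dots> \<ge> 1 * f x" by (rule mult_right_mono[OF 1 f])
    finally show ?thesis using M by simp
  qed
  have "(\<integral>\<^sup>+x. ennreal (f x) * gagliardo \<alpha> \<psi> x \<partial>lborel) \<le>
     (\<integral>\<^sup>+x. ennreal M * gagliardo \<alpha> \<psi> x + ennreal (M powr (1 - p)) * ennreal (f x powr p) * ?K \<partial>lborel)"
  proof (rule nn_integral_mono)
    fix x
    have "ennreal (f x) \<le> ennreal M + ennreal (M powr (1 - p)) * ennreal (f x powr p)"
      using ennreal_leI[OF f_le[of x]] M by (simp add: ennreal_mult'[symmetric] ennreal_plus[symmetric] del: ennreal_plus)
    then have "ennreal (f x) * gagliardo \<alpha> \<psi> x \<le> (ennreal M + ennreal (M powr (1 - p)) * ennreal (f x powr p)) * gagliardo \<alpha> \<psi> x"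
      by (rule mult_right_mono) simp
    also have "\<dots> = ennreal M * gagliardo \<alpha> \<psi> x + ennreal (M powr (1 - p)) * ennreal (f x powr p) * gagliardo \<alpha> \<psi> x"
      by (rule distrib_right)
    also have "\<dots> \<le> ennreal M * gagliardo \<alpha> \<psi> x + ennreal (M powr (1 - p)) * ennreal (f x powr p) * ?K"
      by (intro add_left_mono mult_left_mono gagliardo_le \<alpha> L lip) simp
    finally show "ennreal (f x) * gagliardo \<alpha> \<psi> x \<le> ennreal M * gagliardo \<alpha> \<psi> x + ennreal (M powr (1 - p)) * ennreal (f x powr p) * ?K" .
  qed
  also have "\<dots> = ennreal M * (\<integral>\<^sup>+x. gagliardo \<alpha> \<psi> x \<partial>lborel) + ennreal (M powr (1 - p)) * (\<integral>\<^sup>+x. ennreal (f x powr p) \<partial>lborel) * ?K"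
    by (subst nn_integral_add, measurable, subst nn_integral_multc, measurable, subst (1 2) nn_integral_cmult) measurable
  also have "\<dots> \<le> ennreal M * (2 * emeasure lborel S * ?K) + ennreal (M powr (1 - p)) * (\<integral>\<^sup>+x. ennreal (f x powr p) \<partial>lborel) * ?K"
    by (intro add_right_mono mult_left_mono nn_integral_gagliardo_le[OF \<alpha> L lip]) (use S in auto)
  finally show ?thesis by (simp add: algebra_simps)
qed

section \<open>Testing with products\<close>

text \<open>Cauchy-Schwarz trades the inner product for one power of the distance. At z = 0 both
  sides vanish by the conventions for \<open>powr\<close> and division.\<close>

lemma abs_inner_kernel_le:
  fixes v :: "real^'n"
  assumes v: "norm v = 1"
  shows "\<bar>(z \<bullet> v) * c / norm z powr (b + 1)\<bar> \<le> \<bar>c\<bar> / norm z powr b"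
proof (cases "z = 0")
  case False
  then have z: "norm z > 0" by simp
  have "\<bar>z \<bullet> v\<bar> \<le> norm z" using Cauchy_Schwarz_ineq2[of z v] v by simp
  then have "\<bar>z \<bullet> v\<bar> * \<bar>c\<bar> / norm z powr (b + 1) \<le> norm z * \<bar>c\<bar> / norm z powr (b + 1)"
    by (intro divide_right_mono mult_right_mono) auto
  also have "\<dots> = \<bar>c\<bar> / norm z powr b" using z by (simp add: powr_add)
  finally show ?thesis by (simp add: abs_mult)
qed simp

lemma frac_div_scaleR:
  fixes v :: "real^'n"
  shows "frac_div \<alpha> (\<lambda>y. \<psi> y *\<^sub>R v) x = frac_mu CARD('n) \<alpha> *
    (LINT y|lborel. ((y - x) \<bullet> v) * (\<psi> y - \<psi> x) / norm (y - x) powr (real CARD('n) + \<alpha> + 1))"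
  unfolding frac_div_def by (simp add: scaleR_diff_left[symmetric] mult_ac)

lemma integrable_gagliardo:
  fixes \<psi> :: "real^'n \<Rightarrow> real"
  assumes [measurable]: "\<psi> \<in> borel_measurable borel" and fin: "gagliardo \<alpha> \<psi> x < \<infinity>"
  shows "integrable lborel (\<lambda>y. \<bar>\<psi> y - \<psi> x\<bar> / norm (y - x) powr (real CARD('n) + \<alpha>))"
    and "(LINT y|lborel. \<bar>\<psi> y - \<psi> x\<bar> / norm (y - x) powr (real CARD('n) + \<alpha>)) = enn2real (gagliardo \<alpha> \<psi> x)"
proof -
  show "integrable lborel (\<lambda>y. \<bar>\<psi> y - \<psi> x\<bar> / norm (y - x) powr (real CARD('n) + \<alpha>))"
    by (rule integrableI_bounded) (use fin in \<open>simp_all add: gagliardo_def\<close>)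
  show "(LINT y|lborel. \<bar>\<psi> y - \<psi> x\<bar> / norm (y - x) powr (real CARD('n) + \<alpha>)) = enn2real (gagliardo \<alpha> \<psi> x)"
    unfolding gagliardo_def by (rule integral_eq_nn_integral) auto
qed

lemma integrable_frac_div_kernel:
  fixes \<psi> :: "real^'n \<Rightarrow> real" and v :: "real^'n"
  assumes [measurable]: "\<psi> \<in> borel_measurable borel" and fin: "gagliardo \<alpha> \<psi> x < \<infinity>" and v: "norm v = 1"
  shows "integrable lborel (\<lambda>y. ((y - x) \<bullet> v) * (\<psi> y - \<psi> x) / norm (y - x) powr (real CARD('n) + \<alpha> + 1))"
    and "\<bar>LINT y|lborel. ((y - x) \<bullet> v) * (\<psi> y - \<psi> x) / norm (y - x) powr (real CARD('n) + \<alpha> + 1)\<bar> \<le> enn2real (gagliardo \<alpha> \<psi> x)"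
proof -
  note A = integrable_gagliardo[OF assms(1) fin]
  show I: "integrable lborel (\<lambda>y. ((y - x) \<bullet> v) * (\<psi> y - \<psi> x) / norm (y - x) powr (real CARD('n) + \<alpha> + 1))"
    by (rule Bochner_Integration.integrable_bound[OF A(1)])
      (use abs_inner_kernel_le[OF v, of "_ - x"] in auto)
  have "\<bar>LINT y|lborel. ((y - x) \<bullet> v) * (\<psi> y - \<psi> x) / norm (y - x) powr (real CARD('n) + \<alpha> + 1)\<bar> \<le>
     (LINT y|lborel. \<bar>\<psi> y - \<psi> x\<bar> / norm (y - x) powr (real CARD('n) + \<alpha>))"
    using integral_abs_bound
    by (rule order_trans) (intro integral_mono integrable_abs I A(1) abs_inner_kernel_le[OF v])
  then show "\<bar>LINT y|lborel. ((y - x) \<bullet> v) * (\<psi> y - \<psi> x) / norm (y - x) powr (real CARD('n) + \<alpha> + 1)\<bar> \<le> enn2real (gagliardo \<alpha> \<psi> x)"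
    unfolding A(2) .
qed

text \<open>Leibniz rule \<open>g y \<eta> y - g x \<eta> x = \<eta> x (g y - g x) + g y (\<eta> y - \<eta> x)\<close>; the error
  term is controlled by the cut-off alone.\<close>

lemma kernel_product_ge:
  fixes g \<eta> :: "real^'n \<Rightarrow> real" and v :: "real^'n"
  assumes [measurable]: "g \<in> borel_measurable borel" "\<eta> \<in> borel_measurable borel" and v: "norm v = 1"
    and g: "\<And>y. 0 \<le> g y" "\<And>y. g y \<le> 1" and \<eta>: "\<And>y. 0 \<le> \<eta> y"
    and mono: "\<And>x y. 0 \<le> ((y - x) \<bullet> v) * (g y - g x)"
    and fin: "gagliardo \<alpha> (\<lambda>y. g y * \<eta> y) x < \<infinity>" "gagliardo \<alpha> \<eta> x < \<infinity>"
  shows "(\<integral>\<^sup>+y. ennreal (\<eta> x * (((y - x) \<bullet> v) * (g y - g x) / norm (y - x) powr (real CARD('n) + \<alpha> + 1))) \<partial>lborel) \<le>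
     ennreal ((LINT y|lborel. ((y - x) \<bullet> v) * (g y * \<eta> y - g x * \<eta> x) / norm (y - x) powr (real CARD('n) + \<alpha> + 1)) +
       enn2real (gagliardo \<alpha> \<eta> x))"
    and "0 \<le> (LINT y|lborel. ((y - x) \<bullet> v) * (g y * \<eta> y - g x * \<eta> x) / norm (y - x) powr (real CARD('n) + \<alpha> + 1)) +
       enn2real (gagliardo \<alpha> \<eta> x)"
proof -
  define Q where "Q y = ((y - x) \<bullet> v) * (g y * \<eta> y - g x * \<eta> x) / norm (y - x) powr (real CARD('n) + \<alpha> + 1)" for y
  define B where "B y = \<bar>\<eta> y - \<eta> x\<bar> / norm (y - x) powr (real CARD('n) + \<alpha>)" for y
  define P where "P y = \<eta> x * (((y - x) \<bullet> v) * (g y - g x) / norm (y - x) powr (real CARD('n) + \<alpha> + 1))" for y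
  have Q: "integrable lborel Q" unfolding Q_def[abs_def]
    by (rule integrable_frac_div_kernel[OF _ fin(1) v]) measurable
  have B: "integrable lborel B" "(LINT y|lborel. B y) = enn2real (gagliardo \<alpha> \<eta> x)" unfolding B_def[abs_def]
    by (rule integrable_gagliardo[OF _ fin(2)], measurable)+
  have P0: "0 \<le> P y" for y unfolding P_def using mono[of y x] \<eta>[of x] by simp
  have PQ: "P y \<le> Q y + B y" for y
  proof -
    have "\<bar>((y - x) \<bullet> v) * (g y * (\<eta> y - \<eta> x)) / norm (y - x) powr (real CARD('n) + \<alpha> + 1)\<bar> \<le> \<bar>g y * (\<eta> y - \<eta> x)\<bar> / norm (y - x) powr (real CARD('n) + \<alpha>)"
      by (rule abs_inner_kernel_le[OF v])
    also have "\<dots> \<le> B y" unfolding B_def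
      using g[of y] by (intro divide_right_mono) (auto simp: abs_mult mult_left_le_one_le)
    finally have "- B y \<le> ((y - x) \<bullet> v) * (g y * (\<eta> y - \<eta> x)) / norm (y - x) powr (real CARD('n) + \<alpha> + 1)" by linarith
    moreover have "Q y = P y + ((y - x) \<bullet> v) * (g y * (\<eta> y - \<eta> x)) / norm (y - x) powr (real CARD('n) + \<alpha> + 1)"
      unfolding Q_def P_def by (simp add: add_divide_distrib[symmetric] algebra_simps)
    ultimately show ?thesis by linarith
  qed
  \<comment> \<open>Nonnegativity, inherited from the monotone part \<open>P\<close>, allows the
    Bochner integral of the sum to be read as a nonnegative one.\<close>
  have nn: "0 \<le> Q y + B y" for y using P0[of y] PQ[of y] by linarith
  have int: "(LINT y|lborel. Q y + B y) = (LINT y|lborel. Q y) + enn2real (gagliardo \<alpha> \<eta> x)"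
    using Q B by simp
  have "(\<integral>\<^sup>+y. ennreal (P y) \<partial>lborel) \<le> (\<integral>\<^sup>+y. ennreal (Q y + B y) \<partial>lborel)"
    by (intro nn_integral_mono ennreal_leI PQ)
  also have "\<dots> = ennreal (LINT y|lborel. Q y + B y)"
    by (rule nn_integral_eq_integral) (use Q B nn in auto)
  finally show "(\<integral>\<^sup>+y. ennreal (\<eta> x * (((y - x) \<bullet> v) * (g y - g x) / norm (y - x) powr (real CARD('n) + \<alpha> + 1))) \<partial>lborel) \<le>
     ennreal ((LINT y|lborel. ((y - x) \<bullet> v) * (g y * \<eta> y - g x * \<eta> x) / norm (y - x) powr (real CARD('n) + \<alpha> + 1)) +
       enn2real (gagliardo \<alpha> \<eta> x))"
    unfolding int unfolding P_def Q_def .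
  have "0 \<le> (LINT y|lborel. Q y + B y)" by (rule integral_nonneg_AE) (simp add: nn)
  then show "0 \<le> (LINT y|lborel. ((y - x) \<bullet> v) * (g y * \<eta> y - g x * \<eta> x) / norm (y - x) powr (real CARD('n) + \<alpha> + 1)) +
       enn2real (gagliardo \<alpha> \<eta> x)" unfolding int unfolding Q_def .
qed

lemma borel_measurable_frac_div [measurable]:
  fixes \<phi> :: "real^'n \<Rightarrow> real^'n"
  assumes [measurable]: "\<phi> \<in> borel_measurable borel"
  shows "frac_div \<alpha> \<phi> \<in> borel_measurable borel"
  unfolding frac_div_def[abs_def] by measurable

lemma integrable_mult_gagliardo:
  fixes \<psi> f :: "real^'n \<Rightarrow> real"
  assumes [measurable]: "\<psi> \<in> borel_measurable borel" "f \<in> borel_measurable borel"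
    and f: "\<And>x. 0 \<le> f x" and fin: "\<And>x. gagliardo \<alpha> \<psi> x < \<infinity>"
    and fin2: "(\<integral>\<^sup>+x. ennreal (f x) * gagliardo \<alpha> \<psi> x \<partial>lborel) < \<infinity>"
  shows "integrable lborel (\<lambda>x. f x * enn2real (gagliardo \<alpha> \<psi> x))"
    and "ennreal (LINT x|lborel. f x * enn2real (gagliardo \<alpha> \<psi> x)) = (\<integral>\<^sup>+x. ennreal (f x) * gagliardo \<alpha> \<psi> x \<partial>lborel)"
proof -
  have eq: "ennreal (f x * enn2real (gagliardo \<alpha> \<psi> x)) = ennreal (f x) * gagliardo \<alpha> \<psi> x" for x
    using f[of x] fin[of x] by (simp add: ennreal_mult')
  show I: "integrable lborel (\<lambda>x. f x * enn2real (gagliardo \<alpha> \<psi> x))"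
    by (rule integrableI_bounded) (use fin2 f in \<open>simp_all add: eq\<close>)
  have "ennreal (LINT x|lborel. f x * enn2real (gagliardo \<alpha> \<psi> x)) = (\<integral>\<^sup>+x. ennreal (f x * enn2real (gagliardo \<alpha> \<psi> x)) \<partial>lborel)"
    by (rule nn_integral_eq_integral[symmetric, OF I]) (simp add: f)
  then show "ennreal (LINT x|lborel. f x * enn2real (gagliardo \<alpha> \<psi> x)) = (\<integral>\<^sup>+x. ennreal (f x) * gagliardo \<alpha> \<psi> x \<partial>lborel)"
    unfolding eq .
qed

text \<open>The pointwise Leibniz estimate is integrated against f. The cut-off error is placed on
  the right, so that the left side keeps a nonnegative integrand and is ready for Fatou's
  lemma.\<close>

lemma nn_integral_frac_div_product_ge:
  fixes f g \<eta> :: "real^'n \<Rightarrow> real" and v :: "real^'n"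
  assumes \<alpha>: "0 < \<alpha>" "\<alpha> < 1"
    and mg [measurable]: "g \<in> borel_measurable borel" and m\<eta> [measurable]: "\<eta> \<in> borel_measurable borel"
    and mf [measurable]: "f \<in> borel_measurable borel"
    and v: "norm v = 1"
    and g: "\<And>y. 0 \<le> g y" "\<And>y. g y \<le> 1" and \<eta>: "\<And>y. 0 \<le> \<eta> y" and f: "\<And>x. 0 \<le> f x"
    and mono: "\<And>x y. 0 \<le> ((y - x) \<bullet> v) * (g y - g x)"
    and fin: "\<And>x. gagliardo \<alpha> (\<lambda>y. g y * \<eta> y) x < \<infinity>" "\<And>x. gagliardo \<alpha> \<eta> x < \<infinity>"
    and fin2: "(\<integral>\<^sup>+x. ennreal (f x) * gagliardo \<alpha> (\<lambda>y. g y * \<eta> y) x \<partial>lborel) < \<infinity>"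
      "(\<integral>\<^sup>+x. ennreal (f x) * gagliardo \<alpha> \<eta> x \<partial>lborel) < \<infinity>"
  shows "ennreal (frac_mu CARD('n) \<alpha>) * (\<integral>\<^sup>+x. \<integral>\<^sup>+y. ennreal (f x * \<eta> x * (((y - x) \<bullet> v) * (g y - g x) / norm (y - x) powr (real CARD('n) + \<alpha> + 1))) \<partial>lborel \<partial>lborel)
    \<le> ennreal (LINT x|lborel. f x * frac_div \<alpha> (\<lambda>y. (g y * \<eta> y) *\<^sub>R v) x) +
      ennreal (frac_mu CARD('n) \<alpha>) * (\<integral>\<^sup>+x. ennreal (f x) * gagliardo \<alpha> \<eta> x \<partial>lborel)"
proof -
  let ?\<mu> = "frac_mu CARD('n) \<alpha>"
  let ?Q = "\<lambda>x. LINT y|lborel. ((y - x) \<bullet> v) * (g y * \<eta> y - g x * \<eta> x) / norm (y - x) powr (real CARD('n) + \<alpha> + 1)"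
  have \<mu>: "?\<mu> > 0" using \<alpha> by (intro frac_mu_pos) auto
  have mge [measurable]: "(\<lambda>y. g y * \<eta> y) \<in> borel_measurable borel" by measurable
  note kp = kernel_product_ge[OF mg m\<eta> v g \<eta> mono fin]
  have fd: "frac_div \<alpha> (\<lambda>y. (g y * \<eta> y) *\<^sub>R v) x = ?\<mu> * ?Q x" for x by (rule frac_div_scaleR)
  note I1 = integrable_mult_gagliardo(1)[OF mge mf f fin(1) fin2(1)]
  note I2 = integrable_mult_gagliardo[OF m\<eta> mf f fin(2) fin2(2)]
  \<comment> \<open>A Bochner integral without integrability is zero by default and could not be
    split off from the error term.\<close>
  have I3: "integrable lborel (\<lambda>x. f x * frac_div \<alpha> (\<lambda>y. (g y * \<eta> y) *\<^sub>R v) x)"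
  proof (rule Bochner_Integration.integrable_bound)
    show "integrable lborel (\<lambda>x. ?\<mu> * (f x * enn2real (gagliardo \<alpha> (\<lambda>y. g y * \<eta> y) x)))" using I1 by simp
    show "AE x in lborel. norm (f x * frac_div \<alpha> (\<lambda>y. (g y * \<eta> y) *\<^sub>R v) x) \<le> norm (?\<mu> * (f x * enn2real (gagliardo \<alpha> (\<lambda>y. g y * \<eta> y) x)))"
    proof (rule AE_I2)
      fix x
      have "\<bar>?Q x\<bar> \<le> enn2real (gagliardo \<alpha> (\<lambda>y. g y * \<eta> y) x)"
        by (rule integrable_frac_div_kernel(2)[OF mge fin(1) v])
      then have "?\<mu> * (f x * \<bar>?Q x\<bar>) \<le> ?\<mu> * (f x * enn2real (gagliardo \<alpha> (\<lambda>y. g y * \<eta> y) x))"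
        using \<mu> f[of x] by (intro mult_left_mono) auto
      moreover have "norm (f x * frac_div \<alpha> (\<lambda>y. (g y * \<eta> y) *\<^sub>R v) x) = ?\<mu> * (f x * \<bar>?Q x\<bar>)"
        unfolding fd using \<mu> f[of x] by (simp add: abs_mult)
      ultimately show "norm (f x * frac_div \<alpha> (\<lambda>y. (g y * \<eta> y) *\<^sub>R v) x) \<le> norm (?\<mu> * (f x * enn2real (gagliardo \<alpha> (\<lambda>y. g y * \<eta> y) x)))"
        by simp
    qed
  qed measurable
  let ?tot = "\<lambda>x. f x * frac_div \<alpha> (\<lambda>y. (g y * \<eta> y) *\<^sub>R v) x + ?\<mu> * (f x * enn2real (gagliardo \<alpha> \<eta> x))"
  have tot: "?tot x = ?\<mu> * f x * (?Q x + enn2real (gagliardo \<alpha> \<eta> x))" for x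
    unfolding fd by (simp add: algebra_simps)
  have "ennreal ?\<mu> * (\<integral>\<^sup>+x. \<integral>\<^sup>+y. ennreal (f x * \<eta> x * (((y - x) \<bullet> v) * (g y - g x) / norm (y - x) powr (real CARD('n) + \<alpha> + 1))) \<partial>lborel \<partial>lborel)
     = (\<integral>\<^sup>+x. ennreal ?\<mu> * (\<integral>\<^sup>+y. ennreal (f x * \<eta> x * (((y - x) \<bullet> v) * (g y - g x) / norm (y - x) powr (real CARD('n) + \<alpha> + 1))) \<partial>lborel) \<partial>lborel)"
    by (rule nn_integral_cmult[symmetric]) measurable
  also have "\<dots> \<le> (\<integral>\<^sup>+x. ennreal (?tot x) \<partial>lborel)"
  proof (rule nn_integral_mono)
    fix x
    have "(\<integral>\<^sup>+y. ennreal (f x * \<eta> x * (((y - x) \<bullet> v) * (g y - g x) / norm (y - x) powr (real CARD('n) + \<alpha> + 1))) \<partial>lborel) =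
      (\<integral>\<^sup>+y. ennreal (f x) * ennreal (\<eta> x * (((y - x) \<bullet> v) * (g y - g x) / norm (y - x) powr (real CARD('n) + \<alpha> + 1))) \<partial>lborel)"
      by (rule nn_integral_cong) (simp only: ennreal_mult'[symmetric] f mult.assoc)
    also have "\<dots> = ennreal (f x) * (\<integral>\<^sup>+y. ennreal (\<eta> x * (((y - x) \<bullet> v) * (g y - g x) / norm (y - x) powr (real CARD('n) + \<alpha> + 1))) \<partial>lborel)"
      by (rule nn_integral_cmult) measurable
    also have "\<dots> \<le> ennreal (f x) * ennreal (?Q x + enn2real (gagliardo \<alpha> \<eta> x))"
      by (rule mult_left_mono[OF kp(1)]) simp
    finally have "ennreal ?\<mu> * (\<integral>\<^sup>+y. ennreal (f x * \<eta> x * (((y - x) \<bullet> v) * (g y - g x) / norm (y - x) powr (real CARD('n) + \<alpha> + 1))) \<partial>lborel)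
       \<le> ennreal ?\<mu> * (ennreal (f x) * ennreal (?Q x + enn2real (gagliardo \<alpha> \<eta> x)))"
      by (rule mult_left_mono) simp
    also have "\<dots> = ennreal (?tot x)"
      unfolding tot using \<mu> f[of x] by (simp add: ennreal_mult' mult.assoc)
    finally show "ennreal ?\<mu> * (\<integral>\<^sup>+y. ennreal (f x * \<eta> x * (((y - x) \<bullet> v) * (g y - g x) / norm (y - x) powr (real CARD('n) + \<alpha> + 1))) \<partial>lborel)
       \<le> ennreal (?tot x)" .
  qed
  also have "\<dots> = ennreal (LINT x|lborel. ?tot x)"
  proof (rule nn_integral_eq_integral)
    show "integrable lborel ?tot" using I2(1) I3 by simp
    show "AE x in lborel. 0 \<le> ?tot x" unfolding tot using \<mu> f kp(2) by (intro AE_I2 mult_nonneg_nonneg) (auto intro: less_imp_le)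
  qed
  also have "(LINT x|lborel. ?tot x) = (LINT x|lborel. f x * frac_div \<alpha> (\<lambda>y. (g y * \<eta> y) *\<^sub>R v) x) +
      ?\<mu> * (LINT x|lborel. f x * enn2real (gagliardo \<alpha> \<eta> x))"
    using I2(1) I3 by simp
  \<comment> \<open>The pairing of f with the divergence may be negative and is then clipped to zero
    by \<open>ennreal\<close>. Subadditivity still holds because the error term is
    nonnegative.\<close>
  also have "ennreal \<dots> \<le> ennreal (LINT x|lborel. f x * frac_div \<alpha> (\<lambda>y. (g y * \<eta> y) *\<^sub>R v) x) +
      ennreal (?\<mu> * (LINT x|lborel. f x * enn2real (gagliardo \<alpha> \<eta> x)))"
  proof -
    have "ennreal (a + b) \<le> ennreal a + ennreal b" if "0 \<le> b" for a b
    proof (cases "0 \<le> a")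
      case False
      then have "ennreal (a + b) \<le> ennreal b" by (intro ennreal_leI) simp
      with False show ?thesis by (simp add: ennreal_neg)
    qed (use that in simp)
    moreover have "0 \<le> ?\<mu> * (LINT x|lborel. f x * enn2real (gagliardo \<alpha> \<eta> x))"
      using \<mu> f by (intro mult_nonneg_nonneg integral_nonneg_AE) auto
    ultimately show ?thesis by blast
  qed
  also have "ennreal (?\<mu> * (LINT x|lborel. f x * enn2real (gagliardo \<alpha> \<eta> x))) = ennreal ?\<mu> * (\<integral>\<^sup>+x. ennreal (f x) * gagliardo \<alpha> \<eta> x \<partial>lborel)"
    unfolding I2(2)[symmetric] using \<mu> by (intro ennreal_mult') simp
  finally show ?thesis .
qed

section \<open>The half-space inequality\<close>

lemma AE_hyperplane:
  fixes v :: "'a::euclidean_space"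
  assumes "v \<noteq> 0"
  shows "AE z in lborel. z \<bullet> v \<noteq> d"
proof -
  have "{z. v \<bullet> z = d} \<in> null_sets lborel"
    using negligible_hyperplane[of v d] assms
    by (simp add: negligible_iff_null_sets null_sets_completion_iff)
  then show ?thesis by (rule AE_not_in[THEN AE_mp]) (simp add: inner_commute)
qed

definition half_space_fn :: "real^'n \<Rightarrow> real^'n \<Rightarrow> real \<Rightarrow> real^'n \<Rightarrow> real" where
  "half_space_fn v x0 r y = (if r < (y - x0) \<bullet> v then 1 else 0)"

lemma borel_measurable_half_space_fn [measurable]: "half_space_fn v x0 r \<in> borel_measurable borel"
  unfolding half_space_fn_def[abs_def] by measurable

text \<open>For x outside the half-space, only the points y across the boundary contribute. For x
  inside, the reflection y = x - z leads to the same integral, since the inner product and the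
  difference both change sign. Hence only the distance to the boundary matters.\<close>

lemma frac_div_half_space:
  fixes v :: "real^'n"
  assumes \<alpha>: "0 < \<alpha>" "\<alpha> < 1" and v: "norm v = 1" and x: "(x - x0) \<bullet> v \<noteq> r"
  shows "ennreal (frac_mu CARD('n) \<alpha>) *
     (\<integral>\<^sup>+y. ennreal (((y - x) \<bullet> v) * (half_space_fn v x0 r y - half_space_fn v x0 r x) / norm (y - x) powr (real CARD('n) + \<alpha> + 1)) \<partial>lborel) =
     ennreal (frac_mu 1 \<alpha> / \<alpha> * (1 / \<bar>(x - x0) \<bullet> v - r\<bar> powr \<alpha>))"
proof -
  define d where "d = r - (x - x0) \<bullet> v"
  let ?\<chi> = "half_space_fn v x0 r"
  let ?k = "\<lambda>z::real^'n. norm z powr (real CARD('n) + \<alpha> + 1)"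
  have d0: "d \<noteq> 0" using x by (simp add: d_def)
  have ad: "\<bar>(x - x0) \<bullet> v - r\<bar> = \<bar>d\<bar>" unfolding d_def by linarith
  have "(\<integral>\<^sup>+y. ennreal (((y - x) \<bullet> v) * (?\<chi> y - ?\<chi> x) / ?k (y - x)) \<partial>lborel) =
     (\<integral>\<^sup>+z. ennreal (if \<bar>d\<bar> \<le> z \<bullet> v then z \<bullet> v / ?k z else 0) \<partial>lborel)"
  proof (cases "d > 0")
    case True
    have "(\<integral>\<^sup>+y. ennreal (((y - x) \<bullet> v) * (?\<chi> y - ?\<chi> x) / ?k (y - x)) \<partial>lborel) =
       (\<integral>\<^sup>+z. ennreal ((z \<bullet> v) * (?\<chi> (x + z) - ?\<chi> x) / ?k z) \<partial>lborel)"
      using nn_integral_lborel_translate[of "\<lambda>y. ennreal (((y - x) \<bullet> v) * (?\<chi> y - ?\<chi> x) / ?k (y - x))" x] by simp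
    also have "\<dots> = (\<integral>\<^sup>+z. ennreal (if \<bar>d\<bar> \<le> z \<bullet> v then z \<bullet> v / ?k z else 0) \<partial>lborel)"
    proof (rule nn_integral_cong_AE)
      \<comment> \<open>The half-space is open but the integration range is closed; they differ on a
        null hyperplane. In the reflected case the two match exactly.\<close>
      have "AE z in lborel. z \<bullet> v \<noteq> d" using v by (intro AE_hyperplane) auto
      then show "AE z in lborel. ennreal ((z \<bullet> v) * (?\<chi> (x + z) - ?\<chi> x) / ?k z) = ennreal (if \<bar>d\<bar> \<le> z \<bullet> v then z \<bullet> v / ?k z else 0)"
      proof eventually_elim
        case (elim z)
        have "?\<chi> x = 0" using True by (simp add: half_space_fn_def d_def)
        moreover have "?\<chi> (x + z) = (if \<bar>d\<bar> \<le> z \<bullet> v then 1 else 0)"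
          using elim True by (auto simp: half_space_fn_def d_def inner_diff_left inner_add_left)
        ultimately show ?case by simp
      qed
    qed
    finally show ?thesis .
  next
    case False
    have "(\<integral>\<^sup>+y. ennreal (((y - x) \<bullet> v) * (?\<chi> y - ?\<chi> x) / ?k (y - x)) \<partial>lborel) =
       (\<integral>\<^sup>+z. ennreal (((- z) \<bullet> v) * (?\<chi> (x - z) - ?\<chi> x) / ?k z) \<partial>lborel)"
      using nn_integral_lborel_reflect[of "\<lambda>y. ennreal (((y - x) \<bullet> v) * (?\<chi> y - ?\<chi> x) / ?k (y - x))" x] by simp
    also have "\<dots> = (\<integral>\<^sup>+z. ennreal (if \<bar>d\<bar> \<le> z \<bullet> v then z \<bullet> v / ?k z else 0) \<partial>lborel)"
    proof (rule nn_integral_cong)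
      fix z :: "real^'n"
      have "?\<chi> x = 1" using False d0 by (simp add: half_space_fn_def d_def)
      moreover have "?\<chi> (x - z) = (if \<bar>d\<bar> \<le> z \<bullet> v then 0 else 1)"
        using False by (auto simp: half_space_fn_def d_def inner_diff_left)
      ultimately show "ennreal (((- z) \<bullet> v) * (?\<chi> (x - z) - ?\<chi> x) / ?k z) = ennreal (if \<bar>d\<bar> \<le> z \<bullet> v then z \<bullet> v / ?k z else 0)"
        by simp
    qed
    finally show ?thesis .
  qed
  then show ?thesis unfolding ad using nn_integral_half_space[OF \<alpha> v, of "\<bar>d\<bar>"] d0 by simp
qed

section \<open>Ramps and cut-offs\<close>

definition ramp :: "real^'n \<Rightarrow> real^'n \<Rightarrow> real \<Rightarrow> nat \<Rightarrow> real^'n \<Rightarrow> real" where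
  "ramp v x0 r k y = min 1 (max 0 (real (Suc k) * ((y - x0) \<bullet> v - r)))"

text \<open>Plateau and transition widen at the same rate, so the Lipschitz constant decays like 1 /
  k while the support has the volume of a ball of radius 2 (k + 1). The successor avoids a zero
  scale.\<close>

definition cutoff :: "nat \<Rightarrow> real^'n \<Rightarrow> real" where
  "cutoff k y = max 0 (min 1 (2 - norm y / real (Suc k)))"

lemma ramp_bounds [simp]: "0 \<le> ramp v x0 r k y" "ramp v x0 r k y \<le> 1"
  by (auto simp: ramp_def)

lemma cutoff_bounds [simp]: "0 \<le> cutoff k y" "cutoff k y \<le> 1"
  by (auto simp: cutoff_def)

lemma borel_measurable_ramp [measurable]: "ramp v x0 r k \<in> borel_measurable borel"
  unfolding ramp_def[abs_def] by measurable

lemma borel_measurable_cutoff [measurable]: "cutoff k \<in> borel_measurable borel"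
  unfolding cutoff_def[abs_def] by measurable

lemma ramp_mono: "0 \<le> ((y - x) \<bullet> v) * (ramp v x0 r k y - ramp v x0 r k x)"
proof -
  have le: "ramp v x0 r k a \<le> ramp v x0 r k b" if "a \<bullet> v \<le> b \<bullet> v" for a b
  proof -
    have "real (Suc k) * ((a - x0) \<bullet> v - r) \<le> real (Suc k) * ((b - x0) \<bullet> v - r)"
      using that by (intro mult_left_mono) (auto simp: inner_diff_left)
    then show ?thesis unfolding ramp_def by linarith
  qed
  show ?thesis
  proof (cases "x \<bullet> v \<le> y \<bullet> v")
    case True
    then show ?thesis using le[OF True] by (intro mult_nonneg_nonneg) (auto simp: inner_diff_left)
  next
    case False
    then show ?thesis using le[of y x] by (intro mult_nonpos_nonpos) (auto simp: inner_diff_left)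
  qed
qed

lemma ramp_lipschitz:
  fixes v :: "real^'n"
  assumes v: "norm v = 1"
  shows "\<bar>ramp v x0 r k y - ramp v x0 r k x\<bar> \<le> real (Suc k) * norm (y - x)"
proof -
  have "\<bar>ramp v x0 r k y - ramp v x0 r k x\<bar> \<le>
      \<bar>real (Suc k) * ((y - x0) \<bullet> v - r) - real (Suc k) * ((x - x0) \<bullet> v - r)\<bar>"
    unfolding ramp_def by linarith
  also have "\<dots> = real (Suc k) * \<bar>(y - x) \<bullet> v\<bar>"
    by (simp only: right_diff_distrib[symmetric] abs_mult) (simp add: inner_diff_left)
  also have "\<dots> \<le> real (Suc k) * norm (y - x)"
    using Cauchy_Schwarz_ineq2[of "y - x" v] v by (intro mult_left_mono) auto
  finally show ?thesis .
qed

lemma cutoff_lipschitz: "\<bar>cutoff k y - cutoff k x\<bar> \<le> 1 / real (Suc k) * norm (y - x)"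
proof -
  have "\<bar>cutoff k y - cutoff k x\<bar> \<le> \<bar>norm y / real (Suc k) - norm x / real (Suc k)\<bar>"
    unfolding cutoff_def by linarith
  also have "\<dots> = \<bar>norm y - norm x\<bar> / real (Suc k)"
    by (simp add: diff_divide_distrib[symmetric])
  also have "\<dots> \<le> norm (y - x) / real (Suc k)"
    by (intro divide_right_mono norm_triangle_ineq3) simp
  finally show ?thesis by simp
qed

lemma cutoff_eq_0: "cutoff k x = 0" if "x \<notin> cball 0 (2 * real (Suc k))"
proof -
  have "2 * real (Suc k) < norm x" using that by simp
  then have "2 \<le> norm x / real (Suc k)" by (simp add: pos_le_divide_eq)
  then show ?thesis unfolding cutoff_def by linarith
qed

text \<open>The ramp starts to rise at the bounding hyperplane itself and vanishes there for every
  k, in accordance with the strict inequality in \<open>half_space_fn\<close>. Beyond the hyperplane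
  the sequence is eventually 1.\<close>

lemma ramp_tendsto: "(\<lambda>k. ramp v x0 r k y) \<longlonglongrightarrow> half_space_fn v x0 r y"
proof (cases "r < (y - x0) \<bullet> v")
  case True
  define s where "s = (y - x0) \<bullet> v - r"
  have s: "s > 0" using True by (simp add: s_def)
  obtain N :: nat where N: "1 / s \<le> real N" using real_arch_simple by blast
  have "ramp v x0 r k y = 1" if "k \<ge> N" for k
  proof -
    have "1 / s \<le> real (Suc k)" using N that by linarith
    then have "1 \<le> real (Suc k) * s" using s by (simp add: pos_divide_le_eq)
    then show ?thesis unfolding ramp_def s_def[symmetric] by linarith
  qed
  then show ?thesis using True
    by (intro tendsto_eventually eventually_sequentiallyI[of N]) (auto simp: half_space_fn_def)
next
  case False
  then have "ramp v x0 r k y = 0" for k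
    unfolding ramp_def using mult_nonneg_nonpos[of "real (Suc k)" "(y - x0) \<bullet> v - r"] by linarith
  then show ?thesis using False by (simp add: half_space_fn_def)
qed

lemma cutoff_tendsto: "(\<lambda>k. cutoff k x) \<longlonglongrightarrow> 1"
proof -
  obtain N :: nat where N: "norm x \<le> real N" using real_arch_simple by blast
  have "cutoff k x = 1" if "k \<ge> N" for k
  proof -
    have "norm x / real (Suc k) \<le> 1" using N that by (simp add: pos_divide_le_eq)
    then show ?thesis unfolding cutoff_def by linarith
  qed
  then show ?thesis by (intro tendsto_eventually eventually_sequentiallyI[of N])
qed

text \<open>The hypothesis \<open>p < n / (n - \<alpha>)\<close> leaves room for a truncation level \<open>k\<^sup>-\<^sup>m\<close> that makes
  both parts of the cut-off error vanish.\<close>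

lemma truncation_exponent:
  assumes "0 < \<alpha>" "\<alpha> < 1" "1 \<le> (n :: real)" "1 \<le> p" "p < n / (n - \<alpha>)"
  shows "\<exists>m > n - \<alpha>. m * (p - 1) < \<alpha>"
proof -
  \<comment> \<open>The slack in the hypothesis on p: (n - \<alpha>) (p - 1) equals \<alpha> -
    \<delta>. Raising the exponent n - \<alpha> by \<delta> / (2 p) adds less than \<delta> to the
    product, also for p = 1.\<close>
  define \<delta> where "\<delta> = \<alpha> - (n - \<alpha>) * (p - 1)"
  have "p * (n - \<alpha>) < n" using assms by (simp add: pos_less_divide_eq)
  then have \<delta>: "\<delta> > 0" by (simp add: \<delta>_def algebra_simps)
  have "(n - \<alpha> + \<delta> / (2 * p)) * (p - 1) = \<alpha> - \<delta> + \<delta> * ((p - 1) / (2 * p))"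
    by (simp add: \<delta>_def algebra_simps)
  moreover have "\<delta> * ((p - 1) / (2 * p)) < \<delta> * 1"
    using \<delta> assms by (intro mult_strict_left_mono) (auto simp: divide_simps)
  ultimately show ?thesis using \<delta> assms by (intro exI[of _ "n - \<alpha> + \<delta> / (2 * p)"]) auto
qed

lemma cutoff_error_tendsto:
  fixes f :: "real^'n \<Rightarrow> real"
  assumes \<alpha>: "0 < \<alpha>" "\<alpha> < 1" and p: "1 \<le> p" "p < real CARD('n) / (real CARD('n) - \<alpha>)"
    and mf [measurable]: "f \<in> borel_measurable borel" and f: "\<And>x. 0 \<le> f x"
    and fp: "(\<integral>\<^sup>+x. ennreal (f x powr p) \<partial>lborel) < \<infinity>"
  shows "(\<lambda>k. \<integral>\<^sup>+x. ennreal (f x) * gagliardo \<alpha> (cutoff k) x \<partial>lborel) \<longlonglongrightarrow> 0"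
proof -
  let ?n = "real CARD('n)"
  have n: "1 \<le> ?n" by (simp add: Suc_leI)
  obtain m where m: "m > ?n - \<alpha>" "m * (p - 1) < \<alpha>"
    using truncation_exponent[OF \<alpha> n p] by blast
  define K where "K = lip_kernel_bound CARD('n) \<alpha>"
  have K: "0 \<le> K" using \<alpha> by (simp add: K_def lip_kernel_bound_def)
  define F where "F = enn2real (\<integral>\<^sup>+x. ennreal (f x powr p) \<partial>lborel)"
  have F: "(\<integral>\<^sup>+x. ennreal (f x powr p) \<partial>lborel) = ennreal F" "0 \<le> F" using fp by (simp_all add: F_def)
  define V where "V = unit_ball_vol ?n * 2 ^ CARD('n)"
  have V: "0 \<le> V" by (simp add: V_def)
  \<comment> \<open>With R = k + 1, the cut-off has Lipschitz constant 1 / R and support in the ball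
    of radius 2 R, and the truncation level is R^(-m). The first exponent is negative because m > n
    - \<alpha>, the second because m (p - 1) < \<alpha>.\<close>
  define e where "e k = K * (2 * V * real (Suc k) powr (?n - \<alpha> - m) + F * real (Suc k) powr (m * (p - 1) - \<alpha>))" for k
  have le: "(\<integral>\<^sup>+x. ennreal (f x) * gagliardo \<alpha> (cutoff k) x \<partial>lborel) \<le> ennreal (e k)" for k
  proof -
    let ?R = "real (Suc k)"
    let ?S = "cball (0::real^'n) (2 * ?R)"
    have R: "?R > 0" by simp
    have S: "emeasure lborel ?S = ennreal (V * ?R powr ?n)"
      by (simp add: emeasure_cball V_def power_mult_distrib powr_realpow[symmetric] del: of_nat_Suc)
    have "(\<integral>\<^sup>+x. ennreal (f x) * gagliardo \<alpha> (cutoff k) x \<partial>lborel) \<le>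
      ennreal (K * (1 / ?R) powr \<alpha>) * (2 * emeasure lborel ?S * ennreal (?R powr (- m)) +
        ennreal ((?R powr (- m)) powr (1 - p)) * (\<integral>\<^sup>+x. ennreal (f x powr p) \<partial>lborel))"
      unfolding K_def
    proof (rule nn_integral_mult_gagliardo_le[OF \<alpha>])
      show "\<bar>cutoff k y - cutoff k x\<bar> \<le> min (1 / ?R * norm (y - x)) 1" for x y :: "real^'n"
        using cutoff_lipschitz[of k y x] cutoff_bounds[of k x] cutoff_bounds[of k y] by linarith
    qed (use cutoff_eq_0 f p in auto)
    also have "\<dots> = ennreal (K * (1 / ?R) powr \<alpha> * (2 * (V * ?R powr ?n) * ?R powr (- m) + (?R powr (- m)) powr (1 - p) * F))"
    proof -
      have "2 * ennreal (V * ?R powr ?n) = ennreal (2 * (V * ?R powr ?n))" by (subst ennreal_mult') auto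
      then show ?thesis unfolding S F using K V F(2)
        by (simp add: ennreal_mult'[symmetric] ennreal_plus[symmetric] del: ennreal_plus of_nat_Suc)
    qed
    also have "K * (1 / ?R) powr \<alpha> * (2 * (V * ?R powr ?n) * ?R powr (- m) + (?R powr (- m)) powr (1 - p) * F) = e k"
    proof -
      have 1: "(1 / ?R) powr \<alpha> = ?R powr (- \<alpha>)" using R by (simp add: powr_divide powr_minus_divide del: of_nat_Suc)
      have 2: "?R powr (- \<alpha>) * ?R powr ?n * ?R powr (- m) = ?R powr (?n - \<alpha> - m)"
        unfolding powr_add[symmetric] by simp
      have 3: "?R powr (- \<alpha>) * (?R powr (- m)) powr (1 - p) = ?R powr (m * (p - 1) - \<alpha>)"
        unfolding powr_powr powr_add[symmetric] by (simp add: algebra_simps)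
      have "K * (1 / ?R) powr \<alpha> * (2 * (V * ?R powr ?n) * ?R powr (- m) + (?R powr (- m)) powr (1 - p) * F) =
        K * (2 * V * (?R powr (- \<alpha>) * ?R powr ?n * ?R powr (- m)) + F * (?R powr (- \<alpha>) * (?R powr (- m)) powr (1 - p)))"
        unfolding 1 by (simp only: algebra_simps)
      then show ?thesis unfolding 2 3 e_def .
    qed
    finally show ?thesis .
  qed
  have "e \<longlonglongrightarrow> K * (2 * V * 0 + F * 0)"
    unfolding e_def using m
    by (intro tendsto_intros tendsto_neg_powr filterlim_compose[OF filterlim_real_sequentially filterlim_Suc]) auto
  then have e0: "(\<lambda>k. ennreal (e k)) \<longlonglongrightarrow> 0" using tendsto_ennrealI[of e 0] by simp
  show ?thesis
    by (rule tendsto_sandwich[OF _ _ tendsto_const e0]) (use le in auto)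
qed

text \<open>The vector measure is visible only through \<open>test\<close>, whose bound
  \<open>T\<close> is the same for all fields living in the half-space. This is why \<open>T\<close>
  survives the limit unchanged.\<close>

lemma half_space_weight_le:
  fixes f :: "real^'n \<Rightarrow> real" and v :: "real^'n" and T :: ennreal
  assumes \<alpha>: "0 < \<alpha>" "\<alpha> < 1" and p: "1 \<le> p" "p < real CARD('n) / (real CARD('n) - \<alpha>)"
    and mf [measurable]: "f \<in> borel_measurable borel" and f: "\<And>x. 0 \<le> f x"
    and fp: "(\<integral>\<^sup>+x. ennreal (f x powr p) \<partial>lborel) < \<infinity>" and v: "norm v = 1"
    and test: "\<And>\<psi> L. L-lipschitz_on UNIV \<psi> \<Longrightarrow> bounded {y. \<psi> y \<noteq> 0} \<Longrightarrow>
      (\<And>y. 0 \<le> \<psi> y \<and> \<psi> y \<le> 1) \<Longrightarrow> (\<And>y. \<psi> y \<noteq> 0 \<Longrightarrow> r < (y - x0) \<bullet> v) \<Longrightarrow>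
      ennreal (LINT x|lborel. f x * frac_div \<alpha> (\<lambda>y. \<psi> y *\<^sub>R v) x) \<le> T"
  shows "(\<integral>\<^sup>+x. ennreal (f x * (frac_mu 1 \<alpha> / \<alpha> * (1 / \<bar>(x - x0) \<bullet> v - r\<bar> powr \<alpha>))) \<partial>lborel) \<le> T"
proof -
  let ?\<mu> = "frac_mu CARD('n) \<alpha>"
  let ?g = "ramp v x0 r"
  let ?\<chi> = "half_space_fn v x0 r"
  let ?k = "\<lambda>z::real^'n. norm z powr (real CARD('n) + \<alpha> + 1)"
  have \<mu>: "?\<mu> > 0" using \<alpha> by (intro frac_mu_pos) auto
  define u where "u k x y = ennreal (f x * cutoff k x * (((y - x) \<bullet> v) * (?g k y - ?g k x) / ?k (y - x)))" for k x y
  define U where "U k = (\<integral>\<^sup>+x. \<integral>\<^sup>+y. u k x y \<partial>lborel \<partial>lborel)" for k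
  define E where "E k = (\<integral>\<^sup>+x. ennreal (f x) * gagliardo \<alpha> (cutoff k) x \<partial>lborel)" for k
  have U_le: "U k \<le> ennreal (1 / ?\<mu>) * (T + ennreal ?\<mu> * E k)" for k
  proof -
    define \<psi> where "\<psi> y = ?g k y * cutoff k y" for y
    have m\<psi> [measurable]: "\<psi> \<in> borel_measurable borel" unfolding \<psi>_def[abs_def] by measurable
    have \<psi>: "0 \<le> \<psi> y" "\<psi> y \<le> 1" for y
      using mult_mono[of "?g k y" 1 "cutoff k y" 1] by (simp_all add: \<psi>_def)
    let ?L = "real (Suc k) + 1 / real (Suc k)"
    have L: "?L > 0" by (simp add: add_pos_pos)
    have lip1: "\<bar>\<psi> y - \<psi> x\<bar> \<le> ?L * norm (y - x)" for x y
    proof -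
      have "\<psi> y - \<psi> x = cutoff k x * (?g k y - ?g k x) + ?g k y * (cutoff k y - cutoff k x)"
        by (simp add: \<psi>_def algebra_simps)
      then have "\<bar>\<psi> y - \<psi> x\<bar> \<le> cutoff k x * \<bar>?g k y - ?g k x\<bar> + ?g k y * \<bar>cutoff k y - cutoff k x\<bar>"
        by (simp only:) (rule order_trans[OF abs_triangle_ineq], simp add: abs_mult)
      also have "\<dots> \<le> 1 * \<bar>?g k y - ?g k x\<bar> + 1 * \<bar>cutoff k y - cutoff k x\<bar>"
        by (intro add_mono mult_right_mono) auto
      also have "\<dots> \<le> real (Suc k) * norm (y - x) + 1 / real (Suc k) * norm (y - x)"
        unfolding mult_1 by (intro add_mono ramp_lipschitz[OF v] cutoff_lipschitz)
      finally show ?thesis by (simp only: distrib_right)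
    qed
    have lip\<psi>: "\<bar>\<psi> y - \<psi> x\<bar> \<le> min (?L * norm (y - x)) 1" for x y
      using lip1[of y x] \<psi>[of x] \<psi>[of y] by linarith
    have lip\<eta>: "\<bar>cutoff k y - cutoff k x\<bar> \<le> min (1 / real (Suc k) * norm (y - x)) 1" for x y :: "real^'n"
      using cutoff_lipschitz[of k y x] cutoff_bounds[of k x] cutoff_bounds[of k y] by linarith
    let ?S = "cball (0::real^'n) (2 * real (Suc k))"
    have S\<psi>: "\<psi> x = 0" if "x \<notin> ?S" for x using cutoff_eq_0[OF that] by (simp add: \<psi>_def)
    have fS: "emeasure lborel ?S < \<infinity>" by (rule emeasure_bounded_finite[OF bounded_cball])
    have fin: "(\<integral>\<^sup>+x. ennreal (f x) * gagliardo \<alpha> \<zeta> x \<partial>lborel) < \<infinity>"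
      if "0 < L'" "\<And>x y. \<bar>\<zeta> y - \<zeta> x\<bar> \<le> min (L' * norm (y - x)) 1" "\<zeta> \<in> borel_measurable borel" "\<And>x. x \<notin> ?S \<Longrightarrow> \<zeta> x = 0"
      for L' and \<zeta> :: "real^'n \<Rightarrow> real"
    proof -
      \<comment> \<open>For finiteness alone the truncation level 1 is enough.\<close>
      have "(\<integral>\<^sup>+x. ennreal (f x) * gagliardo \<alpha> \<zeta> x \<partial>lborel) \<le>
        ennreal (lip_kernel_bound CARD('n) \<alpha> * L' powr \<alpha>) * (2 * emeasure lborel ?S * ennreal 1 + ennreal (1 powr (1 - p)) * (\<integral>\<^sup>+x. ennreal (f x powr p) \<partial>lborel))"
        by (rule nn_integral_mult_gagliardo_le[OF \<alpha> that(1,2,3)]) (use that(4) f p in auto)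
      also have "\<dots> < \<infinity>" using fS fp by (simp add: ennreal_mult_less_top)
      finally show ?thesis .
    qed
    have gfin: "gagliardo \<alpha> \<zeta> x < \<infinity>"
      if "0 < L'" "\<And>x y. \<bar>\<zeta> y - \<zeta> x\<bar> \<le> min (L' * norm (y - x)) 1" for L' x and \<zeta> :: "real^'n \<Rightarrow> real"
      using gagliardo_le[OF \<alpha> that] by (rule le_less_trans) simp
    have "ennreal ?\<mu> * U k \<le> ennreal (LINT x|lborel. f x * frac_div \<alpha> (\<lambda>y. (?g k y * cutoff k y) *\<^sub>R v) x) + ennreal ?\<mu> * E k"
      unfolding U_def u_def E_def
    proof (rule nn_integral_frac_div_product_ge[OF \<alpha> _ _ mf v])
      show "gagliardo \<alpha> (\<lambda>y. ?g k y * cutoff k y) x < \<infinity>" for x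
        using gfin[OF L lip\<psi>] unfolding \<psi>_def .
      show "(\<integral>\<^sup>+x. ennreal (f x) * gagliardo \<alpha> (\<lambda>y. ?g k y * cutoff k y) x \<partial>lborel) < \<infinity>"
        using fin[OF L lip\<psi> m\<psi> S\<psi>] unfolding \<psi>_def .
      show "gagliardo \<alpha> (cutoff k) x < \<infinity>" for x :: "real^'n"
        by (rule gfin[OF _ lip\<eta>]) simp
      show "(\<integral>\<^sup>+x. ennreal (f x) * gagliardo \<alpha> (cutoff k) x \<partial>lborel) < \<infinity>"
        by (rule fin[OF _ lip\<eta>]) (use cutoff_eq_0 in auto)
    qed (use f ramp_mono in auto)
    also have "ennreal (LINT x|lborel. f x * frac_div \<alpha> (\<lambda>y. (?g k y * cutoff k y) *\<^sub>R v) x) \<le> T"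
    proof (rule test)
      show "?L-lipschitz_on UNIV (\<lambda>y. ?g k y * cutoff k y)"
        using lip1 L unfolding \<psi>_def by (intro lipschitz_onI) (auto simp: dist_norm norm_minus_commute)
      have "{y. ?g k y * cutoff k y \<noteq> 0} \<subseteq> ?S" using S\<psi> unfolding \<psi>_def by blast
      then show "bounded {y. ?g k y * cutoff k y \<noteq> 0}" by (rule bounded_subset[OF bounded_cball])
      show "0 \<le> ?g k y * cutoff k y \<and> ?g k y * cutoff k y \<le> 1" for y
        using \<psi>[of y] unfolding \<psi>_def by blast
      show "r < (y - x0) \<bullet> v" if "?g k y * cutoff k y \<noteq> 0" for y
      proof (rule ccontr)
        assume "\<not> r < (y - x0) \<bullet> v"
        then have "?g k y = 0" unfolding ramp_def
          using mult_nonneg_nonpos[of "real (Suc k)" "(y - x0) \<bullet> v - r"] by linarith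
        with that show False by simp
      qed
    qed
    finally have "ennreal ?\<mu> * U k \<le> T + ennreal ?\<mu> * E k" by (simp add: add_right_mono)
    then have "ennreal (1 / ?\<mu>) * (ennreal ?\<mu> * U k) \<le> ennreal (1 / ?\<mu>) * (T + ennreal ?\<mu> * E k)"
      by (rule mult_left_mono) simp
    moreover have "ennreal (1 / ?\<mu>) * (ennreal ?\<mu> * U k) = U k"
      using \<mu> by (simp add: mult.assoc[symmetric] ennreal_mult'[symmetric])
    ultimately show ?thesis by simp
  qed
  have lim_u: "(\<lambda>k. u k x y) \<longlonglongrightarrow> ennreal (f x * 1 * (((y - x) \<bullet> v) * (?\<chi> y - ?\<chi> x) / ?k (y - x)))" for x y
  proof -
    have "(\<lambda>k. f x * cutoff k x * (((y - x) \<bullet> v) * (?g k y - ?g k x) * inverse (?k (y - x)))) \<longlonglongrightarrow>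
       f x * 1 * (((y - x) \<bullet> v) * (?\<chi> y - ?\<chi> x) * inverse (?k (y - x)))"
      by (intro tendsto_mult tendsto_diff tendsto_const cutoff_tendsto ramp_tendsto)
    then show ?thesis unfolding u_def divide_inverse by (rule tendsto_ennrealI)
  qed
  have [measurable]: "(\<lambda>(x, y). u k x y) \<in> borel_measurable (borel \<Otimes>\<^sub>M borel)" for k
    unfolding u_def by measurable
  \<comment> \<open>Fatou's lemma is applied in y for fixed x and then in x. On the right the limit
    inferior is a limit, and the cut-off error drops out.\<close>
  have "(\<integral>\<^sup>+x. \<integral>\<^sup>+y. ennreal (f x * 1 * (((y - x) \<bullet> v) * (?\<chi> y - ?\<chi> x) / ?k (y - x))) \<partial>lborel \<partial>lborel)
     = (\<integral>\<^sup>+x. \<integral>\<^sup>+y. liminf (\<lambda>k. u k x y) \<partial>lborel \<partial>lborel)"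
    by (intro nn_integral_cong lim_imp_Liminf[symmetric] lim_u) auto
  also have "\<dots> \<le> (\<integral>\<^sup>+x. liminf (\<lambda>k. \<integral>\<^sup>+y. u k x y \<partial>lborel) \<partial>lborel)"
    by (intro nn_integral_mono nn_integral_liminf) measurable
  also have "\<dots> \<le> liminf U"
    unfolding U_def by (rule nn_integral_liminf) measurable
  also have "\<dots> \<le> liminf (\<lambda>k. ennreal (1 / ?\<mu>) * (T + ennreal ?\<mu> * E k))"
    by (rule Liminf_mono) (use U_le in auto)
  also have "\<dots> = ennreal (1 / ?\<mu>) * (T + ennreal ?\<mu> * 0)"
    unfolding E_def
    by (intro lim_imp_Liminf ennreal_tendsto_cmult tendsto_add tendsto_const cutoff_error_tendsto[OF \<alpha> p mf f fp]) auto
  finally have *: "(\<integral>\<^sup>+x. \<integral>\<^sup>+y. ennreal (f x * (((y - x) \<bullet> v) * (?\<chi> y - ?\<chi> x) / ?k (y - x))) \<partial>lborel \<partial>lborel) \<le> ennreal (1 / ?\<mu>) * T"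
    by simp
  have "(\<integral>\<^sup>+x. ennreal (f x * (frac_mu 1 \<alpha> / \<alpha> * (1 / \<bar>(x - x0) \<bullet> v - r\<bar> powr \<alpha>))) \<partial>lborel) =
     (\<integral>\<^sup>+x. ennreal ?\<mu> * (\<integral>\<^sup>+y. ennreal (f x * (((y - x) \<bullet> v) * (?\<chi> y - ?\<chi> x) / ?k (y - x))) \<partial>lborel) \<partial>lborel)"
  proof (rule nn_integral_cong_AE)
    \<comment> \<open>On the bounding hyperplane the profile is 1 / 0 = 0 by convention and the
      half-space formula does not apply; that set is null.\<close>
    have "AE x in lborel. x \<bullet> v \<noteq> r + x0 \<bullet> v" using v by (intro AE_hyperplane) auto
    then show "AE x in lborel. ennreal (f x * (frac_mu 1 \<alpha> / \<alpha> * (1 / \<bar>(x - x0) \<bullet> v - r\<bar> powr \<alpha>))) =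
      ennreal ?\<mu> * (\<integral>\<^sup>+y. ennreal (f x * (((y - x) \<bullet> v) * (?\<chi> y - ?\<chi> x) / ?k (y - x))) \<partial>lborel)"
    proof eventually_elim
      case (elim x)
      then have x: "(x - x0) \<bullet> v \<noteq> r" by (simp add: inner_diff_left)
      have "(\<integral>\<^sup>+y. ennreal (f x * (((y - x) \<bullet> v) * (?\<chi> y - ?\<chi> x) / ?k (y - x))) \<partial>lborel) =
         (\<integral>\<^sup>+y. ennreal (f x) * ennreal (((y - x) \<bullet> v) * (?\<chi> y - ?\<chi> x) / ?k (y - x)) \<partial>lborel)"
        by (rule nn_integral_cong) (rule ennreal_mult'[OF f])
      also have "\<dots> = ennreal (f x) * (\<integral>\<^sup>+y. ennreal (((y - x) \<bullet> v) * (?\<chi> y - ?\<chi> x) / ?k (y - x)) \<partial>lborel)"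
        by (rule nn_integral_cmult) measurable
      finally show ?case
        by (simp only: ennreal_mult'[OF f] frac_div_half_space[OF \<alpha> v x, symmetric] mult.left_commute)
    qed
  qed
  also have "\<dots> = ennreal ?\<mu> * (\<integral>\<^sup>+x. \<integral>\<^sup>+y. ennreal (f x * (((y - x) \<bullet> v) * (?\<chi> y - ?\<chi> x) / ?k (y - x))) \<partial>lborel \<partial>lborel)"
    by (rule nn_integral_cmult) measurable
  also have "\<dots> \<le> ennreal ?\<mu> * (ennreal (1 / ?\<mu>) * T)"
    by (rule mult_left_mono[OF *]) simp
  also have "\<dots> = T" using \<mu> by (simp add: mult.assoc[symmetric] ennreal_mult'[symmetric])
  finally show ?thesis .
qed

section \<open>Averaging over directions\<close>

text \<open>Directions are sampled by normalizing the points of the unit ball, which avoids a surface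
  measure on the sphere.\<close>

lemma weight_eq_ball_average:
  fixes z :: "real^'n"
  assumes \<alpha>: "0 < \<alpha>" "\<alpha> < 1" and n: "CARD('n) \<ge> 2" and z: "z \<noteq> 0"
  shows "(\<integral>\<^sup>+w\<in>cball 0 1. ennreal (frac_mu 1 \<alpha> / \<alpha> * (1 / \<bar>z \<bullet> (w /\<^sub>R norm w) - r\<bar> powr \<alpha>)) \<partial>lborel) =
    ennreal (unit_ball_vol (real CARD('n))) * weight CARD('n) \<alpha> (norm z) r"
proof -
  let ?n = "CARD('n)"
  let ?t = "norm z"
  let ?c = "(real ?n - 1) * unit_ball_vol (real ?n - 1)"
  let ?m = "frac_mu 1 \<alpha> / \<alpha>"
  have c: "?c \<ge> 0" using n by simp
  have m: "?m > 0" using frac_mu_pos[of \<alpha> 1] \<alpha> by simp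
  define u where "u = z /\<^sub>R norm z"
  have u: "norm u = 1" using z by (simp add: u_def)
  define h where "h s = 1 / \<bar>s * ?t - r\<bar> powr \<alpha>" for s
  have [measurable]: "h \<in> borel_measurable borel" unfolding h_def[abs_def] by measurable
  have h0: "0 \<le> h s" for s by (simp add: h_def)
  \<comment> \<open>Inside the unit ball the integrand depends only on a / R, the cosine of the
    angle. The radial integral is therefore that of R^(n - 1) over [0, 1], the source of the factor
    1 / n in the weight.\<close>
  define H where "H a R = ?m * h (a / R) * indicator {..1} R" for a R :: real
  have H0: "0 \<le> H a R" for a R unfolding H_def using m h0 by (intro mult_nonneg_nonneg) auto
  have [measurable]: "case_prod H \<in> borel_measurable (borel \<Otimes>\<^sub>M borel)" unfolding H_def by measurable
  have inner: "(\<integral>\<^sup>+R\<in>{0<..}. ennreal (R ^ (?n - 1) * H (R * s) R) \<partial>lborel) = ennreal (?m * h s / real ?n)" for s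
  proof -
    have "(\<integral>\<^sup>+R\<in>{0<..}. ennreal (R ^ (?n - 1) * H (R * s) R) \<partial>lborel) =
       (\<integral>\<^sup>+R. ennreal (?m * h s * R ^ (?n - 1)) * indicator {0..1} R \<partial>lborel)"
    proof (rule nn_integral_cong_AE)
      have "AE R in lborel. R \<noteq> (0::real)" by (rule AE_lborel_singleton)
      then show "AE R in lborel. ennreal (R ^ (?n - 1) * H (R * s) R) * indicator {0<..} R = ennreal (?m * h s * R ^ (?n - 1)) * indicator {0..1} R"
        by eventually_elim (auto simp: H_def indicator_def mult_ac)
    qed
    also have "\<dots> = ennreal (?m * h s * 1 ^ ?n / real ?n - ?m * h s * 0 ^ ?n / real ?n)"
    proof (rule nn_integral_FTC_Icc)
      show "0 \<le> ?m * h s * R ^ (?n - 1)" if "R \<in> {0..1}" for R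
        using m h0[of s] that by (intro mult_nonneg_nonneg zero_le_power) auto
      show "DERIV (\<lambda>R. ?m * h s * R ^ ?n / real ?n) R :> ?m * h s * R ^ (?n - 1)" for R
        using \<alpha>(1) by (auto intro!: derivative_eq_intros)
    qed auto
    finally show ?thesis using n by (simp add: zero_power)
  qed
  have "(\<integral>\<^sup>+w\<in>cball 0 1. ennreal (?m * (1 / \<bar>z \<bullet> (w /\<^sub>R norm w) - r\<bar> powr \<alpha>)) \<partial>lborel) = (\<integral>\<^sup>+w. ennreal (H (w \<bullet> u) (norm w)) \<partial>lborel)"
  proof (rule nn_integral_cong)
    fix w :: "real^'n"
    have "w \<bullet> u / norm w * ?t = z \<bullet> (w /\<^sub>R norm w)"
      using z by (simp add: u_def inner_commute field_simps)
    then have "h (w \<bullet> u / norm w) = 1 / \<bar>z \<bullet> (w /\<^sub>R norm w) - r\<bar> powr \<alpha>" by (simp only: h_def)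
    then show "ennreal (?m * (1 / \<bar>z \<bullet> (w /\<^sub>R norm w) - r\<bar> powr \<alpha>)) * indicator (cball 0 1) w = ennreal (H (w \<bullet> u) (norm w))"
      unfolding H_def by (auto simp: indicator_def)
  qed
  also have "\<dots> = (\<integral>\<^sup>+s\<in>{-1<..<1}. ennreal (?c * (1 - s\<^sup>2) powr ((real ?n - 3) / 2)) * ennreal (?m * h s / real ?n) \<partial>lborel)"
    unfolding inner[symmetric] by (rule nn_integral_lborel_polar[OF _ H0 u n]) measurable
  also have "\<dots> = (\<integral>\<^sup>+s. ennreal (?c * ?m / real ?n) * (ennreal ((1 - s\<^sup>2) powr ((real ?n - 3) / 2) / \<bar>s * ?t - r\<bar> powr \<alpha>) * indicator {-1..1} s) \<partial>lborel)"
  proof (rule nn_integral_cong_AE)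
    have "AE s in lborel. s \<noteq> -1 \<and> s \<noteq> (1::real)" by (intro AE_conjI AE_lborel_singleton)
    then show "AE s in lborel. ennreal (?c * (1 - s\<^sup>2) powr ((real ?n - 3) / 2)) * ennreal (?m * h s / real ?n) * indicator {-1<..<1} s =
      ennreal (?c * ?m / real ?n) * (ennreal ((1 - s\<^sup>2) powr ((real ?n - 3) / 2) / \<bar>s * ?t - r\<bar> powr \<alpha>) * indicator {-1..1} s)"
    proof eventually_elim
      case (elim s)
      have i: "indicator {-1<..<1} s = (indicator {-1..1} s :: ennreal)" using elim by (auto simp: indicator_def)
      have "ennreal (?c * (1 - s\<^sup>2) powr ((real ?n - 3) / 2)) * ennreal (?m * h s / real ?n) =
         ennreal (?c * (1 - s\<^sup>2) powr ((real ?n - 3) / 2) * (?m * h s / real ?n))"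
        using c by (intro ennreal_mult'[symmetric]) simp
      also have "?c * (1 - s\<^sup>2) powr ((real ?n - 3) / 2) * (?m * h s / real ?n) =
         ?c * ?m / real ?n * ((1 - s\<^sup>2) powr ((real ?n - 3) / 2) / \<bar>s * ?t - r\<bar> powr \<alpha>)"
        by (simp add: h_def mult_ac)
      also have "ennreal \<dots> = ennreal (?c * ?m / real ?n) * ennreal ((1 - s\<^sup>2) powr ((real ?n - 3) / 2) / \<bar>s * ?t - r\<bar> powr \<alpha>)"
        using divide_nonneg_nonneg[OF mult_nonneg_nonneg[OF c less_imp_le[OF m]] of_nat_0_le_iff]
        by (rule ennreal_mult')
      finally show ?case unfolding i by (simp only: mult.assoc)
    qed
  qed
  also have "\<dots> = ennreal (?c * ?m / real ?n) * (\<integral>\<^sup>+s\<in>{-1..1}. ennreal ((1 - s\<^sup>2) powr ((real ?n - 3) / 2) / \<bar>s * ?t - r\<bar> powr \<alpha>) \<partial>lborel)"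
    by (rule nn_integral_cmult) measurable
  \<comment> \<open>The ball volume taken out here is the total mass of the sampled directions;
    dividing by it normalizes the average.\<close>
  also have "?c * ?m / real ?n = unit_ball_vol (real ?n) * (?c / (real ?n * unit_ball_vol (real ?n)) * ?m)"
  proof -
    have "unit_ball_vol (real ?n) \<noteq> 0" by (metis less_irrefl of_nat_0_le_iff unit_ball_vol_pos)
    then show ?thesis by (simp add: mult_ac)
  qed
  also have "ennreal \<dots> = ennreal (unit_ball_vol (real ?n)) * ennreal (?c / (real ?n * unit_ball_vol (real ?n)) * ?m)"
    by (rule ennreal_mult') simp
  finally show ?thesis using n by (simp add: weight_def mult.assoc)
qed

text \<open>One of the directions v and -v gives the value |z| and the other -|z|, so the pair
  produces both terms of the weight, whichever is which.\<close>

lemma weight_one_dim: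
  fixes z v :: "real^'n"
  assumes \<alpha>: "0 < \<alpha>" "\<alpha> < 1" and n: "CARD('n) = 1" and v: "norm v = 1"
  shows "2 * weight CARD('n) \<alpha> (norm z) r =
    ennreal (frac_mu 1 \<alpha> / \<alpha> * (1 / \<bar>z \<bullet> v - r\<bar> powr \<alpha>)) + ennreal (frac_mu 1 \<alpha> / \<alpha> * (1 / \<bar>z \<bullet> (- v) - r\<bar> powr \<alpha>))"
proof -
  have m: "frac_mu 1 \<alpha> / \<alpha> > 0" using frac_mu_pos[of \<alpha> 1] \<alpha> by simp
  let ?W = "\<lambda>a. 1 / \<bar>a - r\<bar> powr \<alpha>"
  have eq: "\<bar>norm z + r\<bar> = \<bar>- norm z - r\<bar>" by linarith
  have "norm z = \<bar>z \<bullet> v\<bar>" by (rule inner_one_dim(1)[OF n v])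
  then have "z \<bullet> v = norm z \<or> z \<bullet> v = - norm z" by linarith
  then have "?W (norm z) + 1 / \<bar>norm z + r\<bar> powr \<alpha> = ?W (z \<bullet> v) + ?W (z \<bullet> (- v))"
    unfolding eq by auto
  then have "2 * (frac_mu 1 \<alpha> / (2 * \<alpha>) * (?W (norm z) + 1 / \<bar>norm z + r\<bar> powr \<alpha>)) = frac_mu 1 \<alpha> / \<alpha> * ?W (z \<bullet> v) + frac_mu 1 \<alpha> / \<alpha> * ?W (z \<bullet> (- v))"
    by (simp add: distrib_left)
  moreover have "2 * weight CARD('n) \<alpha> (norm z) r = ennreal (2 * (frac_mu 1 \<alpha> / (2 * \<alpha>) * (?W (norm z) + 1 / \<bar>norm z + r\<bar> powr \<alpha>)))"
    unfolding weight_def n by (subst ennreal_mult') simp_all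
  ultimately have "2 * weight CARD('n) \<alpha> (norm z) r = ennreal (frac_mu 1 \<alpha> / \<alpha> * ?W (z \<bullet> v) + frac_mu 1 \<alpha> / \<alpha> * ?W (z \<bullet> (- v)))"
    by (simp only:)
  also have "\<dots> = ennreal (frac_mu 1 \<alpha> / \<alpha> * ?W (z \<bullet> v)) + ennreal (frac_mu 1 \<alpha> / \<alpha> * ?W (z \<bullet> (- v)))"
    using m by (intro ennreal_plus mult_nonneg_nonneg) auto
  finally show ?thesis .
qed

text \<open>The half-space bound \<open>T\<close> does not depend on v. By Tonelli the average over
  directions moves outside the integral in x, and an average of quantities at most \<open>T\<close>
  is at most \<open>T\<close>.\<close>

lemma nn_integral_weight_le:
  fixes f :: "real^'n \<Rightarrow> real" and T :: ennreal
  assumes \<alpha>: "0 < \<alpha>" "\<alpha> < 1" and mf [measurable]: "f \<in> borel_measurable borel" and f: "\<And>x. 0 \<le> f x"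
    and half: "\<And>v. norm v = 1 \<Longrightarrow> (\<integral>\<^sup>+x. ennreal (f x * (frac_mu 1 \<alpha> / \<alpha> * (1 / \<bar>(x - x0) \<bullet> v - r\<bar> powr \<alpha>))) \<partial>lborel) \<le> T"
  shows "(\<integral>\<^sup>+x. ennreal (f x) * weight CARD('n) \<alpha> (norm (x - x0)) r \<partial>lborel) \<le> T"
proof (cases "CARD('n) = 1")
  case True
  let ?W = "\<lambda>v x. frac_mu 1 \<alpha> / \<alpha> * (1 / \<bar>(x - x0) \<bullet> v - r\<bar> powr \<alpha>)"
  obtain v :: "real^'n" where v: "norm v = 1" using vector_choose_size[of 1] by auto
  have "2 * (\<integral>\<^sup>+x. ennreal (f x) * weight CARD('n) \<alpha> (norm (x - x0)) r \<partial>lborel) \<le> 2 * T"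
  proof -
    have [measurable]: "(\<lambda>x. ennreal (f x) * weight CARD('n) \<alpha> (norm (x - x0)) r) \<in> borel_measurable borel"
      unfolding weight_def True by simp
    have "2 * (\<integral>\<^sup>+x. ennreal (f x) * weight CARD('n) \<alpha> (norm (x - x0)) r \<partial>lborel) =
       (\<integral>\<^sup>+x. 2 * (ennreal (f x) * weight CARD('n) \<alpha> (norm (x - x0)) r) \<partial>lborel)"
      by (rule nn_integral_cmult[symmetric]) measurable
    also have "\<dots> = (\<integral>\<^sup>+x. ennreal (f x * ?W v x) + ennreal (f x * ?W (- v) x) \<partial>lborel)"
    proof (rule nn_integral_cong)
      fix x
      have "2 * (ennreal (f x) * weight CARD('n) \<alpha> (norm (x - x0)) r) = ennreal (f x) * (2 * weight CARD('n) \<alpha> (norm (x - x0)) r)"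
        by (rule mult.left_commute)
      then show "2 * (ennreal (f x) * weight CARD('n) \<alpha> (norm (x - x0)) r) = ennreal (f x * ?W v x) + ennreal (f x * ?W (- v) x)"
        unfolding weight_one_dim[OF \<alpha> True v] ennreal_mult'[OF f] by (simp only: distrib_left)
    qed
    also have "\<dots> = (\<integral>\<^sup>+x. ennreal (f x * ?W v x) \<partial>lborel) + (\<integral>\<^sup>+x. ennreal (f x * ?W (- v) x) \<partial>lborel)"
      by (rule nn_integral_add) measurable
    also have "\<dots> \<le> T + T" using v by (intro add_mono half) simp_all
    finally show ?thesis by (simp only: mult_2)
  qed
  then show ?thesis by (subst (asm) ennreal_mult_le_mult_iff) auto
next
  case False
  let ?n = "CARD('n)"
  have n: "?n \<ge> 2" using False by (metis One_nat_def Suc_leI le_neq_implies_less numeral_2_eq_2 zero_less_card_finite)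
  let ?\<omega> = "ennreal (unit_ball_vol (real ?n))"
  let ?W = "\<lambda>v x. frac_mu 1 \<alpha> / \<alpha> * (1 / \<bar>(x - x0) \<bullet> v - r\<bar> powr \<alpha>)"
  have [measurable]: "(\<lambda>x. weight ?n \<alpha> (norm (x - x0)) r) \<in> borel_measurable borel"
    unfolding weight_def using False by simp
  have [measurable]: "cball (0::real^'n) 1 \<in> sets borel" by simp
  have "?\<omega> * (\<integral>\<^sup>+x. ennreal (f x) * weight ?n \<alpha> (norm (x - x0)) r \<partial>lborel) =
     (\<integral>\<^sup>+x. ?\<omega> * (ennreal (f x) * weight ?n \<alpha> (norm (x - x0)) r) \<partial>lborel)"
    by (rule nn_integral_cmult[symmetric]) measurable
  also have "\<dots> = (\<integral>\<^sup>+x. \<integral>\<^sup>+w. ennreal (f x * ?W (w /\<^sub>R norm w) x) * indicator (cball 0 1) w \<partial>lborel \<partial>lborel)"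
  proof (rule nn_integral_cong_AE)
    \<comment> \<open>At x = x0 there is no axis for the polar coordinates. The point w = 0, which
      has no direction, is discarded in the same way below.\<close>
    have "AE x in lborel. x \<noteq> x0" by (rule AE_lborel_singleton)
    then show "AE x in lborel. ?\<omega> * (ennreal (f x) * weight ?n \<alpha> (norm (x - x0)) r) =
       (\<integral>\<^sup>+w. ennreal (f x * ?W (w /\<^sub>R norm w) x) * indicator (cball 0 1) w \<partial>lborel)"
    proof eventually_elim
      case (elim x)
      then have "x - x0 \<noteq> 0" by simp
      note avg = weight_eq_ball_average[OF \<alpha> n this, of r]
      have "(\<integral>\<^sup>+w. ennreal (f x * ?W (w /\<^sub>R norm w) x) * indicator (cball 0 1) w \<partial>lborel) =
        (\<integral>\<^sup>+w. ennreal (f x) * (ennreal (?W (w /\<^sub>R norm w) x) * indicator (cball 0 1) w) \<partial>lborel)"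
        by (simp only: ennreal_mult'[OF f] mult.assoc)
      also have "\<dots> = ennreal (f x) * (\<integral>\<^sup>+w. ennreal (?W (w /\<^sub>R norm w) x) * indicator (cball 0 1) w \<partial>lborel)"
        by (rule nn_integral_cmult) measurable
      finally show ?case unfolding avg by (simp only: mult.left_commute)
    qed
  qed
  also have "\<dots> = (\<integral>\<^sup>+w. \<integral>\<^sup>+x. ennreal (f x * ?W (w /\<^sub>R norm w) x) * indicator (cball 0 1) w \<partial>lborel \<partial>lborel)"
    by (rule lborel_pair.Fubini') measurable
  also have "\<dots> \<le> (\<integral>\<^sup>+w. T * indicator (cball (0::real^'n) 1) w \<partial>lborel)"
  proof (rule nn_integral_mono_AE)
    have "AE w in lborel. w \<noteq> (0::real^'n)" by (rule AE_lborel_singleton)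
    then show "AE w in lborel. (\<integral>\<^sup>+x. ennreal (f x * ?W (w /\<^sub>R norm w) x) * indicator (cball 0 1) w \<partial>lborel) \<le> T * indicator (cball 0 1) w"
    proof eventually_elim
      case (elim w)
      have "(\<integral>\<^sup>+x. ennreal (f x * ?W (w /\<^sub>R norm w) x) * indicator (cball 0 1) w \<partial>lborel) =
         (\<integral>\<^sup>+x. ennreal (f x * ?W (w /\<^sub>R norm w) x) \<partial>lborel) * indicator (cball 0 1) w"
        by (rule nn_integral_multc) measurable
      also have "\<dots> \<le> T * indicator (cball 0 1) w"
        using elim by (intro mult_right_mono half) auto
      finally show ?case .
    qed
  qed
  also have "\<dots> = T * emeasure lborel (cball (0::real^'n) 1)"
    by (simp add: nn_integral_cmult)
  also have "\<dots> = ?\<omega> * T" by (simp add: emeasure_cball mult.commute)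
  finally have *: "?\<omega> * (\<integral>\<^sup>+x. ennreal (f x) * weight ?n \<alpha> (norm (x - x0)) r \<partial>lborel) \<le> ?\<omega> * T" .
  have "?\<omega> \<noteq> 0" "?\<omega> \<noteq> \<infinity>" using unit_ball_vol_pos[of "real ?n"] by (simp_all add: ennreal_eq_0_iff not_le)
  then show ?thesis using * by (subst (asm) ennreal_mult_le_mult_iff) auto
qed

section \<open>Passage to a Borel representative and to the measure D\<close>

theorem corollary1p10:
  fixes f :: "real^'n \<Rightarrow> real" and D :: "(real^'n) set \<Rightarrow> real^'n" and \<alpha> p :: real
  assumes "0 < \<alpha>" "\<alpha> < 1"
    and "1 \<le> p" "p < real CARD('n) / (real CARD('n) - \<alpha>)"
    and "f \<in> BV_plus \<alpha> p"
    and "has_frac_variation_measure \<alpha> f D"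
  shows "\<forall>x0 r. r > 0 \<longrightarrow>
    (\<integral>\<^sup>+x. ennreal (f x) * weight CARD('n) \<alpha> (norm (x - x0)) r \<partial>lebesgue)
      \<le> total_variation D (UNIV - ball x0 r)"
proof (intro allI impI)
  fix x0 :: "real^'n" and r :: real assume r: "r > 0"
  note \<alpha> = assms(1,2)
  let ?K = "UNIV - ball x0 r"
  have D: "finite_vector_measure D"
    and eq: "\<And>\<phi>. \<phi> \<in> Lip_c \<Longrightarrow> (LINT x|lebesgue. f x * frac_div \<alpha> \<phi> x) = - vector_integral \<phi> D"
    using assms(6) by (auto simp: has_frac_variation_measure_def)
  have mf: "f \<in> borel_measurable lebesgue" and fp: "integrable lebesgue (\<lambda>x. \<bar>f x\<bar> powr p)" and f0: "AE x in lebesgue. 0 \<le> f x"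
    using assms(5) by (auto simp: BV_plus_def BV_def L_p_def)
  \<comment> \<open>f is only Lebesgue measurable and nonnegative almost everywhere, while the
    lemmas exchange integrals over \<open>lborel\<close> and ask for a Borel function that is
    nonnegative everywhere. The positive part of a Borel representative supplies one without
    changing any integral.\<close>
  obtain f' where f' [measurable]: "f' \<in> borel_measurable lborel" and ff': "AE x in lborel. f x = f' x"
    using completion_ex_borel_measurable_real[OF mf] by blast
  define h where "h x = max 0 (f' x)" for x
  have mh [measurable]: "h \<in> borel_measurable borel" unfolding h_def[abs_def] by measurable
  have h: "0 \<le> h x" for x by (simp add: h_def)
  have fh: "AE x in lebesgue. f x = h x"
    using f0 AE_completion[OF ff'] by eventually_elim (simp add: h_def)
  have hp: "(\<integral>\<^sup>+x. ennreal (h x powr p) \<partial>lborel) < \<infinity>"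
  proof -
    have "(\<integral>\<^sup>+x. ennreal (h x powr p) \<partial>lborel) = (\<integral>\<^sup>+x. ennreal (h x powr p) \<partial>lebesgue)"
      by (rule nn_integral_completion[symmetric])
    also have "\<dots> = (\<integral>\<^sup>+x. ennreal (norm (\<bar>f x\<bar> powr p)) \<partial>lebesgue)"
    proof (rule nn_integral_cong_AE)
      show "AE x in lebesgue. ennreal (h x powr p) = ennreal (norm (\<bar>f x\<bar> powr p))"
        using fh by eventually_elim (simp add: h)
    qed
    also have "\<dots> < \<infinity>" using fp by (simp add: integrable_iff_bounded)
    finally show ?thesis .
  qed
  have half: "(\<integral>\<^sup>+x. ennreal (h x * (frac_mu 1 \<alpha> / \<alpha> * (1 / \<bar>(x - x0) \<bullet> v - r\<bar> powr \<alpha>))) \<partial>lborel) \<le> total_variation D ?K"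
    if v: "norm v = 1" for v
  proof (rule half_space_weight_le[OF \<alpha> assms(3,4) mh h hp v])
    fix \<psi> :: "real^'n \<Rightarrow> real" and L
    assume lip: "L-lipschitz_on UNIV \<psi>" and bd: "bounded {y. \<psi> y \<noteq> 0}"
      and \<psi>: "\<And>y. 0 \<le> \<psi> y \<and> \<psi> y \<le> 1" and supp: "\<And>y. \<psi> y \<noteq> 0 \<Longrightarrow> r < (y - x0) \<bullet> v"
    let ?\<phi> = "\<lambda>y. \<psi> y *\<^sub>R v"
    have m\<psi> [measurable]: "\<psi> \<in> borel_measurable borel"
      using lipschitz_on_continuous_on[OF lip] by (rule borel_measurable_continuous_onI)
    have "L-lipschitz_on UNIV ?\<phi>"
      using lip v unfolding lipschitz_on_def by (simp add: dist_norm scaleR_diff_left[symmetric])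
    moreover have "compactly_supported ?\<phi>"
      unfolding compactly_supported_def compact_closure by (rule bounded_subset[OF bd]) auto
    ultimately have "?\<phi> \<in> Lip_c" by (auto simp: Lip_c_def)
    then have "(LINT x|lebesgue. f x * frac_div \<alpha> ?\<phi> x) = - vector_integral ?\<phi> D" by (rule eq)
    moreover have "(LINT x|lebesgue. f x * frac_div \<alpha> ?\<phi> x) = (LINT x|lborel. h x * frac_div \<alpha> ?\<phi> x)"
    proof -
      have m: "(\<lambda>x. h x * frac_div \<alpha> ?\<phi> x) \<in> borel_measurable lborel" by measurable
      have "(LINT x|lebesgue. f x * frac_div \<alpha> ?\<phi> x) = (LINT x|lebesgue. h x * frac_div \<alpha> ?\<phi> x)"
      proof (rule integral_cong_AE)
        show "(\<lambda>x. f x * frac_div \<alpha> ?\<phi> x) \<in> borel_measurable lebesgue"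
          using mf measurable_completion[of "frac_div \<alpha> ?\<phi>" lborel borel] by simp
        show "(\<lambda>x. h x * frac_div \<alpha> ?\<phi> x) \<in> borel_measurable lebesgue"
          by (rule measurable_completion[OF m])
        show "AE x in lebesgue. f x * frac_div \<alpha> ?\<phi> x = h x * frac_div \<alpha> ?\<phi> x"
          using fh by eventually_elim simp
      qed
      also have "\<dots> = (LINT x|lborel. h x * frac_div \<alpha> ?\<phi> x)" by (rule integral_completion[OF m])
      finally show ?thesis .
    qed
    moreover have "ennreal (- vector_integral ?\<phi> D) \<le> total_variation D ?K"
    proof (rule vector_integral_ge[OF D m\<psi> _ _ _ _ v])
      show "y \<in> ?K" if "\<psi> y \<noteq> 0" for y
      proof -
        have "r < (y - x0) \<bullet> v" by (rule supp[OF that])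
        also have "\<dots> \<le> norm (y - x0)" using norm_cauchy_schwarz[of "y - x0" v] v by simp
        finally show ?thesis by (simp add: dist_norm norm_minus_commute)
      qed
    qed (use \<psi> in auto)
    ultimately show "ennreal (LINT x|lborel. h x * frac_div \<alpha> ?\<phi> x) \<le> total_variation D ?K" by simp
  qed
  have "(\<integral>\<^sup>+x. ennreal (f x) * weight CARD('n) \<alpha> (norm (x - x0)) r \<partial>lebesgue) =
     (\<integral>\<^sup>+x. ennreal (h x) * weight CARD('n) \<alpha> (norm (x - x0)) r \<partial>lebesgue)"
  proof (rule nn_integral_cong_AE)
    show "AE x in lebesgue. ennreal (f x) * weight CARD('n) \<alpha> (norm (x - x0)) r = ennreal (h x) * weight CARD('n) \<alpha> (norm (x - x0)) r"
      using fh by eventually_elim simp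
  qed
  also have "\<dots> = (\<integral>\<^sup>+x. ennreal (h x) * weight CARD('n) \<alpha> (norm (x - x0)) r \<partial>lborel)"
    by (rule nn_integral_completion)
  also have "\<dots> \<le> total_variation D ?K"
    by (rule nn_integral_weight_le[OF \<alpha> mh h half])
  finally show "(\<integral>\<^sup>+x. ennreal (f x) * weight CARD('n) \<alpha> (norm (x - x0)) r \<partial>lebesgue) \<le> total_variation D ?K" .
qed

end
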